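(* Let $(M,g)$ be a generalized gravitational wave spacetime (see context) with least action $S:E\times E\to[-\infty,+\infty]$, and let $x=(e_1,y_1)\in M$, $e_1\in E$. Then $(M,g)$ is future distinguishing at $x$ if and only if $S(e_1,\cdot)$ is lower semi-continuous at $e_1$, and $(M,g)$ is past distinguishing at $x$ if and only if $S(\cdot,e_1)$ is lower semi-continuous at $e_1$.
   Context: Setting. $r\ge 2$; $Q$ is a connected $d$-dimensional ($C^{r+1}$, Hausdorff, paracompact, boundaryless) manifold; $T\subset\mathbb{R}$ is a connected interval, open because spacetimes are without boundary; $E=T\times Q$ with points $e=(t,q)$. On $Q$ there are given a time-dependent Riemannian metric $a_t$, a time-dependent 1-form $b_t$ and a function $V(t,q)$, all $C^r$ in $(t,q)\in E$. The Lagrangian is $L(t,q,v)=\frac12 a_t(v,v)+b_t(v)-V(t,q)$. The generalized gravitational wave spacetime is $M=T\times Q\times\mathbb{R}$ with points $x=(t,q,y)=(e,y)$ and Lorentzian metric (signature $(-,+,\dots,+)$) $g=a_t-dt\otimes(dy-b_t)-(dy-b_t)\otimes dt-2V\,dt^2$, time oriented by the timelike vector field $W=\partial_t-(V-\tfrac12)\partial_y$. Least action. For $e_0=(t_0,q_0)$, $e_1=(t_1,q_1)$ with $t_0<t_1$, $S(e_0,e_1)$ is the infimum of $\int_{t_0}^{t_1}L(t,q(t),\dot q(t))\,dt$ over the $C^1$ curves $q:[t_0,t_1]\to Q$ with $q(t_0)=q_0$, $q(t_1)=q_1$; $S(e_0,e_1)=0$ if $e_0=e_1$; $S(e_0,e_1)=+\infty$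 otherwise. $I^{\pm}(x)$ denotes the chronological future/past of $x$ (points reachable by future/past directed timelike curves). A spacetime is future (past) distinguishing at $x$ if $I^+(x)=I^+(z)$ (resp. $I^-(x)=I^-(z)$) implies $z=x$. *)

theory Defs
  imports "HOL-Analysis.Analysis"
begin

section \<open>Functions of class \<open>C\<^sup>k\<close>\<close>

text \<open>
  Meant for open \<open>S\<close>.  Derivatives are taken one direction at a time, so that the type does not
  change with the order; on a finite-dimensional domain this is the usual class \<open>C\<^sup>k\<close>.
\<close>

primrec Ck_on :: "nat \<Rightarrow> ('a::real_normed_vector \<Rightarrow> 'b::real_normed_vector) \<Rightarrow> 'a set \<Rightarrow> bool" where
  "Ck_on 0 f S \<longleftrightarrow> continuous_on S f"
| "Ck_on (Suc k) f S \<longleftrightarrow>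
     (\<forall>x\<in>S. f differentiable (at x)) \<and> (\<forall>v. Ck_on k (\<lambda>x. frechet_derivative f (at x) v) S)"

text \<open>
  One-sided derivatives at the end points of an interval; \<open>J\<close> will be a relatively open subset
  of a compact interval.
\<close>

definition C1_on :: "(real \<Rightarrow> 'b::real_normed_vector) \<Rightarrow> real set \<Rightarrow> bool" where
  "C1_on f J \<longleftrightarrow>
     (\<exists>D. (\<forall>s\<in>J. (f has_vector_derivative D s) (at s within J)) \<and> continuous_on J D)"

definition lsc_at_within :: "'a::topological_space set \<Rightarrow> ('a \<Rightarrow> ereal) \<Rightarrow> 'a \<Rightarrow> bool" where
  "lsc_at_within X f x \<longleftrightarrow> (\<forall>c<f x. \<forall>\<^sub>F z in at x within X. c < f z)"


section \<open>Manifolds\<close>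

text \<open>
  The manifold is the whole (Hausdorff) type \<open>'q\<close>.  A chart is a domain together with a coordinate
  map whose values outside the domain are irrelevant.  The model space \<open>'v\<close> is an inner product
  space with an orthonormal basis of \<open>d\<close> elements; class \<open>euclidean_space\<close> is not used because
  it excludes \<open>d = 0\<close>.
\<close>

type_synonym ('q, 'v) chart = "'q set \<times> ('q \<Rightarrow> 'v)"

abbreviation chart_inv :: "('q, 'v) chart \<Rightarrow> 'v \<Rightarrow> 'q" where
  "chart_inv c \<equiv> inv_into (fst c) (snd c)"

definition paracompact_space :: "'a topology \<Rightarrow> bool" where
  "paracompact_space X \<longleftrightarrow>
     (\<forall>\<U>. (\<forall>U\<in>\<U>. openin X U) \<and> \<Union>\<U> = topspace X \<longrightarrow>
        (\<exists>\<V>. (\<forall>V\<in>\<V>. openin X V) \<and> \<Union>\<V> = topspace X \<and>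
             (\<forall>V\<in>\<V>. \<exists>U\<in>\<U>. V \<subseteq> U) \<and> locally_finite_in X \<V>))"

definition euclidean_model :: "nat \<Rightarrow> 'v::real_inner itself \<Rightarrow> bool" where
  "euclidean_model d _ \<longleftrightarrow>
     (\<exists>B::'v set. finite B \<and> card B = d \<and> pairwise orthogonal B \<and> (\<forall>u\<in>B. norm u = 1) \<and>
        span B = UNIV)"

definition Ck_atlas :: "nat \<Rightarrow> ('q::topological_space, 'v::real_inner) chart set \<Rightarrow> bool" where
  "Ck_atlas k A \<longleftrightarrow>
     (\<Union>c\<in>A. fst c) = UNIV \<and>
     (\<forall>c\<in>A. open (fst c) \<and> open (snd c ` fst c) \<and>
        homeomorphism (fst c) (snd c ` fst c) (snd c) (chart_inv c)) \<and>
     (\<forall>c\<in>A. \<forall>c'\<in>A. Ck_on k (snd c' \<circ> chart_inv c) (snd c ` (fst c \<inter> fst c')))"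

definition manifold :: "nat \<Rightarrow> nat \<Rightarrow> ('q::t2_space, 'v::real_inner) chart set \<Rightarrow> bool" where
  "manifold k d A \<longleftrightarrow>
     euclidean_model d TYPE('v) \<and> Ck_atlas k A \<and> paracompact_space (euclidean :: 'q topology)"


section \<open>Tangent vectors\<close>

text \<open>
  A tangent vector at \<open>q\<close> is the family of its coordinate representatives in the charts around
  \<open>q\<close>, which are related by the derivatives of the chart changes.  Irrelevant entries are \<open>0\<close>,
  so that equality of tangent vectors is equality of functions.
\<close>

type_synonym ('q, 'v) tvec = "('q, 'v) chart \<Rightarrow> 'v"

definition tangent_space ::
  "('q::topological_space, 'v::real_inner) chart set \<Rightarrow> 'q \<Rightarrow> ('q, 'v) tvec set" where
  "tangent_space A q =
     {\<xi>. (\<forall>c. \<not> (c \<in> A \<and> q \<in> fst c) \<longrightarrow> \<xi> c = 0) \<and>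
          (\<forall>c\<in>A. \<forall>c'\<in>A. q \<in> fst c \<and> q \<in> fst c' \<longrightarrow>
             \<xi> c' = frechet_derivative (snd c' \<circ> chart_inv c) (at (snd c q)) (\<xi> c))}"

text \<open>The tangent vector at \<open>q\<close> whose representative in the chart \<open>c\<close> is \<open>u\<close>.\<close>

definition coord_vec ::
  "('q::topological_space, 'v::real_inner) chart set \<Rightarrow> ('q, 'v) chart \<Rightarrow> 'q \<Rightarrow> 'v \<Rightarrow> ('q, 'v) tvec" where
  "coord_vec A c q u =
     (\<lambda>c'. if c' \<in> A \<and> q \<in> fst c'
           then frechet_derivative (snd c' \<circ> chart_inv c) (at (snd c q)) u else 0)"

text \<open>Only the values of the fields below at \<open>t \<in> T\<close> and on tangent vectors at \<open>q\<close> matter.\<close>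

definition Ck_function ::
  "nat \<Rightarrow> real set \<Rightarrow> ('q::topological_space, 'v::real_inner) chart set \<Rightarrow> (real \<Rightarrow> 'q \<Rightarrow> real) \<Rightarrow> bool" where
  "Ck_function k T A f \<longleftrightarrow>
     (\<forall>c\<in>A. Ck_on k (\<lambda>(t, x). f t (chart_inv c x)) (T \<times> snd c ` fst c))"

definition Ck_one_form ::
  "nat \<Rightarrow> real set \<Rightarrow> ('q::topological_space, 'v::real_inner) chart set \<Rightarrow>
     (real \<Rightarrow> 'q \<Rightarrow> ('q, 'v) tvec \<Rightarrow> real) \<Rightarrow> bool" where
  "Ck_one_form k T A b \<longleftrightarrow>
     (\<forall>t\<in>T. \<forall>q. \<forall>\<xi>\<in>tangent_space A q. \<forall>\<eta>\<in>tangent_space A q. \<forall>m n.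
        b t q (\<lambda>c. m *\<^sub>R \<xi> c + n *\<^sub>R \<eta> c) = m * b t q \<xi> + n * b t q \<eta>) \<and>
     (\<forall>c\<in>A. \<forall>u.
        Ck_on k (\<lambda>(t, x). b t (chart_inv c x) (coord_vec A c (chart_inv c x) u))
          (T \<times> snd c ` fst c))"

definition Ck_riemannian_metric ::
  "nat \<Rightarrow> real set \<Rightarrow> ('q::topological_space, 'v::real_inner) chart set \<Rightarrow>
     (real \<Rightarrow> 'q \<Rightarrow> ('q, 'v) tvec \<Rightarrow> ('q, 'v) tvec \<Rightarrow> real) \<Rightarrow> bool" where
  "Ck_riemannian_metric k T A a \<longleftrightarrow>
     (\<forall>t\<in>T. \<forall>q. \<forall>\<xi>\<in>tangent_space A q. \<forall>\<eta>\<in>tangent_space A q.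
        a t q \<xi> \<eta> = a t q \<eta> \<xi> \<and>
        (\<xi> \<noteq> (\<lambda>_. 0) \<longrightarrow> a t q \<xi> \<xi> > 0) \<and>
        (\<forall>\<zeta>\<in>tangent_space A q. \<forall>m n.
           a t q (\<lambda>c. m *\<^sub>R \<xi> c + n *\<^sub>R \<eta> c) \<zeta> = m * a t q \<xi> \<zeta> + n * a t q \<eta> \<zeta>)) \<and>
     (\<forall>c\<in>A. \<forall>u w.
        Ck_on k (\<lambda>(t, x). a t (chart_inv c x) (coord_vec A c (chart_inv c x) u)
                                               (coord_vec A c (chart_inv c x) w))
          (T \<times> snd c ` fst c))"


section \<open>Curves and least action\<close>

definition C1_curve ::
  "('q::topological_space, 'v::real_inner) chart set \<Rightarrow> (real \<Rightarrow> 'q) \<Rightarrow> real set \<Rightarrow> bool" where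
  "C1_curve A \<gamma> I \<longleftrightarrow>
     continuous_on I \<gamma> \<and> (\<forall>c\<in>A. C1_on (snd c \<circ> \<gamma>) {s\<in>I. \<gamma> s \<in> fst c})"

definition velocity ::
  "('q::topological_space, 'v::real_inner) chart set \<Rightarrow> (real \<Rightarrow> 'q) \<Rightarrow> real set \<Rightarrow> real \<Rightarrow> ('q, 'v) tvec" where
  "velocity A \<gamma> I s =
     (\<lambda>c. if c \<in> A \<and> \<gamma> s \<in> fst c then vector_derivative (snd c \<circ> \<gamma>) (at s within I) else 0)"

definition lagrangian ::
  "(real \<Rightarrow> 'q \<Rightarrow> ('q, 'v) tvec \<Rightarrow> ('q, 'v) tvec \<Rightarrow> real) \<Rightarrow> (real \<Rightarrow> 'q \<Rightarrow> ('q, 'v) tvec \<Rightarrow> real) \<Rightarrow>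
     (real \<Rightarrow> 'q \<Rightarrow> real) \<Rightarrow> real \<Rightarrow> 'q \<Rightarrow> ('q, 'v) tvec \<Rightarrow> real" where
  "lagrangian a b V t q \<xi> = 1/2 * a t q \<xi> \<xi> + b t q \<xi> - V t q"

definition least_action ::
  "('q::topological_space, 'v::real_inner) chart set \<Rightarrow>
     (real \<Rightarrow> 'q \<Rightarrow> ('q, 'v) tvec \<Rightarrow> ('q, 'v) tvec \<Rightarrow> real) \<Rightarrow> (real \<Rightarrow> 'q \<Rightarrow> ('q, 'v) tvec \<Rightarrow> real) \<Rightarrow>
     (real \<Rightarrow> 'q \<Rightarrow> real) \<Rightarrow> real \<times> 'q \<Rightarrow> real \<times> 'q \<Rightarrow> ereal" where
  "least_action A a b V = (\<lambda>(t0, q0) (t1, q1).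
     if t0 < t1 then
       INF \<gamma>\<in>{\<gamma>. C1_curve A \<gamma> {t0..t1} \<and> \<gamma> t0 = q0 \<and> \<gamma> t1 = q1}.
         ereal (integral {t0..t1} (\<lambda>t. lagrangian a b V t (\<gamma> t) (velocity A \<gamma> {t0..t1} t)))
     else if (t0, q0) = (t1, q1) then 0 else \<infinity>)"


section \<open>The spacetime\<close>

text \<open>
  Points of the spacetime are \<open>((t, q), y)\<close>, and its tangent vectors are
  written \<open>((\<tau>, \<xi>), \<eta>)\<close> according to the splitting of the tangent space of a product.
\<close>

type_synonym 'q point = "(real \<times> 'q) \<times> real"
type_synonym ('q, 'v) ptvec = "(real \<times> ('q, 'v) tvec) \<times> real"

definition spacetime :: "real set \<Rightarrow> 'q point set" where
  "spacetime T = (T \<times> UNIV) \<times> UNIV"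

definition gw_metric ::
  "(real \<Rightarrow> 'q \<Rightarrow> ('q, 'v) tvec \<Rightarrow> ('q, 'v) tvec \<Rightarrow> real) \<Rightarrow> (real \<Rightarrow> 'q \<Rightarrow> ('q, 'v) tvec \<Rightarrow> real) \<Rightarrow>
     (real \<Rightarrow> 'q \<Rightarrow> real) \<Rightarrow> 'q point \<Rightarrow> ('q, 'v) ptvec \<Rightarrow> ('q, 'v) ptvec \<Rightarrow> real" where
  "gw_metric a b V = (\<lambda>((t, q), y) ((\<tau>, \<xi>), \<eta>) ((\<tau>', \<xi>'), \<eta>').
     a t q \<xi> \<xi>' - \<tau> * (\<eta>' - b t q \<xi>') - (\<eta> - b t q \<xi>) * \<tau>' - 2 * V t q * \<tau> * \<tau>')"

definition orientation_field :: "(real \<Rightarrow> 'q \<Rightarrow> real) \<Rightarrow> 'q point \<Rightarrow> ('q, 'v::real_inner) ptvec" where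
  "orientation_field V = (\<lambda>((t, q), y). ((1, \<lambda>_. 0), - (V t q - 1/2)))"

definition spacetime_C1_curve ::
  "real set \<Rightarrow> ('q::topological_space, 'v::real_inner) chart set \<Rightarrow> (real \<Rightarrow> 'q point) \<Rightarrow> real set \<Rightarrow> bool" where
  "spacetime_C1_curve T A \<gamma> I \<longleftrightarrow>
     \<gamma> ` I \<subseteq> spacetime T \<and> C1_on (\<lambda>s. fst (fst (\<gamma> s))) I \<and>
     C1_curve A (\<lambda>s. snd (fst (\<gamma> s))) I \<and> C1_on (\<lambda>s. snd (\<gamma> s)) I"

definition spacetime_velocity ::
  "('q::topological_space, 'v::real_inner) chart set \<Rightarrow> (real \<Rightarrow> 'q point) \<Rightarrow> real set \<Rightarrow> real \<Rightarrow>
     ('q, 'v) ptvec" where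
  "spacetime_velocity A \<gamma> I s =
     ((vector_derivative (\<lambda>s. fst (fst (\<gamma> s))) (at s within I),
       velocity A (\<lambda>s. snd (fst (\<gamma> s))) I s),
      vector_derivative (\<lambda>s. snd (\<gamma> s)) (at s within I))"

text \<open>
  In signature \<open>(-,+,\<dots>,+)\<close> a timelike vector is future directed iff its product with the
  orientation field is negative.
\<close>

definition future_timelike_curve where
  "future_timelike_curve T A a b V \<gamma> I \<longleftrightarrow>
     spacetime_C1_curve T A \<gamma> I \<and>
     (\<forall>s\<in>I. let X = spacetime_velocity A \<gamma> I s in
        gw_metric a b V (\<gamma> s) X X < 0 \<and> gw_metric a b V (\<gamma> s) (orientation_field V (\<gamma> s)) X < 0)"

definition past_timelike_curve where
  "past_timelike_curve T A a b V \<gamma> I \<longleftrightarrow>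
     spacetime_C1_curve T A \<gamma> I \<and>
     (\<forall>s\<in>I. let X = spacetime_velocity A \<gamma> I s in
        gw_metric a b V (\<gamma> s) X X < 0 \<and> gw_metric a b V (\<gamma> s) (orientation_field V (\<gamma> s)) X > 0)"

definition chron_future where
  "chron_future T A a b V x =
     {z. \<exists>\<gamma> s0 s1. s0 < s1 \<and> future_timelike_curve T A a b V \<gamma> {s0..s1} \<and> \<gamma> s0 = x \<and> \<gamma> s1 = z}"

definition chron_past where
  "chron_past T A a b V x =
     {z. \<exists>\<gamma> s0 s1. s0 < s1 \<and> past_timelike_curve T A a b V \<gamma> {s0..s1} \<and> \<gamma> s0 = x \<and> \<gamma> s1 = z}"

definition future_distinguishing_at where
  "future_distinguishing_at T A a b V x \<longleftrightarrow>
     (\<forall>z\<in>spacetime T. chron_future T A a b V x = chron_future T A a b V z \<longrightarrow> z = x)"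

definition past_distinguishing_at where
  "past_distinguishing_at T A a b V x \<longleftrightarrow>
     (\<forall>z\<in>spacetime T. chron_past T A a b V x = chron_past T A a b V z \<longrightarrow> z = x)"

end

theory Submission
  imports Defs
begin

text \<open>
  A tangent vector \<open>((\<tau>, \<xi>), \<eta>)\<close> is timelike and future directed iff \<open>\<tau> > 0\<close> and
  \<open>\<eta> > \<tau> L(\<xi> / \<tau>)\<close>.  Hence timelike curves can be parametrised by \<open>t\<close>, and \<open>(e, y)\<close> lies in
  \<open>I\<^sup>+(e0, y0)\<close> iff \<open>e\<close> is later than \<open>e0\<close> and \<open>S(e0, e) < y - y0\<close>.  The function \<open>S\<close> satisfies the
  triangle inequality (corners of concatenated curves are rounded off at arbitrarily small cost), and
  \<open>{e'. e' \<noteq> e \<and> S(e', e) < y}\<close> is open.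

  If \<open>S(e1, z) < k\<close> with \<open>k < 0\<close> for points \<open>z\<close> arbitrarily close to \<open>e1\<close>, then inserting such a detour
  at the beginning of a curve shows that \<open>S(e1, e)\<close> is infinite for all \<open>e \<noteq> e1\<close>, so that
  \<open>(e1, y1)\<close> and \<open>(e1, y1 + k)\<close> have the same future.

  Conversely, let \<open>(e1, y1)\<close> and \<open>(e2, y2)\<close> have the same future, so that \<open>t1 = t2\<close> and \<open>S(e1, \<cdot>)\<close> and
  \<open>S(e2, \<cdot>)\<close> differ by the constant \<open>y1 - y2\<close>.  If \<open>q1 \<noteq> q2\<close>, then in an arbitrarily short time one can
  travel from \<open>q1\<close> to \<open>q2\<close> and back to \<open>q1\<close> at bounded total cost.  But the last part of the way
  back, from a small sphere around \<open>q1\<close> to \<open>q1\<close>, is arbitrarily expensive because the Lagrangian is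
  superlinear in the velocity, so the part before it has very negative action, and it ends close to
  \<open>e1\<close>: this contradicts lower semicontinuity.  If \<open>q1 = q2\<close> and \<open>y1 \<noteq> y2\<close>, then \<open>S(e1, \<cdot>)\<close> takes only
  infinite values away from \<open>e1\<close>, with the same conclusion.

  The statement on the past follows by time reversal.
\<close>

section \<open>Curves of class \<open>C\<^sup>1\<close>\<close>

lemma Ck_on_imp_continuous_on: "Ck_on k f S \<Longrightarrow> continuous_on S f"
proof (cases k)
  case (Suc n)
  assume "Ck_on k f S"
  then have "\<forall>x\<in>S. f differentiable (at x)"
    using Suc by simp
  then show ?thesis
    by (simp add: continuous_at_imp_continuous_on differentiable_imp_continuous_within)
qed simp

text \<open>The difference of \<open>v\<close> and its expansion is orthogonal to \<open>B\<close>,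
  hence to \<open>span B = UNIV\<close>, hence to itself. The expansion replaces coordinates
  throughout; an empty \<open>B\<close> covers \<open>d = 0\<close>.\<close>

lemma euclidean_model_expansion:
  assumes "euclidean_model d TYPE('v::real_inner)"
  obtains B :: "'v::real_inner set" where "finite B" "\<And>u. u \<in> B \<Longrightarrow> norm u = 1"
    "\<And>v. (\<Sum>u\<in>B. (v \<bullet> u) *\<^sub>R u) = v"
proof -
  obtain B :: "'v::real_inner set" where B: "finite B" "pairwise orthogonal B" "\<forall>u\<in>B. norm u = 1" "span B = UNIV"
    using assms unfolding euclidean_model_def by blast
  have "(\<Sum>u\<in>B. (v \<bullet> u) *\<^sub>R u) = v" for v
  proof -
    define w where "w = v - (\<Sum>u\<in>B. (v \<bullet> u) *\<^sub>R u)"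
    have "w \<bullet> u = 0" if "u \<in> B" for u
    proof -
      have "(\<Sum>u'\<in>B. (v \<bullet> u') *\<^sub>R u') \<bullet> u = (\<Sum>u'\<in>B. (v \<bullet> u') * (u' \<bullet> u))"
        by (simp add: inner_sum_left)
      also have "\<dots> = (\<Sum>u'\<in>B. if u' = u then v \<bullet> u else 0)"
        using B(2,3) that by (intro sum.cong) (auto simp: pairwise_def orthogonal_def dot_square_norm)
      also have "\<dots> = v \<bullet> u"
        using B(1) that by simp
      finally show ?thesis
        by (simp add: w_def inner_diff_left)
    qed
    then have "orthogonal w w"
      using orthogonal_to_span[of w B w] B(4) by (auto simp: orthogonal_def)
    then show ?thesis
      by (simp add: w_def orthogonal_def)
  qed
  then show ?thesis
    using that B by blast
qed

section \<open>One-sided derivatives: localization, reparametrization and gluing\<close>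

lemma at_within_Icc_neq_bot: "s0 < s1 \<Longrightarrow> s \<in> {s0..s1::real} \<Longrightarrow> at s within {s0..s1} \<noteq> bot"
  by (auto simp: trivial_limit_within intro!: islimpt_closure_open[where s="{s0<..<s1}"])

text \<open>\<open>C1_curve\<close> differentiates within the set of parameters that lie in a chart
  domain, \<open>velocity\<close> within the whole interval. That set is relatively open, so the two
  filters agree.\<close>

lemma at_within_preimage:
  assumes "continuous_on I \<gamma>" "open U" "s \<in> I" "\<gamma> s \<in> U"
  shows "at s within {s\<in>I. \<gamma> s \<in> U} = at s within I"
proof -
  obtain S where "open S" "S \<inter> I = \<gamma> -` U \<inter> I"
    using assms(1,2) unfolding continuous_on_open_invariant by blast
  then show ?thesis
    using assms(3,4) by (intro at_within_nhd[of s S]) auto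
qed

lemma vector_derivative_reparam:
  assumes "(f has_vector_derivative f') (at (\<sigma> s) within I)"
    and "(\<sigma> has_vector_derivative \<sigma>') (at s within J)" and "\<sigma> ` J \<subseteq> I"
  shows "(f \<circ> \<sigma> has_vector_derivative \<sigma>' *\<^sub>R f') (at s within J)"
  using assms by (intro vector_diff_chain_within has_vector_derivative_within_subset[OF assms(1)]) auto

text \<open>\<open>J1\<close> and \<open>J2\<close> will be the parameters at which two adjacent
  curves lie in one chart domain; they need not be intervals, and the junction \<open>m\<close>
  belongs to both or to neither. Off \<open>m\<close> only one piece is visible locally; at
  \<open>m\<close> a limit within a union is a limit within both pieces.\<close>

lemma has_vector_derivative_glue:
  fixes f g :: "real \<Rightarrow> 'b::real_normed_vector"
  assumes J: "J1 \<subseteq> {..m}" "J2 \<subseteq> {m..}"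
    and f: "\<And>s. s \<in> J1 \<Longrightarrow> (f has_vector_derivative f' s) (at s within J1)"
    and g: "\<And>s. s \<in> J2 \<Longrightarrow> (g has_vector_derivative g' s) (at s within J2)"
    and m: "m \<in> J1 \<longleftrightarrow> m \<in> J2" "m \<in> J1 \<Longrightarrow> f m = g m" "m \<in> J1 \<Longrightarrow> f' m = g' m"
    and s: "s \<in> J1 \<union> J2"
  shows "((\<lambda>s. if s \<le> m then f s else g s) has_vector_derivative (if s \<le> m then f' s else g' s))
     (at s within J1 \<union> J2)" (is "(?h has_vector_derivative _) _")
proof -
  consider "s < m" | "m < s" | "s = m" by linarith
  then show ?thesis
  proof cases
    case 1
    then have "s \<in> J1" using s J by auto
    then have "(f has_vector_derivative f' s) (at s within J1)" by (rule f)
    moreover have "at s within J1 = at s within J1 \<union> J2"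
      using 1 J by (intro at_within_nhd[of s "{..<m}"]) auto
    ultimately have "(f has_vector_derivative f' s) (at s within J1 \<union> J2)"
      by simp
    then have "(?h has_vector_derivative f' s) (at s within J1 \<union> J2)"
      by (rule has_vector_derivative_transform_within[where d="m - s"])
        (use 1 s in \<open>auto simp: dist_real_def\<close>)
    then show ?thesis using 1 by simp
  next
    case 2
    then have "s \<in> J2" using s J by auto
    then have "(g has_vector_derivative g' s) (at s within J2)" by (rule g)
    moreover have "at s within J2 = at s within J1 \<union> J2"
      using 2 J by (intro at_within_nhd[of s "{m<..}"]) auto
    ultimately have "(g has_vector_derivative g' s) (at s within J1 \<union> J2)"
      by simp
    then have "(?h has_vector_derivative g' s) (at s within J1 \<union> J2)"
      by (rule has_vector_derivative_transform_within[where d="s - m"])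
        (use 2 s in \<open>auto simp: dist_real_def\<close>)
    then show ?thesis using 2 by simp
  next
    case 3
    then have mm: "m \<in> J1" "m \<in> J2" using s m(1) by auto
    have 1: "(?h has_vector_derivative f' m) (at m within J1)"
      using J mm by (intro has_vector_derivative_transform[OF _ _ f]) auto
    have "?h s = g s" if "s \<in> J2" for s
      using J that m(2) mm by force
    then have 2: "(?h has_vector_derivative g' m) (at m within J2)"
      using mm by (intro has_vector_derivative_transform[OF _ _ g]) auto
    show ?thesis
      using 1 2 m(3)[OF mm(1)] 3
      by (simp add: has_vector_derivative_def has_derivative_within Lim_within_Un)
  qed
qed

lemma continuous_on_glue:
  fixes f :: "real \<Rightarrow> 'b::topological_space"
  assumes J: "J1 \<subseteq> {..m}" "J2 \<subseteq> {m..}"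
    and "continuous_on J1 f" "continuous_on J2 g"
    and m: "m \<in> J1 \<longleftrightarrow> m \<in> J2" "m \<in> J1 \<Longrightarrow> f m = g m"
  shows "continuous_on (J1 \<union> J2) (\<lambda>s. if s \<le> m then f s else g s)"
proof -
  have eq: "x = m" if "x \<in> J1 \<and> m \<le> x \<or> x \<in> J2 \<and> x \<le> m" for x
    using that J by (meson atLeast_iff atMost_iff order.antisym subsetD)
  have 1: "J1 = (J1 \<union> J2) \<inter> {..m}" and 2: "J2 = (J1 \<union> J2) \<inter> {m..}"
    using J m(1) eq by blast+
  have "closedin (top_of_set (J1 \<union> J2)) J1" 
    by (subst (2) 1, rule closedin_closed_Int) simp
  moreover have "closedin (top_of_set (J1 \<union> J2)) J2" 
    by (subst (2) 2, rule closedin_closed_Int) simp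
  moreover have "f x = g x" if "x \<in> J1 \<and> \<not> x \<le> m \<or> x \<in> J2 \<and> x \<le> m" for x
  proof -
    have "x = m" using that eq[of x] by linarith
    then show ?thesis using that m by auto
  qed
  ultimately show ?thesis
    using assms(3,4) by (intro continuous_on_cases_local) auto
qed

section \<open>Calculus of curves in an atlas\<close>

lemma C1_curveI:
  assumes "s0 < s1" "\<forall>c\<in>A. open (fst c)" "continuous_on {s0..s1} \<gamma>"
    and v: "\<And>c s. c \<in> A \<Longrightarrow> s \<in> {s0..s1} \<Longrightarrow> \<gamma> s \<in> fst c \<Longrightarrow>
           (snd c \<circ> \<gamma> has_vector_derivative v s c) (at s within {s0..s1})"
    and "\<And>c. c \<in> A \<Longrightarrow> continuous_on {s\<in>{s0..s1}. \<gamma> s \<in> fst c} (\<lambda>s. v s c)"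
  shows "C1_curve A \<gamma> {s0..s1}"
    and "\<And>c s. c \<in> A \<Longrightarrow> s \<in> {s0..s1} \<Longrightarrow> \<gamma> s \<in> fst c \<Longrightarrow> velocity A \<gamma> {s0..s1} s c = v s c"
proof -
  have "C1_on (snd c \<circ> \<gamma>) {s \<in> {s0..s1}. \<gamma> s \<in> fst c}" if "c \<in> A" for c
    unfolding C1_on_def
  proof (intro exI conjI ballI)
    show "continuous_on {s\<in>{s0..s1}. \<gamma> s \<in> fst c} (\<lambda>s. v s c)"
      using assms that by blast
    show "(snd c \<circ> \<gamma> has_vector_derivative v s c) (at s within {s \<in> {s0..s1}. \<gamma> s \<in> fst c})"
      if "s \<in> {s \<in> {s0..s1}. \<gamma> s \<in> fst c}" for s
      using that \<open>c \<in> A\<close> by (intro has_vector_derivative_within_subset[OF v]) auto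
  qed
  then show "C1_curve A \<gamma> {s0..s1}"
    using assms(3) by (simp add: C1_curve_def)
  show "velocity A \<gamma> {s0..s1} s c = v s c" if "c \<in> A" "s \<in> {s0..s1}" "\<gamma> s \<in> fst c" for c s
    using vector_derivative_within[OF at_within_Icc_neq_bot[OF assms(1) that(2)] v[OF that]] that
    by (simp add: velocity_def)
qed

lemma C1_curveD:
  fixes A :: "('q::topological_space, 'v::real_inner) chart set"
  assumes "s0 < s1" "\<forall>c\<in>A. open (fst c)" "C1_curve A \<gamma> {s0..s1}"
  shows "continuous_on {s0..s1} \<gamma>"
    and "\<And>c s. c \<in> A \<Longrightarrow> s \<in> {s0..s1} \<Longrightarrow> \<gamma> s \<in> fst c \<Longrightarrow>
           (snd c \<circ> \<gamma> has_vector_derivative velocity A \<gamma> {s0..s1} s c) (at s within {s0..s1})"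
    and "\<And>c. c \<in> A \<Longrightarrow> continuous_on {s\<in>{s0..s1}. \<gamma> s \<in> fst c} (\<lambda>s. velocity A \<gamma> {s0..s1} s c)"
proof -
  show cont: "continuous_on {s0..s1} \<gamma>"
    using assms(3) by (simp add: C1_curve_def)
  \<comment> \<open>\<open>C1_on\<close> only asserts that some continuous derivative exists in each
    chart. A choice makes these one family, which \<open>C1_curveI\<close> then identifies with
    \<open>velocity\<close>.\<close>
  define D where "D c = (SOME D :: real \<Rightarrow> 'v. (\<forall>s\<in>{s\<in>{s0..s1}. \<gamma> s \<in> fst c}. (snd c \<circ> \<gamma> has_vector_derivative D s)
         (at s within {s\<in>{s0..s1}. \<gamma> s \<in> fst c})) \<and> continuous_on {s\<in>{s0..s1}. \<gamma> s \<in> fst c} D)" for c :: "('q, 'v) chart"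
  have D: "(\<forall>s\<in>{s\<in>{s0..s1}. \<gamma> s \<in> fst c}. (snd c \<circ> \<gamma> has_vector_derivative D c s)
         (at s within {s\<in>{s0..s1}. \<gamma> s \<in> fst c})) \<and> continuous_on {s\<in>{s0..s1}. \<gamma> s \<in> fst c} (D c)"
    if "c \<in> A" for c
  proof -
    from assms(3) that have "C1_on (snd c \<circ> \<gamma>) {s\<in>{s0..s1}. \<gamma> s \<in> fst c}"
      by (simp add: C1_curve_def)
    then show ?thesis
      unfolding C1_on_def D_def by (rule someI_ex)
  qed
  have D1: "(snd c \<circ> \<gamma> has_vector_derivative D c s) (at s within {s0..s1})"
    if "c \<in> A" "s \<in> {s0..s1}" "\<gamma> s \<in> fst c" for c s
  proof -
    have "s \<in> {s\<in>{s0..s1}. \<gamma> s \<in> fst c}" using that by simp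
    then have "(snd c \<circ> \<gamma> has_vector_derivative D c s) (at s within {s\<in>{s0..s1}. \<gamma> s \<in> fst c})"
      using D[OF that(1)] by blast
    then show ?thesis
      by (simp only: at_within_preimage[OF cont bspec[OF assms(2) that(1)] that(2,3)])
  qed
  have D2: "continuous_on {s\<in>{s0..s1}. \<gamma> s \<in> fst c} (\<lambda>s. D c s)" if "c \<in> A" for c
    using D[OF that] by (rule conjunct2)
  have *: "velocity A \<gamma> {s0..s1} s c = D c s" if "c \<in> A" "s \<in> {s0..s1}" "\<gamma> s \<in> fst c" for c s
    by (rule C1_curveI(2)[where v="\<lambda>s c. D c s", OF assms(1,2) cont D1 D2 that])
  show "(snd c \<circ> \<gamma> has_vector_derivative velocity A \<gamma> {s0..s1} s c) (at s within {s0..s1})"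
    if "c \<in> A" "s \<in> {s0..s1}" "\<gamma> s \<in> fst c" for c s
    using *[OF that] D1[OF that] by simp
  show "continuous_on {s\<in>{s0..s1}. \<gamma> s \<in> fst c} (\<lambda>s. velocity A \<gamma> {s0..s1} s c)"
    if "c \<in> A" for c
    by (rule continuous_on_eq[OF D2[OF that]]) (simp add: *[OF that])
qed

lemma velocity_outside: "\<not> (c \<in> A \<and> \<gamma> s \<in> fst c) \<Longrightarrow> velocity A \<gamma> I s c = 0"
  by (auto simp: velocity_def)

text \<open>The chain rule in every chart. It is applied to inclusions of subintervals, to the
  change from the parameter of a timelike curve to the time \<open>t\<close>, and to the decreasing
  map \<open>uminus\<close> in time reversal.\<close>

lemma C1_curve_reparam:
  assumes "s0 < s1" "t0 < t1" and A: "\<forall>c\<in>A. open (fst c)"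
    and \<gamma>: "C1_curve A \<gamma> {s0..s1}"
    and \<sigma>: "\<And>t. t \<in> {t0..t1} \<Longrightarrow> (\<sigma> has_vector_derivative \<sigma>' t) (at t within {t0..t1})"
      "continuous_on {t0..t1} \<sigma>'" "\<sigma> ` {t0..t1} \<subseteq> {s0..s1}"
  shows "C1_curve A (\<gamma> \<circ> \<sigma>) {t0..t1}"
    and "\<And>t. t \<in> {t0..t1} \<Longrightarrow>
       velocity A (\<gamma> \<circ> \<sigma>) {t0..t1} t = (\<lambda>c. \<sigma>' t *\<^sub>R velocity A \<gamma> {s0..s1} (\<sigma> t) c)"
proof -
  note D = C1_curveD[OF assms(1) A \<gamma>]
  have \<sigma>c: "continuous_on {t0..t1} \<sigma>"
    using \<sigma>(1) by (meson continuous_on_eq_continuous_within has_vector_derivative_continuous)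
  let ?v = "\<lambda>t c. \<sigma>' t *\<^sub>R velocity A \<gamma> {s0..s1} (\<sigma> t) c"
  have 0: "continuous_on {t0..t1} (\<gamma> \<circ> \<sigma>)"
    by (intro continuous_on_compose continuous_on_subset[OF D(1)] \<sigma>c \<sigma>(3))
  have 1: "(snd c \<circ> (\<gamma> \<circ> \<sigma>) has_vector_derivative ?v t c) (at t within {t0..t1})"
    if "c \<in> A" "t \<in> {t0..t1}" "(\<gamma> \<circ> \<sigma>) t \<in> fst c" for c t
    unfolding o_assoc
    using that \<sigma>(3) by (intro vector_derivative_reparam[OF D(2)] \<sigma>) (simp_all add: image_subset_iff)
  have 2: "continuous_on {t\<in>{t0..t1}. (\<gamma> \<circ> \<sigma>) t \<in> fst c} (\<lambda>t. ?v t c)" if "c \<in> A" for c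
    using \<sigma>(3) 
    by (intro continuous_intros continuous_on_compose2[OF D(3)[OF that]] continuous_on_subset[OF \<sigma>c]
        continuous_on_subset[OF \<sigma>(2)]) (auto simp: image_subset_iff)
  show "C1_curve A (\<gamma> \<circ> \<sigma>) {t0..t1}"
    by (rule C1_curveI(1)[where v="?v", OF assms(2) A 0 1 2])
  show "velocity A (\<gamma> \<circ> \<sigma>) {t0..t1} t = (\<lambda>c. \<sigma>' t *\<^sub>R velocity A \<gamma> {s0..s1} (\<sigma> t) c)"
    if t: "t \<in> {t0..t1}" for t
  proof
    fix c
    show "velocity A (\<gamma> \<circ> \<sigma>) {t0..t1} t c = \<sigma>' t *\<^sub>R velocity A \<gamma> {s0..s1} (\<sigma> t) c"
    proof (cases "c \<in> A \<and> \<gamma> (\<sigma> t) \<in> fst c")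
      case True
      then show ?thesis
        using C1_curveI(2)[where v="?v", OF assms(2) A 0 1 2, of c t] t by (simp add: comp_def)
    next
      case False
      then show ?thesis by (simp add: velocity_outside)
    qed
  qed
qed

lemma C1_curve_subinterval:
  assumes "s0 \<le> t0" "t0 < t1" "t1 \<le> s1" "\<forall>c\<in>A. open (fst c)" "C1_curve A \<gamma> {s0..s1}"
  shows "C1_curve A \<gamma> {t0..t1}"
    and "\<And>t. t \<in> {t0..t1} \<Longrightarrow> velocity A \<gamma> {t0..t1} t = velocity A \<gamma> {s0..s1} t"
  using C1_curve_reparam[of s0 s1 t0 t1 A \<gamma> "\<lambda>t. t" "\<lambda>_. 1"] assms
  by (auto simp: o_def)

text \<open>Equal velocities at \<open>m\<close> are part of the hypotheses, which is why corners
  have to be removed before curves are concatenated.\<close>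

lemma C1_curve_glue:
  assumes "s0 < m" "m < s1" and A: "\<forall>c\<in>A. open (fst c)"
    and 1: "C1_curve A \<gamma>1 {s0..m}" and 2: "C1_curve A \<gamma>2 {m..s1}"
    and m: "\<gamma>1 m = \<gamma>2 m" "velocity A \<gamma>1 {s0..m} m = velocity A \<gamma>2 {m..s1} m"
  defines "\<gamma> \<equiv> \<lambda>s. if s \<le> m then \<gamma>1 s else \<gamma>2 s"
  shows "C1_curve A \<gamma> {s0..s1}"
    and "\<And>s. s \<in> {s0..m} \<Longrightarrow> velocity A \<gamma> {s0..s1} s = velocity A \<gamma>1 {s0..m} s"
    and "\<And>s. s \<in> {m..s1} \<Longrightarrow> velocity A \<gamma> {s0..s1} s = velocity A \<gamma>2 {m..s1} s"
proof -
  note D1 = C1_curveD[OF assms(1) A 1] and D2 = C1_curveD[OF assms(2) A 2]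
  have I: "{s0..s1} = {s0..m} \<union> {m..s1}" using assms(1,2) by auto
  let ?v = "\<lambda>s. if s \<le> m then velocity A \<gamma>1 {s0..m} s else velocity A \<gamma>2 {m..s1} s"
  have s01: "s0 < s1" using assms by simp
  have c0: "continuous_on {s0..s1} \<gamma>"
    unfolding I \<gamma>_def using D1(1) D2(1) m assms(1,2) by (intro continuous_on_glue) auto
  \<comment> \<open>At \<open>s = m\<close> the definition of \<open>\<gamma>\<close> selects
    \<open>\<gamma>1\<close>; the parameter sets still match because the two curves agree
    there.\<close>
  have J: "{s\<in>{s0..s1}. \<gamma> s \<in> fst c} = {s\<in>{s0..m}. \<gamma>1 s \<in> fst c} \<union> {s\<in>{m..s1}. \<gamma>2 s \<in> fst c}" for c
  proof (intro equalityI subsetI)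
    fix s assume "s \<in> {s\<in>{s0..m}. \<gamma>1 s \<in> fst c} \<union> {s\<in>{m..s1}. \<gamma>2 s \<in> fst c}"
    then show "s \<in> {s\<in>{s0..s1}. \<gamma> s \<in> fst c}"
      using m(1) assms(1,2) by (cases "s = m") (auto simp: \<gamma>_def)
  qed (use assms(1,2) in \<open>auto simp: \<gamma>_def split: if_splits\<close>)
  have c1: "(snd c \<circ> \<gamma> has_vector_derivative ?v s c) (at s within {s0..s1})"
    if cs: "c \<in> A" "s \<in> {s0..s1}" "\<gamma> s \<in> fst c" for c s
  proof -
    have "((\<lambda>s. if s \<le> m then (snd c \<circ> \<gamma>1) s else (snd c \<circ> \<gamma>2) s) has_vector_derivative
        (if s \<le> m then velocity A \<gamma>1 {s0..m} s c else velocity A \<gamma>2 {m..s1} s c))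
        (at s within {s\<in>{s0..m}. \<gamma>1 s \<in> fst c} \<union> {s\<in>{m..s1}. \<gamma>2 s \<in> fst c})"
    proof (rule has_vector_derivative_glue)
      show "s \<in> {s\<in>{s0..m}. \<gamma>1 s \<in> fst c} \<union> {s\<in>{m..s1}. \<gamma>2 s \<in> fst c}"
        using cs unfolding J[symmetric] by auto
      show "(snd c \<circ> \<gamma>1 has_vector_derivative velocity A \<gamma>1 {s0..m} s c) (at s within {s \<in> {s0..m}. \<gamma>1 s \<in> fst c})" 
        if "s \<in> {s\<in>{s0..m}. \<gamma>1 s \<in> fst c}" for s
        using that by (intro has_vector_derivative_within_subset[OF D1(2)[OF cs(1)]]) auto
      show "(snd c \<circ> \<gamma>2 has_vector_derivative velocity A \<gamma>2 {m..s1} s c) (at s within {s \<in> {m..s1}. \<gamma>2 s \<in> fst c})" 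
        if "s \<in> {s\<in>{m..s1}. \<gamma>2 s \<in> fst c}" for s
        using that by (intro has_vector_derivative_within_subset[OF D2(2)[OF cs(1)]]) auto
    qed (use m assms(1,2) in auto)
    moreover have "(\<lambda>s. if s \<le> m then (snd c \<circ> \<gamma>1) s else (snd c \<circ> \<gamma>2) s) = snd c \<circ> \<gamma>"
      by (auto simp: \<gamma>_def)
    ultimately have "(snd c \<circ> \<gamma> has_vector_derivative ?v s c) (at s within {s\<in>{s0..s1}. \<gamma> s \<in> fst c})"
      unfolding J by (cases "s \<le> m") simp_all
    then show ?thesis
      by (simp only: at_within_preimage[OF c0 bspec[OF A cs(1)] cs(2,3)])
  qed
  have c2: "continuous_on {s\<in>{s0..s1}. \<gamma> s \<in> fst c} (\<lambda>s. ?v s c)" if "c \<in> A" for c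
  proof -
    have "continuous_on {s\<in>{s0..s1}. \<gamma> s \<in> fst c}
       (\<lambda>s. if s \<le> m then velocity A \<gamma>1 {s0..m} s c else velocity A \<gamma>2 {m..s1} s c)"
      unfolding J using D1(3)[OF that] D2(3)[OF that] m assms(1,2)
      by (intro continuous_on_glue) auto
    then show ?thesis by (simp add: if_distrib if_distribR cong: if_cong)
  qed
  show "C1_curve A \<gamma> {s0..s1}"
    by (rule C1_curveI(1)[where v="?v", OF s01 A c0 c1 c2])
  have *: "velocity A \<gamma> {s0..s1} s = ?v s" if s: "s \<in> {s0..s1}" for s
  proof
    fix c
    show "velocity A \<gamma> {s0..s1} s c = ?v s c"
    proof (cases "c \<in> A \<and> \<gamma> s \<in> fst c")
      case True
      then show ?thesis
        using C1_curveI(2)[where v="?v", OF s01 A c0 c1 c2, of c s] s by simp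
    next
      case False
      then show ?thesis by (auto simp: velocity_outside \<gamma>_def)
    qed
  qed
  then show "\<And>s. s \<in> {s0..m} \<Longrightarrow> velocity A \<gamma> {s0..s1} s = velocity A \<gamma>1 {s0..m} s"
    using assms(2) by auto
  show "velocity A \<gamma> {s0..s1} s = velocity A \<gamma>2 {m..s1} s" if "s \<in> {m..s1}" for s
    using * that m(2) assms(1,2) by (cases "s = m") auto
qed

text \<open>The inverse function theorem in one dimension, with one-sided derivatives at the ends;
  it makes the time component of a timelike curve its parameter. The inverse is continuous by
  compactness, and its difference quotients are reciprocals of those of \<open>f\<close>.\<close>

lemma increasing_C1_inverse:
  fixes f :: "real \<Rightarrow> real"
  assumes "s0 < s1"
    and f: "\<forall>s\<in>{s0..s1}. (f has_vector_derivative D s) (at s within {s0..s1})"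
    and D: "continuous_on {s0..s1} D" "\<forall>s\<in>{s0..s1}. D s > 0"
  obtains \<sigma> where "f s0 < f s1" "\<sigma> (f s0) = s0" "\<sigma> (f s1) = s1" "\<sigma> ` {f s0..f s1} \<subseteq> {s0..s1}"
    "\<And>t. t \<in> {f s0..f s1} \<Longrightarrow> f (\<sigma> t) = t"
    "\<And>t. t \<in> {f s0..f s1} \<Longrightarrow> (\<sigma> has_vector_derivative 1 / D (\<sigma> t)) (at t within {f s0..f s1})"
    "continuous_on {f s0..f s1} (\<lambda>t. 1 / D (\<sigma> t))"
proof -
  let ?I = "{s0..s1}"
  have fc: "continuous_on ?I f"
    using f by (meson continuous_on_eq_continuous_within has_vector_derivative_continuous)
  have mono: "f x < f y" if xy: "x \<in> ?I" "y \<in> ?I" "x < y" for x y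
  proof (rule DERIV_pos_imp_increasing_open[OF xy(3)])
    fix z assume z: "x < z" "z < y"
    have "(f has_real_derivative D z) (at z within ?I)"
      using f z xy by (simp add: has_real_derivative_iff_has_vector_derivative)
    moreover have "at z within ?I = at z"
      using z xy by (intro at_within_interior) (auto simp: interior_atLeastAtMost_real)
    ultimately show "\<exists>y. DERIV f z :> y \<and> y > 0"
      using D(2) z xy by auto
  next
    show "continuous_on {x..y} f"
      using xy by (intro continuous_on_subset[OF fc]) auto
  qed
  have inj: "inj_on f ?I"
    by (rule inj_onI) (metis linorder_neqE_linordered_idom mono order_less_irrefl)
  define \<sigma> where "\<sigma> = inv_into ?I f"
  let ?J = "{f s0..f s1}"
  have f01: "f s0 < f s1" using mono assms(1) by simp
  have img: "f ` ?I = ?J"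
  proof (intro equalityI subsetI)
    fix y assume "y \<in> f ` ?I"
    then obtain x where x: "x \<in> ?I" "y = f x" by blast
    then show "y \<in> ?J"
      using mono[of s0 x] mono[of x s1] assms(1) by (cases "x = s0"; cases "x = s1") auto
  next
    fix y assume "y \<in> ?J"
    then obtain x where "s0 \<le> x" "x \<le> s1" "f x = y"
      using IVT'[of f s0 y s1] fc assms(1) by auto
    then show "y \<in> f ` ?I" by auto
  qed
  have \<sigma>f: "\<sigma> (f s) = s" if "s \<in> ?I" for s
    unfolding \<sigma>_def using inj that by (rule inv_into_f_f)
  have f\<sigma>: "f (\<sigma> t) = t" and \<sigma>_in: "\<sigma> t \<in> ?I" if "t \<in> ?J" for t
  proof -
    have "t \<in> f ` ?I" using that img by simp
    then show "f (\<sigma> t) = t" "\<sigma> t \<in> ?I"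
      unfolding \<sigma>_def by (rule f_inv_into_f, rule inv_into_into)
  qed
  have \<sigma>c: "continuous_on ?J \<sigma>"
    unfolding img[symmetric] using \<sigma>f by (intro continuous_on_inv fc compact_Icc) auto
  have deriv: "(\<sigma> has_vector_derivative 1 / D (\<sigma> t)) (at t within ?J)" if t: "t \<in> ?J" for t
  proof -
    have "((\<lambda>r. (f r - f (\<sigma> t)) / (r - \<sigma> t)) \<longlongrightarrow> D (\<sigma> t)) (at (\<sigma> t) within ?I)"
      using f \<sigma>_in[OF t] by (simp add: has_field_derivative_iff flip: has_real_derivative_iff_has_vector_derivative)
    \<comment> \<open>To compose the limits, \<open>\<sigma> u\<close> must approach
      \<open>\<sigma> t\<close> without attaining it; this follows from
      \<open>f (\<sigma> u) = u\<close>.\<close>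
    moreover have "filterlim \<sigma> (at (\<sigma> t) within ?I) (at t within ?J)"
      unfolding filterlim_at
    proof
      show "\<forall>\<^sub>F u in at t within ?J. \<sigma> u \<in> ?I \<and> \<sigma> u \<noteq> \<sigma> t"
        using \<sigma>_in f\<sigma> t by (auto simp: eventually_at_filter intro!: always_eventually) metis
      show "(\<sigma> \<longlongrightarrow> \<sigma> t) (at t within ?J)"
        using \<sigma>c t by (simp add: continuous_on_def)
    qed
    ultimately have "((\<lambda>u. (f (\<sigma> u) - f (\<sigma> t)) / (\<sigma> u - \<sigma> t)) \<longlongrightarrow> D (\<sigma> t)) (at t within ?J)"
      by (rule filterlim_compose)
    then have "((\<lambda>u. inverse ((f (\<sigma> u) - f (\<sigma> t)) / (\<sigma> u - \<sigma> t))) \<longlongrightarrow> inverse (D (\<sigma> t))) (at t within ?J)"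
      using D(2) \<sigma>_in[OF t] by (intro tendsto_inverse) force+
    moreover have "\<forall>\<^sub>F u in at t within ?J. inverse ((f (\<sigma> u) - f (\<sigma> t)) / (\<sigma> u - \<sigma> t)) = (\<sigma> u - \<sigma> t) / (u - t)"
      using f\<sigma> t by (simp add: eventually_at_filter)
    ultimately have "((\<lambda>u. (\<sigma> u - \<sigma> t) / (u - t)) \<longlongrightarrow> inverse (D (\<sigma> t))) (at t within ?J)"
      by (rule Lim_transform_eventually)
    then show ?thesis
      by (simp add: has_field_derivative_iff inverse_eq_divide flip: has_real_derivative_iff_has_vector_derivative)
  qed
  show ?thesis
  proof (rule that[OF f01 _ _ _ f\<sigma> deriv])
    show "\<sigma> (f s0) = s0" "\<sigma> (f s1) = s1" using assms(1) by (simp_all add: \<sigma>f)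
    show sub: "\<sigma> ` ?J \<subseteq> ?I" using \<sigma>_in by blast
    have "\<forall>t\<in>?J. D (\<sigma> t) \<noteq> 0"
      using D(2) \<sigma>_in by force
    then show "continuous_on ?J (\<lambda>t. 1 / D (\<sigma> t))"
      by (intro continuous_on_divide continuous_on_const continuous_on_compose2[OF D(1) \<sigma>c sub]) auto
  qed
qed

text \<open>\<open>P\<close> will be the relation \<open>conn\<close>, which describes the least
  action only off the diagonal. Since \<open>f x = 0\<close> and \<open>P x k\<close> fails for
  negative \<open>k\<close>, the neighbourhoods on the right need not be punctured.\<close>

lemma lsc_at_within_zero_iff:
  fixes f :: "'a::topological_space \<Rightarrow> ereal"
  assumes "f x = 0" and P: "\<And>z k. z \<noteq> x \<Longrightarrow> f z < ereal k \<longleftrightarrow> P z k" "\<And>k. k < 0 \<Longrightarrow> \<not> P x k"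
  shows "lsc_at_within X f x \<longleftrightarrow> (\<forall>k<0. \<exists>N. open N \<and> x \<in> N \<and> (\<forall>z\<in>N. z \<in> X \<longrightarrow> \<not> P z k))"
proof
  assume lsc: "lsc_at_within X f x"
  show "\<forall>k<0. \<exists>N. open N \<and> x \<in> N \<and> (\<forall>z\<in>N. z \<in> X \<longrightarrow> \<not> P z k)"
  proof (intro allI impI)
    fix k :: real assume k: "k < 0"
    then have "\<forall>\<^sub>F z in at x within X. ereal k < f z"
      using lsc assms(1) by (simp add: lsc_at_within_def)
    then obtain N where N: "open N" "x \<in> N" "\<And>z. z \<in> N \<Longrightarrow> z \<noteq> x \<Longrightarrow> z \<in> X \<Longrightarrow> ereal k < f z"
      unfolding eventually_at_topological by blast
    have "\<not> P z k" if z: "z \<in> N" "z \<in> X" for z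
    proof (cases "z = x")
      case False
      show ?thesis using N(3)[OF z(1) False z(2)] P(1)[OF False, of k] by (auto dest: order.asym)
    qed (use P(2)[OF k] in simp)
    then show "\<exists>N. open N \<and> x \<in> N \<and> (\<forall>z\<in>N. z \<in> X \<longrightarrow> \<not> P z k)"
      using N(1,2) by blast
  qed
next
  assume h: "\<forall>k<0. \<exists>N. open N \<and> x \<in> N \<and> (\<forall>z\<in>N. z \<in> X \<longrightarrow> \<not> P z k)"
  show "lsc_at_within X f x"
    unfolding lsc_at_within_def
  proof (intro allI impI)
    fix c assume "c < f x"
    then obtain k where k: "c < ereal k" "k < 0"
      using ereal_dense2[of c 0] assms(1) by auto
    obtain N where N: "open N" "x \<in> N" "\<forall>z\<in>N. z \<in> X \<longrightarrow> \<not> P z k"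
      using h k(2) by blast
    have "c < f z" if z: "z \<in> N" "z \<noteq> x" "z \<in> X" for z
    proof -
      have "\<not> f z < ereal k" using N(3) P(1)[OF z(2)] z by blast
      then show ?thesis using k(1) by (meson leI less_le_trans)
    qed
    then show "\<forall>\<^sub>F z in at x within X. c < f z"
      unfolding eventually_at_topological using N(1,2) by blast
  qed
qed

section \<open>Manifolds of class \<open>C\<^sup>1\<close>\<close>

text \<open>The data of a C^1 atlas in the form in which they are used. Unit vectors that satisfy
  the expansion formula are automatically orthonormal, so \<open>B\<close> is an orthonormal
  basis.\<close>

locale C1_manifold =
  fixes A :: "('q::t2_space, 'v::real_inner) chart set" and B :: "'v set"
  assumes finite_B: "finite B" and norm_B: "\<And>u. u \<in> B \<Longrightarrow> norm u = 1"
    and expand_B: "\<And>v. (\<Sum>u\<in>B. (v \<bullet> u) *\<^sub>R u) = v"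
    and chart_cover: "\<And>q. \<exists>c\<in>A. q \<in> fst c"
    and open_dom: "\<forall>c\<in>A. open (fst c)"
    and open_img: "\<And>c. c \<in> A \<Longrightarrow> open (snd c ` fst c)"
    and chart_homeo: "\<And>c. c \<in> A \<Longrightarrow> homeomorphism (fst c) (snd c ` fst c) (snd c) (chart_inv c)"
    and trans_differentiable: "\<And>c c' x. c \<in> A \<Longrightarrow> c' \<in> A \<Longrightarrow> x \<in> snd c ` (fst c \<inter> fst c') \<Longrightarrow>
        (snd c' \<circ> chart_inv c) differentiable (at x)"
    and trans_C1: "\<And>c c' v. c \<in> A \<Longrightarrow> c' \<in> A \<Longrightarrow>
        continuous_on (snd c ` (fst c \<inter> fst c')) (\<lambda>x. frechet_derivative (snd c' \<circ> chart_inv c) (at x) v)"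
begin

section \<open>Linear maps and compact balls in the model space\<close>

lemma linear_expand:
  fixes f :: "'v \<Rightarrow> 'b::real_vector"
  assumes "linear f"
  shows "f v = (\<Sum>u\<in>B. (v \<bullet> u) *\<^sub>R f u)"
proof -
  have "f v = f (\<Sum>u\<in>B. (v \<bullet> u) *\<^sub>R u)"
    by (simp add: expand_B)
  also have "\<dots> = (\<Sum>u\<in>B. f ((v \<bullet> u) *\<^sub>R u))"
    by (rule linear_sum[OF assms])
  finally show ?thesis
    by (simp add: linear_scale[OF assms])
qed

text \<open>A ball is a closed subset of a box of linear combinations with bounded coefficients.
  Boxes are compact by induction on the set of vectors, as continuous images of products with an
  interval.\<close>

lemma compact_cball_model: "compact (cball (z::'v) R)"
proof -
  have box: "compact {\<Sum>u\<in>C. f u *\<^sub>R u |f. \<forall>u. \<bar>f u\<bar> \<le> R}" if "finite C" for C :: "'v set" and R :: real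
    using that
  proof (induction C)
    case empty
    have "{\<Sum>u\<in>{}. f u *\<^sub>R u |f. \<forall>u. \<bar>f u\<bar> \<le> R} = (if 0 \<le> R then {0::'v} else {})"
      by (auto intro: exI[of _ "\<lambda>_. 0"] order.trans[OF abs_ge_zero])
    then show ?case
      by simp
  next
    case (insert w C)
    let ?K = "\<lambda>C. {\<Sum>u\<in>C. f u *\<^sub>R u |f. \<forall>u. \<bar>f u\<bar> \<le> R}"
    have "?K (insert w C) = (\<lambda>(s, x). s *\<^sub>R w + x) ` ({-R..R} \<times> ?K C)" (is "_ = ?r")
    proof (intro equalityI subsetI)
      fix x assume "x \<in> ?K (insert w C)"
      then obtain f where f: "x = (\<Sum>u\<in>insert w C. f u *\<^sub>R u)" "\<forall>u. \<bar>f u\<bar> \<le> R" by blast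
      then have "\<bar>f w\<bar> \<le> R" by blast
      then have "f w \<in> {-R..R}" by auto
      then show "x \<in> ?r"
        using insert(1,2) f by (intro image_eqI[of _ _ "(f w, \<Sum>u\<in>C. f u *\<^sub>R u)"]) auto
    next
      fix x assume "x \<in> ?r"
      then obtain s f where f: "x = s *\<^sub>R w + (\<Sum>u\<in>C. f u *\<^sub>R u)" "\<forall>u. \<bar>f u\<bar> \<le> R" "s \<in> {-R..R}"
        by (auto simp: case_prod_beta)
      have "(\<Sum>u\<in>C. f u *\<^sub>R u) = (\<Sum>u\<in>C. (f(w := s)) u *\<^sub>R u)"
        using insert(2) by (intro sum.cong) auto
      then have "x = (\<Sum>u\<in>insert w C. (f(w := s)) u *\<^sub>R u)"
        using insert(1,2) f(1) by simp
      moreover have "\<forall>u. \<bar>(f(w := s)) u\<bar> \<le> R"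
        using f by auto
      ultimately show "x \<in> ?K (insert w C)" by blast
    qed
    moreover have "compact ?r"
      using insert by (intro compact_continuous_image compact_Times)
        (auto simp: case_prod_beta intro!: continuous_intros)
    ultimately show ?case by simp
  qed
  have "cball z R \<subseteq> {\<Sum>u\<in>B. f u *\<^sub>R u |f. \<forall>u. \<bar>f u\<bar> \<le> norm z + R}"
  proof
    fix v assume "v \<in> cball z R"
    then have "norm v \<le> norm z + R"
      using norm_triangle_ineq2[of v z] by (simp add: dist_norm norm_minus_commute)
    moreover have "\<bar>v \<bullet> u\<bar> \<le> norm v" if "u \<in> B" for u
      using Cauchy_Schwarz_ineq2[of v u] norm_B[OF that] by simp
    \<comment> \<open>The box bounds the coefficients of all vectors, so the coefficient function is
      set to \<open>0\<close> off \<open>B\<close>.\<close>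
    moreover define f where "f u = (if u \<in> B then v \<bullet> u else 0)" for u
    ultimately have "\<forall>u. \<bar>f u\<bar> \<le> norm z + R"
      using order.trans[OF norm_ge_zero] by force
    moreover have "v = (\<Sum>u\<in>B. f u *\<^sub>R u)"
      using expand_B[of v] by (simp add: f_def)
    ultimately show "v \<in> {\<Sum>u\<in>B. f u *\<^sub>R u |f. \<forall>u. \<bar>f u\<bar> \<le> norm z + R}" by blast
  qed
  from Int_absorb1[OF this] show ?thesis
    using compact_Int_closed[OF box[OF finite_B] closed_cball[of z R], of "norm z + R"] by simp
qed

section \<open>Chart changes and tangent vectors\<close>

abbreviation trans :: "('q, 'v) chart \<Rightarrow> ('q, 'v) chart \<Rightarrow> 'v \<Rightarrow> 'v" where
  "trans c c' \<equiv> snd c' \<circ> chart_inv c"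

abbreviation dtrans :: "('q, 'v) chart \<Rightarrow> ('q, 'v) chart \<Rightarrow> 'v \<Rightarrow> 'v \<Rightarrow> 'v" where
  "dtrans c c' x \<equiv> frechet_derivative (trans c c') (at x)"

lemma chart_inv_left: "c \<in> A \<Longrightarrow> q \<in> fst c \<Longrightarrow> chart_inv c (snd c q) = q"
  using chart_homeo unfolding homeomorphism_def by blast

lemma chart_inv_right: "c \<in> A \<Longrightarrow> x \<in> snd c ` fst c \<Longrightarrow> snd c (chart_inv c x) = x"
  using chart_homeo unfolding homeomorphism_def by blast

lemma chart_inv_in: "x \<in> snd c ` fst c \<Longrightarrow> chart_inv c x \<in> fst c"
  by (rule inv_into_into)

lemma continuous_on_chart: "c \<in> A \<Longrightarrow> continuous_on (fst c) (snd c)"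
  using chart_homeo unfolding homeomorphism_def by blast

lemma continuous_on_chart_inv: "c \<in> A \<Longrightarrow> continuous_on (snd c ` fst c) (chart_inv c)"
  using chart_homeo unfolding homeomorphism_def by blast

lemma open_chart_image:
  assumes "c \<in> A" "open U" "U \<subseteq> fst c"
  shows "open (snd c ` U)"
proof -
  have "openin (top_of_set (snd c ` fst c)) (snd c ` U)"
    using assms by (intro homeomorphism_imp_open_map[OF chart_homeo]) (auto intro: open_subset)
  then show ?thesis
    using openin_open_trans open_img assms(1) by blast
qed

lemma open_chart_inv_image:
  assumes "c \<in> A" "open U" "U \<subseteq> snd c ` fst c"
  shows "open (chart_inv c ` U)"
proof -
  have "openin (top_of_set (fst c)) (chart_inv c ` U)"
    using assms by (intro homeomorphism_imp_open_map[OF homeomorphism_sym[THEN iffD1, OF chart_homeo]])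
      (auto intro: open_subset)
  then show ?thesis
    using openin_open_trans open_dom assms(1) by blast
qed

lemma open_overlap: "c \<in> A \<Longrightarrow> c' \<in> A \<Longrightarrow> open (snd c ` (fst c \<inter> fst c'))"
  using open_dom by (intro open_chart_image) auto

lemma trans_has_derivative:
  assumes "c \<in> A" "c' \<in> A" "q \<in> fst c" "q \<in> fst c'"
  shows "(trans c c' has_derivative dtrans c c' (snd c q)) (at (snd c q))"
  using trans_differentiable[OF assms(1,2)] assms(3,4) frechet_derivative_works by blast

lemma linear_dtrans:
  assumes "c \<in> A" "c' \<in> A" "q \<in> fst c" "q \<in> fst c'"
  shows "linear (dtrans c c' (snd c q))"
  using trans_has_derivative[OF assms] has_derivative_linear by blast

lemma dtrans_self:
  assumes "c \<in> A" "q \<in> fst c"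
  shows "dtrans c c (snd c q) = (\<lambda>v. v)"
proof -
  have "(trans c c has_derivative (\<lambda>v. v)) (at (snd c q))"
    using assms by (intro has_derivative_transform_within_open[OF has_derivative_ident open_img[OF assms(1)]])
      (auto simp: chart_inv_left)
  then show ?thesis
    using frechet_derivative_at by metis
qed

lemma dtrans_dtrans:
  assumes c: "c \<in> A" "c' \<in> A" "c'' \<in> A" and q: "q \<in> fst c" "q \<in> fst c'" "q \<in> fst c''"
  shows "dtrans c' c'' (snd c' q) (dtrans c c' (snd c q) v) = dtrans c c'' (snd c q) v"
proof -
  have eq: "trans c c' (snd c q) = snd c' q"
    using c q by (simp add: chart_inv_left)
  have "(trans c' c'' has_derivative dtrans c' c'' (snd c' q)) (at (trans c c' (snd c q)))"
    unfolding eq by (intro trans_has_derivative c q)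
  from diff_chain_at[OF trans_has_derivative[OF c(1,2) q(1,2)] this]
  have "(trans c c'' has_derivative dtrans c' c'' (snd c' q) \<circ> dtrans c c' (snd c q)) (at (snd c q))"
    by (rule has_derivative_transform_within_open[OF _ open_overlap[OF c(1,2)]])
      (use c q in \<open>auto simp: chart_inv_left\<close>)
  then show ?thesis
    using frechet_derivative_at by (metis comp_apply)
qed

lemma coord_vec_apply: "c' \<in> A \<Longrightarrow> q \<in> fst c' \<Longrightarrow> coord_vec A c q u c' = dtrans c c' (snd c q) u"
  by (simp add: coord_vec_def)

lemma coord_vec_self: "c \<in> A \<Longrightarrow> q \<in> fst c \<Longrightarrow> coord_vec A c q u c = u"
  by (simp add: coord_vec_apply dtrans_self)

lemma coord_vec_tangent: "c \<in> A \<Longrightarrow> q \<in> fst c \<Longrightarrow> coord_vec A c q u \<in> tangent_space A q"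
  unfolding tangent_space_def
proof (intro CollectI conjI allI impI ballI)
  fix c' assume "\<not> (c' \<in> A \<and> q \<in> fst c')"
  then show "coord_vec A c q u c' = 0"
    by (simp only: coord_vec_def if_False)
next
  fix c' c'' assume "c \<in> A" "q \<in> fst c" "c' \<in> A" "c'' \<in> A" "q \<in> fst c' \<and> q \<in> fst c''"
  then show "coord_vec A c q u c'' = dtrans c' c'' (snd c' q) (coord_vec A c q u c')"
    by (simp only: coord_vec_apply dtrans_dtrans)
qed

lemma tangent_eq_coord_vec:
  assumes "c \<in> A" "q \<in> fst c" "\<xi> \<in> tangent_space A q"
  shows "\<xi> = coord_vec A c q (\<xi> c)"
proof
  fix c'
  show "\<xi> c' = coord_vec A c q (\<xi> c) c'"
  proof (cases "c' \<in> A \<and> q \<in> fst c'")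
    case True
    then have "\<xi> c' = dtrans c c' (snd c q) (\<xi> c)"
      using assms unfolding tangent_space_def by blast
    then show ?thesis
      using True by (simp only: coord_vec_apply)
  next
    case False
    then have "\<xi> c' = 0"
      using assms(3) unfolding tangent_space_def by blast
    then show ?thesis
      using False by (simp only: coord_vec_def if_False)
  qed
qed

lemma coord_vec_lincomb:
  assumes "c \<in> A" "q \<in> fst c"
  shows "coord_vec A c q (m *\<^sub>R u + n *\<^sub>R w) = (\<lambda>c'. m *\<^sub>R coord_vec A c q u c' + n *\<^sub>R coord_vec A c q w c')"
proof
  fix c'
  show "coord_vec A c q (m *\<^sub>R u + n *\<^sub>R w) c' = m *\<^sub>R coord_vec A c q u c' + n *\<^sub>R coord_vec A c q w c'"
    using linear_dtrans[OF assms(1) _ assms(2), of c']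
    by (cases "c' \<in> A \<and> q \<in> fst c'") (auto simp: coord_vec_def linear_add linear_scale simp del: o_apply)
qed

text \<open>The chain rule for \<open>trans c c'\<close>. It is applied within the parameters that
  lie in both chart domains, where \<open>trans c c'\<close> after \<open>snd c\<close> agrees with
  \<open>snd c'\<close>; restricting to them leaves the filter unchanged.\<close>

lemma curve_change_chart:
  assumes c: "c \<in> A" "c' \<in> A" and q: "\<gamma> s \<in> fst c" "\<gamma> s \<in> fst c'" and "s \<in> I"
    and \<gamma>: "continuous_on I \<gamma>" "(snd c \<circ> \<gamma> has_vector_derivative v) (at s within I)"
  shows "(snd c' \<circ> \<gamma> has_vector_derivative dtrans c c' (snd c (\<gamma> s)) v) (at s within I)"
proof -
  let ?J = "{s\<in>I. \<gamma> s \<in> fst c \<inter> fst c'}"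
  have eq: "at s within ?J = at s within I"
    using assms open_dom by (intro at_within_preimage) auto
  have d: "(snd c \<circ> \<gamma> has_vector_derivative v) (at s within ?J)"
    unfolding eq by (rule \<gamma>(2))
  have "(trans c c' has_derivative dtrans c c' (snd c (\<gamma> s))) (at ((snd c \<circ> \<gamma>) s) within (snd c \<circ> \<gamma>) ` ?J)"
    using trans_has_derivative[OF c q] by (simp add: has_derivative_at_withinI)
  from vector_derivative_diff_chain_within[OF d this]
  have "(snd c' \<circ> \<gamma> has_vector_derivative dtrans c c' (snd c (\<gamma> s)) v) (at s within ?J)"
    by (rule has_vector_derivative_transform[rotated 2]) (use assms in \<open>auto simp: chart_inv_left\<close>)
  then show ?thesis
    by (simp only: eq)
qed

text \<open>By the chain rule and the uniqueness of derivatives the components obey the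
  transformation law, so the component in one chart determines the velocity.\<close>

lemma velocity_eq_coord_vec:
  assumes "s0 < s1" "C1_curve A \<gamma> {s0..s1}" "s \<in> {s0..s1}" "c \<in> A" "\<gamma> s \<in> fst c"
  shows "velocity A \<gamma> {s0..s1} s = coord_vec A c (\<gamma> s) (velocity A \<gamma> {s0..s1} s c)"
proof
  fix c'
  note D = C1_curveD[OF assms(1) open_dom assms(2)]
  show "velocity A \<gamma> {s0..s1} s c' = coord_vec A c (\<gamma> s) (velocity A \<gamma> {s0..s1} s c) c'"
  proof (cases "c' \<in> A \<and> \<gamma> s \<in> fst c'")
    case True
    have "velocity A \<gamma> {s0..s1} s c' = dtrans c c' (snd c (\<gamma> s)) (velocity A \<gamma> {s0..s1} s c)"
      using True assms
      by (intro vector_derivative_unique_within[OF at_within_Icc_neq_bot[OF assms(1,3)],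
            where f="snd c' \<circ> \<gamma>"] D(2) curve_change_chart D(1)) auto
    then show ?thesis
      using True by (simp add: coord_vec_apply)
  next
    case False
    then show ?thesis by (auto simp: velocity_outside coord_vec_def)
  qed
qed

lemma velocity_tangent:
  assumes "s0 < s1" "C1_curve A \<gamma> {s0..s1}" "s \<in> {s0..s1}"
  shows "velocity A \<gamma> {s0..s1} s \<in> tangent_space A (\<gamma> s)"
proof -
  obtain c where c: "c \<in> A" "\<gamma> s \<in> fst c" using chart_cover by blast
  show ?thesis
    by (subst velocity_eq_coord_vec[OF assms c]) (rule coord_vec_tangent[OF c])
qed

text \<open>All explicit curves are built in one chart by this lemma; it transfers smoothness and
  velocity from the coordinate curve \<open>x\<close> to every other chart.\<close>

lemma chart_curve:
  assumes "s0 < s1" and c: "c \<in> A" and x: "x ` {s0..s1} \<subseteq> snd c ` fst c"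
    and x': "\<forall>s\<in>{s0..s1}. (x has_vector_derivative x' s) (at s within {s0..s1})"
      "continuous_on {s0..s1} x'"
  shows "C1_curve A (chart_inv c \<circ> x) {s0..s1}"
    and "\<And>s. s \<in> {s0..s1} \<Longrightarrow>
       velocity A (chart_inv c \<circ> x) {s0..s1} s = coord_vec A c (chart_inv c (x s)) (x' s)"
proof -
  let ?\<gamma> = "chart_inv c \<circ> x"
  let ?v = "\<lambda>s c'. dtrans c c' (x s) (x' s)"
  have xc: "continuous_on {s0..s1} x"
    using x'(1) by (meson continuous_on_eq_continuous_within has_vector_derivative_continuous)
  have in_c: "?\<gamma> s \<in> fst c" and inv_c: "snd c (chart_inv c (x s)) = x s" if "s \<in> {s0..s1}" for s
  proof -
    have "x s \<in> snd c ` fst c" using x that by blast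
    then show "?\<gamma> s \<in> fst c" "snd c (chart_inv c (x s)) = x s"
      using chart_inv_in chart_inv_right[OF c] by (simp_all add: comp_def)
  qed
  have c0: "continuous_on {s0..s1} ?\<gamma>"
    by (intro continuous_on_compose xc continuous_on_subset[OF continuous_on_chart_inv[OF c] x])
  have c1: "(snd c' \<circ> ?\<gamma> has_vector_derivative ?v s c') (at s within {s0..s1})"
    if c': "c' \<in> A" "s \<in> {s0..s1}" "?\<gamma> s \<in> fst c'" for c' s
  proof -
    have "(snd c \<circ> ?\<gamma> has_vector_derivative x' s) (at s within {s0..s1})"
      by (rule has_vector_derivative_transform[OF c'(2) _ bspec[OF x'(1) c'(2)]]) (simp add: inv_c)
    then have "(snd c' \<circ> ?\<gamma> has_vector_derivative dtrans c c' (snd c (?\<gamma> s)) (x' s)) (at s within {s0..s1})"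
      by (intro curve_change_chart c c' c0 in_c)
    then show ?thesis by (simp add: inv_c[OF c'(2)])
  qed
  have c2: "continuous_on {s\<in>{s0..s1}. ?\<gamma> s \<in> fst c'} (\<lambda>s. ?v s c')" if c': "c' \<in> A" for c'
  proof (rule continuous_on_eq)
    let ?J = "{s\<in>{s0..s1}. ?\<gamma> s \<in> fst c'}"
    have J: "?J \<subseteq> {s0..s1}" by auto
    have xJ: "x ` ?J \<subseteq> snd c ` (fst c \<inter> fst c')"
    proof
      fix z assume "z \<in> x ` ?J"
      then obtain s where s: "s \<in> {s0..s1}" "?\<gamma> s \<in> fst c'" "z = x s" by blast
      then show "z \<in> snd c ` (fst c \<inter> fst c')"
        using in_c[OF s(1)] inv_c[OF s(1)] by (intro image_eqI[of _ _ "?\<gamma> s"]) auto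
    qed
    \<comment> \<open>\<open>trans_C1\<close> gives continuity of \<open>dtrans\<close> in the base
      point for a fixed vector only, so the moving vector \<open>x' s\<close> is expanded in
      \<open>B\<close>.\<close>
    show "continuous_on ?J (\<lambda>s. \<Sum>u\<in>B. (x' s \<bullet> u) *\<^sub>R dtrans c c' (x s) u)"
      by (intro continuous_on_sum continuous_on_scaleR continuous_on_inner continuous_on_const
          continuous_on_subset[OF x'(2) J] continuous_on_compose2[OF trans_C1[OF c c']]
          continuous_on_subset[OF xc J] xJ)
    show "(\<Sum>u\<in>B. (x' s \<bullet> u) *\<^sub>R dtrans c c' (x s) u) = ?v s c'" if s: "s \<in> ?J" for s
    proof -
      have "s \<in> {s0..s1}" "?\<gamma> s \<in> fst c'" using s by auto
      then show ?thesis
        using linear_expand[OF linear_dtrans[OF c c' in_c[of s]], of "x' s"] inv_c[of s] by simp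
    qed
  qed
  show "C1_curve A ?\<gamma> {s0..s1}"
    by (rule C1_curveI(1)[where v="?v", OF assms(1) open_dom c0 c1 c2])
  show "velocity A ?\<gamma> {s0..s1} s = coord_vec A c (chart_inv c (x s)) (x' s)" if s: "s \<in> {s0..s1}" for s
  proof
    fix c'
    show "velocity A ?\<gamma> {s0..s1} s c' = coord_vec A c (chart_inv c (x s)) (x' s) c'"
    proof (cases "c' \<in> A \<and> ?\<gamma> s \<in> fst c'")
      case True
      then show ?thesis
        using C1_curveI(2)[where v="?v", OF assms(1) open_dom c0 c1 c2, of c' s] s
        by (simp add: coord_vec_apply inv_c comp_def)
    next
      case False
      then show ?thesis by (auto simp: velocity_outside coord_vec_def)
    qed
  qed
qed

end

section \<open>The action\<close>

text \<open>The fields enter through their algebraic properties on tangent spaces and through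
  continuity in charts. This form is preserved by time reversal, so that results on the future can
  be applied to the reversed fields.\<close>

locale gw_fields = C1_manifold A B
  for A :: "('q::t2_space, 'v::real_inner) chart set" and B :: "'v set" +
  fixes T :: "real set"
    and a :: "real \<Rightarrow> 'q \<Rightarrow> ('q, 'v) tvec \<Rightarrow> ('q, 'v) tvec \<Rightarrow> real"
    and b :: "real \<Rightarrow> 'q \<Rightarrow> ('q, 'v) tvec \<Rightarrow> real"
    and V :: "real \<Rightarrow> 'q \<Rightarrow> real"
  assumes open_T: "open T" and connected_T: "connected T"
    and a_sym: "\<And>t q \<xi> \<eta>. t \<in> T \<Longrightarrow> \<xi> \<in> tangent_space A q \<Longrightarrow> \<eta> \<in> tangent_space A q \<Longrightarrow> a t q \<xi> \<eta> = a t q \<eta> \<xi>"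
    and a_pos: "\<And>t q \<xi>. t \<in> T \<Longrightarrow> \<xi> \<in> tangent_space A q \<Longrightarrow> \<xi> \<noteq> (\<lambda>_. 0) \<Longrightarrow> a t q \<xi> \<xi> > 0"
    and a_lin: "\<And>t q \<xi> \<eta> \<zeta> m n. t \<in> T \<Longrightarrow> \<xi> \<in> tangent_space A q \<Longrightarrow> \<eta> \<in> tangent_space A q \<Longrightarrow>
        \<zeta> \<in> tangent_space A q \<Longrightarrow>
        a t q (\<lambda>c. m *\<^sub>R \<xi> c + n *\<^sub>R \<eta> c) \<zeta> = m * a t q \<xi> \<zeta> + n * a t q \<eta> \<zeta>"
    and b_lin: "\<And>t q \<xi> \<eta> m n. t \<in> T \<Longrightarrow> \<xi> \<in> tangent_space A q \<Longrightarrow> \<eta> \<in> tangent_space A q \<Longrightarrow>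
        b t q (\<lambda>c. m *\<^sub>R \<xi> c + n *\<^sub>R \<eta> c) = m * b t q \<xi> + n * b t q \<eta>"
    and a_cont: "\<And>c u w. c \<in> A \<Longrightarrow> continuous_on (T \<times> snd c ` fst c)
        (\<lambda>(t, x). a t (chart_inv c x) (coord_vec A c (chart_inv c x) u) (coord_vec A c (chart_inv c x) w))"
    and b_cont: "\<And>c u. c \<in> A \<Longrightarrow> continuous_on (T \<times> snd c ` fst c)
        (\<lambda>(t, x). b t (chart_inv c x) (coord_vec A c (chart_inv c x) u))"
    and V_cont: "\<And>c. c \<in> A \<Longrightarrow> continuous_on (T \<times> snd c ` fst c) (\<lambda>(t, x). V t (chart_inv c x))"
begin

section \<open>The fields and the Lagrangian in coordinates\<close>

lemma linear_a_left:
  assumes "t \<in> T" "c \<in> A" "q \<in> fst c" "\<zeta> \<in> tangent_space A q"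
  shows "linear (\<lambda>v. a t q (coord_vec A c q v) \<zeta>)"
proof (rule linearI)
  fix u w
  show "a t q (coord_vec A c q (u + w)) \<zeta> = a t q (coord_vec A c q u) \<zeta> + a t q (coord_vec A c q w) \<zeta>"
    using coord_vec_lincomb[OF assms(2,3), of 1 u 1 w]
      a_lin[OF assms(1) coord_vec_tangent[OF assms(2,3)] coord_vec_tangent[OF assms(2,3)] assms(4), of 1 u 1 w]
    by simp
next
  fix m u
  show "a t q (coord_vec A c q (m *\<^sub>R u)) \<zeta> = m *\<^sub>R a t q (coord_vec A c q u) \<zeta>"
    using coord_vec_lincomb[OF assms(2,3), of m u 0 0]
      a_lin[OF assms(1) coord_vec_tangent[OF assms(2,3)] coord_vec_tangent[OF assms(2,3)] assms(4), of m u 0 0]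
    by simp
qed

lemma linear_a_right:
  assumes "t \<in> T" "c \<in> A" "q \<in> fst c" "\<zeta> \<in> tangent_space A q"
  shows "linear (\<lambda>v. a t q \<zeta> (coord_vec A c q v))"
  using linear_a_left[OF assms] a_sym[OF assms(1) coord_vec_tangent[OF assms(2,3)] assms(4)]
  by simp

lemma linear_b:
  assumes "t \<in> T" "c \<in> A" "q \<in> fst c"
  shows "linear (\<lambda>v. b t q (coord_vec A c q v))"
proof (rule linearI)
  fix u w
  show "b t q (coord_vec A c q (u + w)) = b t q (coord_vec A c q u) + b t q (coord_vec A c q w)"
    using coord_vec_lincomb[OF assms(2,3), of 1 u 1 w]
      b_lin[OF assms(1) coord_vec_tangent[OF assms(2,3)] coord_vec_tangent[OF assms(2,3)], of 1 u 1 w]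
    by simp
next
  fix m u
  show "b t q (coord_vec A c q (m *\<^sub>R u)) = m *\<^sub>R b t q (coord_vec A c q u)"
    using coord_vec_lincomb[OF assms(2,3), of m u 0 0]
      b_lin[OF assms(1) coord_vec_tangent[OF assms(2,3)] coord_vec_tangent[OF assms(2,3)], of m u 0 0]
    by simp
qed

definition chart_a where
  "chart_a c t x v = a t (chart_inv c x) (coord_vec A c (chart_inv c x) v) (coord_vec A c (chart_inv c x) v)"

definition chart_b where
  "chart_b c t x v = b t (chart_inv c x) (coord_vec A c (chart_inv c x) v)"

definition chart_lagrangian where
  "chart_lagrangian c t x v = lagrangian a b V t (chart_inv c x) (coord_vec A c (chart_inv c x) v)"

lemma chart_lagrangian_eq:
  "chart_lagrangian c t x v = 1/2 * chart_a c t x v + chart_b c t x v - V t (chart_inv c x)"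
  by (simp add: chart_lagrangian_def lagrangian_def chart_a_def chart_b_def)

lemma chart_a_scale:
  assumes "t \<in> T" "c \<in> A" "x \<in> snd c ` fst c"
  shows "chart_a c t x (m *\<^sub>R v) = m\<^sup>2 * chart_a c t x v"
proof -
  let ?q = "chart_inv c x"
  have q: "?q \<in> fst c" by (rule chart_inv_in[OF assms(3)])
  show ?thesis
    using linear_scale[OF linear_a_left[OF assms(1,2) q coord_vec_tangent[OF assms(2) q, of "m *\<^sub>R v"]], of m v]
      linear_scale[OF linear_a_right[OF assms(1,2) q coord_vec_tangent[OF assms(2) q, of v]], of m v]
    by (simp add: chart_a_def power2_eq_square)
qed

lemma chart_b_scale:
  assumes "t \<in> T" "c \<in> A" "x \<in> snd c ` fst c"
  shows "chart_b c t x (m *\<^sub>R v) = m * chart_b c t x v"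
  using linear_scale[OF linear_b[OF assms(1,2) chart_inv_in[OF assms(3)]], of m v]
  by (simp add: chart_b_def)

lemma chart_a_pos:
  assumes "t \<in> T" "c \<in> A" "x \<in> snd c ` fst c" "v \<noteq> 0"
  shows "chart_a c t x v > 0"
proof -
  let ?q = "chart_inv c x"
  have q: "?q \<in> fst c" by (rule chart_inv_in[OF assms(3)])
  have "coord_vec A c ?q v \<noteq> (\<lambda>_. 0)"
    using coord_vec_self[OF assms(2) q, of v] assms(4) by metis
  then show ?thesis
    unfolding chart_a_def by (intro a_pos assms(1) coord_vec_tangent[OF assms(2) q])
qed

text \<open>Joint continuity in time, position and vector: both arguments of the bilinear form are
  expanded in \<open>B\<close>, and the coefficients are continuous by
  \<open>a_cont\<close>.\<close>

lemma continuous_on_chart_a: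
  assumes "c \<in> A"
  shows "continuous_on ((T \<times> snd c ` fst c) \<times> UNIV) (\<lambda>p. chart_a c (fst (fst p)) (snd (fst p)) (snd p))"
proof (rule continuous_on_eq)
  let ?a = "\<lambda>u w p. a (fst p) (chart_inv c (snd p)) (coord_vec A c (chart_inv c (snd p)) u) (coord_vec A c (chart_inv c (snd p)) w)"
  have *: "continuous_on ((T \<times> snd c ` fst c) \<times> (UNIV :: 'v set)) (\<lambda>p. ?a u w (fst p))" for u w
    by (rule continuous_on_compose2[OF a_cont[OF assms, of u w, unfolded case_prod_beta] continuous_on_fst]) 
      (auto intro: continuous_on_id)
  show "continuous_on ((T \<times> snd c ` fst c) \<times> UNIV)
      (\<lambda>p. \<Sum>u\<in>B. (snd p \<bullet> u) *\<^sub>R (\<Sum>w\<in>B. (snd p \<bullet> w) *\<^sub>R ?a u w (fst p)))"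
    by (intro continuous_on_sum continuous_on_scaleR * continuous_on_inner continuous_on_const continuous_on_snd continuous_on_id)
next
  fix p assume p: "p \<in> (T \<times> snd c ` fst c) \<times> (UNIV :: 'v set)"
  let ?t = "fst (fst p)" and ?q = "chart_inv c (snd (fst p))" and ?v = "snd p"
  have t: "?t \<in> T" and q: "?q \<in> fst c"
    using p by (auto intro: chart_inv_in)
  show "(\<Sum>u\<in>B. (?v \<bullet> u) *\<^sub>R (\<Sum>w\<in>B. (?v \<bullet> w) *\<^sub>R a ?t ?q (coord_vec A c ?q u) (coord_vec A c ?q w)))
      = chart_a c ?t (snd (fst p)) ?v"
    unfolding chart_a_def
    by (subst linear_expand[OF linear_a_left[OF t assms q coord_vec_tangent[OF assms q, of ?v]], of ?v])
      (simp only: linear_expand[OF linear_a_right[OF t assms q coord_vec_tangent[OF assms q]], of _ ?v])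
qed

lemma continuous_on_chart_b:
  assumes "c \<in> A"
  shows "continuous_on ((T \<times> snd c ` fst c) \<times> UNIV) (\<lambda>p. chart_b c (fst (fst p)) (snd (fst p)) (snd p))"
proof (rule continuous_on_eq)
  let ?b = "\<lambda>u p. b (fst p) (chart_inv c (snd p)) (coord_vec A c (chart_inv c (snd p)) u)"
  have *: "continuous_on ((T \<times> snd c ` fst c) \<times> (UNIV :: 'v set)) (\<lambda>p. ?b u (fst p))" for u
    by (rule continuous_on_compose2[OF b_cont[OF assms, of u, unfolded case_prod_beta] continuous_on_fst]) 
      (auto intro: continuous_on_id)
  show "continuous_on ((T \<times> snd c ` fst c) \<times> UNIV) (\<lambda>p. \<Sum>u\<in>B. (snd p \<bullet> u) *\<^sub>R ?b u (fst p))"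
    by (intro continuous_on_sum continuous_on_scaleR * continuous_on_inner continuous_on_const continuous_on_snd continuous_on_id)
next
  fix p assume p: "p \<in> (T \<times> snd c ` fst c) \<times> (UNIV :: 'v set)"
  let ?t = "fst (fst p)" and ?q = "chart_inv c (snd (fst p))" and ?v = "snd p"
  have t: "?t \<in> T" and q: "?q \<in> fst c"
    using p by (auto intro: chart_inv_in)
  show "(\<Sum>u\<in>B. (?v \<bullet> u) *\<^sub>R b ?t ?q (coord_vec A c ?q u)) = chart_b c ?t (snd (fst p)) ?v"
    unfolding chart_b_def by (simp only: linear_expand[OF linear_b[OF t assms q], of ?v])
qed

lemma continuous_on_chart_lagrangian:
  assumes "c \<in> A"
  shows "continuous_on ((T \<times> snd c ` fst c) \<times> UNIV) (\<lambda>p. chart_lagrangian c (fst (fst p)) (snd (fst p)) (snd p))"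
proof -
  have "continuous_on ((T \<times> snd c ` fst c) \<times> (UNIV :: 'v set)) (\<lambda>p. V (fst (fst p)) (chart_inv c (snd (fst p))))"
    by (rule continuous_on_compose2[OF V_cont[OF assms, unfolded case_prod_beta] continuous_on_fst]) 
      (auto intro: continuous_on_id)
  then show ?thesis
    unfolding chart_lagrangian_eq
    by (intro continuous_on_add continuous_on_diff continuous_on_mult continuous_on_const
        continuous_on_chart_a continuous_on_chart_b assms)
qed

lemma chart_lagrangian_bounded:
  assumes "c \<in> A" "compact K" "K \<subseteq> T \<times> snd c ` fst c"
  obtains C where "C \<ge> 0" "\<And>t x v. (t, x) \<in> K \<Longrightarrow> norm v \<le> R \<Longrightarrow> \<bar>chart_lagrangian c t x v\<bar> \<le> C"
proof -
  let ?L = "\<lambda>p. chart_lagrangian c (fst (fst p)) (snd (fst p)) (snd p)"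
  have "compact (?L ` (K \<times> cball 0 R))"
    using assms
    by (intro compact_continuous_image compact_Times compact_cball_model
        continuous_on_subset[OF continuous_on_chart_lagrangian]) auto
  then have "bounded (?L ` (K \<times> cball 0 R))"
    by (rule compact_imp_bounded)
  then obtain C where C: "\<And>y. y \<in> ?L ` (K \<times> cball 0 R) \<Longrightarrow> norm y \<le> C"
    unfolding bounded_iff by blast
  show ?thesis
  \<comment> \<open>If \<open>K\<close> is empty or \<open>R\<close> is negative, the bound
    \<open>C\<close> may be negative.\<close>
  proof (rule that[of "max C 0"])
    fix t x v assume "(t, x) \<in> K" "norm (v::'v) \<le> R"
    then have "((t, x), v) \<in> K \<times> cball 0 R" by simp
    then have "norm (?L ((t, x), v)) \<le> C"
      by (intro C imageI)
    then show "\<bar>chart_lagrangian c t x v\<bar> \<le> max C 0" by simp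
  qed simp
qed

text \<open>The kinetic term dominates any linear function of the speed, since
  \<open>\<kappa> r\<^sup>2 / 2 - N r \<ge> - N\<^sup>2 / (2 \<kappa>)\<close>.\<close>

lemma chart_lagrangian_superlinear:
  assumes c: "c \<in> A" and K: "compact K" "K \<subseteq> T \<times> snd c ` fst c"
  obtains C where "\<And>t x v. (t, x) \<in> K \<Longrightarrow> M * norm v - C \<le> chart_lagrangian c t x v"
proof -
  define S where "S = {v::'v. norm v = 1}"
  let ?a = "\<lambda>p. chart_a c (fst (fst p)) (snd (fst p)) (snd p)"
  have "compact (cball (0::'v) 1 \<inter> S)"
    unfolding S_def by (intro compact_Int_closed compact_cball_model closed_Collect_eq continuous_intros)
  then have S: "compact S"
    by (subst (asm) Int_absorb1) (auto simp: S_def)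
  have KS: "compact (K \<times> S)" "K \<times> S \<subseteq> (T \<times> snd c ` fst c) \<times> UNIV"
    using K by (auto intro: compact_Times S)
  \<comment> \<open>Uniform ellipticity: \<open>\<kappa>\<close> is the minimum of the positive
    quadratic form over \<open>K\<close> and the unit sphere. The product is empty if
    \<open>K\<close> is empty or if \<open>d = 0\<close>.\<close>
  have "\<exists>\<kappa>>0. \<forall>p\<in>K \<times> S. \<kappa> \<le> ?a p"
  proof (cases "K \<times> S = {}")
    case True
    then show ?thesis by (intro exI[of _ 1]) auto
  next
    case False
    obtain p where p: "p \<in> K \<times> S" "\<forall>p'\<in>K \<times> S. ?a p \<le> ?a p'"
      using continuous_attains_inf[OF KS(1) False continuous_on_subset[OF continuous_on_chart_a[OF c] KS(2)]] by blast
    then have "?a p > 0"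
      using K(2) c by (intro chart_a_pos) (auto simp: S_def)
    then show ?thesis using p(2) by blast
  qed
  then obtain \<kappa> where \<kappa>: "\<kappa> > 0" "\<And>t x v. (t, x) \<in> K \<Longrightarrow> v \<in> S \<Longrightarrow> \<kappa> \<le> chart_a c t x v"
    by fastforce
  have "bounded ((\<lambda>p. chart_b c (fst (fst p)) (snd (fst p)) (snd p)) ` (K \<times> S))"
    by (intro compact_imp_bounded compact_continuous_image KS continuous_on_subset[OF continuous_on_chart_b[OF c] KS(2)])
  then obtain \<beta> where "\<And>y. y \<in> (\<lambda>p. chart_b c (fst (fst p)) (snd (fst p)) (snd p)) ` (K \<times> S) \<Longrightarrow> norm y \<le> \<beta>"
    unfolding bounded_iff by blast
  then have \<beta>: "\<bar>chart_b c t x v\<bar> \<le> \<beta>" if "(t, x) \<in> K" "v \<in> S" for t x v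
    using that by force
  have "bounded ((\<lambda>(t, x). V t (chart_inv c x)) ` K)"
    by (intro compact_imp_bounded compact_continuous_image K continuous_on_subset[OF V_cont[OF c] K(2)])
  then obtain \<nu> where "\<And>y. y \<in> (\<lambda>(t, x). V t (chart_inv c x)) ` K \<Longrightarrow> norm y \<le> \<nu>"
    unfolding bounded_iff by blast
  then have \<nu>: "\<bar>V t (chart_inv c x)\<bar> \<le> \<nu>" if "(t, x) \<in> K" for t x
    using that by force
  show ?thesis
  \<comment> \<open>\<open>\<nu>\<close> bounds \<open>V\<close> and \<open>\<beta>\<close> bounds
    the linear term on unit vectors; the second summand completes the square with
    \<open>M + \<beta>\<close> as the coefficient of the speed.\<close>
  proof (rule that[of "\<nu> + (M + \<beta>)\<^sup>2 / (2 * \<kappa>)"])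
    fix t x and v :: 'v assume tx: "(t, x) \<in> K"
    then have tx': "t \<in> T" "x \<in> snd c ` fst c" using K(2) by auto
    have nonneg: "(M + \<beta>)\<^sup>2 / (2 * \<kappa>) \<ge> 0" using \<kappa>(1) by simp
    show "M * norm v - (\<nu> + (M + \<beta>)\<^sup>2 / (2 * \<kappa>)) \<le> chart_lagrangian c t x v"
    proof (cases "v = 0")
      case True
      have "chart_a c t x (0 *\<^sub>R v) = 0" "chart_b c t x (0 *\<^sub>R v) = 0"
        using chart_a_scale[OF tx'(1) c tx'(2), of 0] chart_b_scale[OF tx'(1) c tx'(2), of 0] by simp_all
      then show ?thesis
        using True \<nu>[OF tx] nonneg by (simp add: chart_lagrangian_eq)
    next
      case False
      define r where "r = norm v"
      define s where "s = (1 / r) *\<^sub>R v"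
      have r: "r > 0" using False by (simp add: r_def)
      have s: "s \<in> S" "v = r *\<^sub>R s" using r by (simp_all add: S_def s_def r_def)
      have "\<kappa> * r\<^sup>2 \<le> chart_a c t x v"
        using mult_right_mono[OF \<kappa>(2)[OF tx s(1)], of "r\<^sup>2"]
        unfolding s(2) chart_a_scale[OF tx'(1) c tx'(2)] by (simp add: mult.commute)
      moreover have "- (r * \<beta>) \<le> chart_b c t x v"
        using mult_left_mono[of "-\<beta>" "chart_b c t x s" r] \<beta>[OF tx s(1)] r
        unfolding s(2) chart_b_scale[OF tx'(1) c tx'(2)] by simp
      moreover have "M * r - (M + \<beta>)\<^sup>2 / (2 * \<kappa>) \<le> \<kappa> * r\<^sup>2 / 2 - r * \<beta>"
      proof -
        have "0 \<le> (\<kappa> * r - (M + \<beta>))\<^sup>2 / (2 * \<kappa>)" using \<kappa>(1) by simp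
        also have "\<dots> = \<kappa> * r\<^sup>2 / 2 - (M + \<beta>) * r + (M + \<beta>)\<^sup>2 / (2 * \<kappa>)"
          using \<kappa>(1) by (simp add: field_simps power2_eq_square)
        finally show ?thesis by (simp add: algebra_simps)
      qed
      ultimately show ?thesis
        using \<nu>[OF tx] by (simp add: chart_lagrangian_eq r_def[symmetric])
    qed
  qed
qed

section \<open>The action integral and its additivity\<close>

lemma Icc_subset_T: "s \<in> T \<Longrightarrow> t \<in> T \<Longrightarrow> {s..t} \<subseteq> T"
  using connected_T connectedD_interval[of T s t] by auto

text \<open>The interval is an argument because the velocity is taken within it and hence is
  one-sided at its end points.\<close>

definition lag where
  "lag \<gamma> s0 s1 t = lagrangian a b V t (\<gamma> t) (velocity A \<gamma> {s0..s1} t)"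

definition action where
  "action \<gamma> s0 s1 = integral {s0..s1} (lag \<gamma> s0 s1)"

text \<open>Near each parameter the curve lies in one chart, where the Lagrangian is a jointly
  continuous function of time, position and velocity component, all of which depend continuously on
  the parameter.\<close>

lemma continuous_on_lag:
  assumes "s0 < s1" "{s0..s1} \<subseteq> T" "C1_curve A \<gamma> {s0..s1}"
  shows "continuous_on {s0..s1} (lag \<gamma> s0 s1)"
  unfolding continuous_on_eq_continuous_within
proof
  fix s assume s: "s \<in> {s0..s1}"
  note D = C1_curveD[OF assms(1) open_dom assms(3)]
  obtain c where c: "c \<in> A" "\<gamma> s \<in> fst c" using chart_cover by blast
  let ?J = "{s\<in>{s0..s1}. \<gamma> s \<in> fst c}"
  let ?p = "\<lambda>t. ((t, snd c (\<gamma> t)), velocity A \<gamma> {s0..s1} t c)"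
  have J: "?J \<subseteq> {s0..s1}" by auto
  have "continuous_on ?J (\<lambda>t. chart_lagrangian c (fst (fst (?p t))) (snd (fst (?p t))) (snd (?p t)))"
  proof (rule continuous_on_compose2[OF continuous_on_chart_lagrangian[OF c(1)]])
    show "continuous_on ?J ?p"
      by (intro continuous_on_Pair continuous_on_id D(3) c(1)
          continuous_on_compose2[OF continuous_on_chart[OF c(1)] continuous_on_subset[OF D(1) J]]) auto
    show "?p ` ?J \<subseteq> (T \<times> snd c ` fst c) \<times> UNIV"
      using assms(2) by auto
  qed
  then have "continuous_on ?J (lag \<gamma> s0 s1)"
  proof (rule continuous_on_eq)
    fix t assume "t \<in> ?J"
    then have t: "t \<in> {s0..s1}" "\<gamma> t \<in> fst c" by auto
    show "chart_lagrangian c (fst (fst (?p t))) (snd (fst (?p t))) (snd (?p t)) = lag \<gamma> s0 s1 t"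
      unfolding lag_def chart_lagrangian_def
      by (subst (2) velocity_eq_coord_vec[OF assms(1,3) t(1) c(1) t(2)])
        (simp add: chart_inv_left[OF c(1) t(2)])
  qed
  moreover have "s \<in> ?J" using s c by simp
  ultimately have "continuous (at s within ?J) (lag \<gamma> s0 s1)"
    by (simp add: continuous_on_eq_continuous_within)
  then show "continuous (at s within {s0..s1}) (lag \<gamma> s0 s1)"
    using at_within_preimage[OF D(1) bspec[OF open_dom c(1)] s c(2)] by simp
qed

lemma lag_integrable:
  assumes "s0 < s1" "{s0..s1} \<subseteq> T" "C1_curve A \<gamma> {s0..s1}"
  shows "lag \<gamma> s0 s1 integrable_on {s0..s1}"
  using continuous_on_lag[OF assms] by (rule integrable_continuous_real)

lemma action_eq_integral:
  assumes "s0 \<le> t0" "t0 < t1" "t1 \<le> s1" "C1_curve A \<gamma> {s0..s1}"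
  shows "action \<gamma> t0 t1 = integral {t0..t1} (lag \<gamma> s0 s1)"
  unfolding action_def lag_def
  using C1_curve_subinterval(2)[OF assms(1-3) open_dom assms(4)]
  by (intro integral_cong) simp

lemma action_split:
  assumes "s0 < m" "m < s1" "{s0..s1} \<subseteq> T" "C1_curve A \<gamma> {s0..s1}"
  shows "action \<gamma> s0 s1 = action \<gamma> s0 m + action \<gamma> m s1"
  using Henstock_Kurzweil_Integration.integral_combine[OF _ _ lag_integrable[of s0 s1 \<gamma>], of m] assms
  by (simp add: action_eq_integral[of s0 _ _ s1])

lemma action_glue:
  assumes "s0 < m" "m < s1" "{s0..s1} \<subseteq> T"
    and "C1_curve A \<gamma>1 {s0..m}" "C1_curve A \<gamma>2 {m..s1}"
    and "\<gamma>1 m = \<gamma>2 m" "velocity A \<gamma>1 {s0..m} m = velocity A \<gamma>2 {m..s1} m"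
  defines "\<gamma> \<equiv> \<lambda>s. if s \<le> m then \<gamma>1 s else \<gamma>2 s"
  shows "C1_curve A \<gamma> {s0..s1}" "action \<gamma> s0 s1 = action \<gamma>1 s0 m + action \<gamma>2 m s1"
proof -
  note G = C1_curve_glue[OF assms(1,2) open_dom assms(4-7), folded \<gamma>_def]
  show "C1_curve A \<gamma> {s0..s1}" by (rule G)
  have eq2: "\<gamma> s = \<gamma>2 s" if "s \<in> {m..s1}" for s
    using that assms(6) by (auto simp: \<gamma>_def)
  have "integral {s0..m} (lag \<gamma> s0 s1) = action \<gamma>1 s0 m"
    unfolding action_def lag_def using G(2) by (intro integral_cong) (simp add: \<gamma>_def)
  moreover have "integral {m..s1} (lag \<gamma> s0 s1) = action \<gamma>2 m s1"
    unfolding action_def lag_def using G(3) eq2 by (intro integral_cong) simp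
  moreover have "integral {s0..m} (lag \<gamma> s0 s1) + integral {m..s1} (lag \<gamma> s0 s1) = integral {s0..s1} (lag \<gamma> s0 s1)"
    using assms(1,2) by (intro Henstock_Kurzweil_Integration.integral_combine lag_integrable G(1) assms(3)) auto
  ultimately show "action \<gamma> s0 s1 = action \<gamma>1 s0 m + action \<gamma>2 m s1"
    by (simp add: action_def)
qed

lemma action_chart_curve:
  assumes "s0 < s1" and c: "c \<in> A" and x: "x ` {s0..s1} \<subseteq> snd c ` fst c"
    and x': "\<forall>s\<in>{s0..s1}. (x has_vector_derivative x' s) (at s within {s0..s1})"
      "continuous_on {s0..s1} x'"
  shows "action (chart_inv c \<circ> x) s0 s1 = integral {s0..s1} (\<lambda>s. chart_lagrangian c s (x s) (x' s))"
  unfolding action_def lag_def chart_lagrangian_def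
  using chart_curve(2)[OF assms] by (intro integral_cong) simp

definition conn :: "real \<times> 'q \<Rightarrow> real \<times> 'q \<Rightarrow> real \<Rightarrow> bool" where
  "conn e0 e1 y \<longleftrightarrow> fst e0 < fst e1 \<and>
     (\<exists>\<gamma>. C1_curve A \<gamma> {fst e0..fst e1} \<and> \<gamma> (fst e0) = snd e0 \<and> \<gamma> (fst e1) = snd e1 \<and>
          action \<gamma> (fst e0) (fst e1) < y)"

lemma connI:
  "t0 < t1 \<Longrightarrow> C1_curve A \<gamma> {t0..t1} \<Longrightarrow> action \<gamma> t0 t1 < y \<Longrightarrow> conn (t0, \<gamma> t0) (t1, \<gamma> t1) y"
  by (auto simp: conn_def)

lemma connE:
  assumes "conn (t0, q0) (t1, q1) y"
  obtains \<gamma> where "t0 < t1" "C1_curve A \<gamma> {t0..t1}" "\<gamma> t0 = q0" "\<gamma> t1 = q1" "action \<gamma> t0 t1 < y"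
  using assms by (auto simp: conn_def)

lemma conn_mono: "conn e0 e1 y \<Longrightarrow> y \<le> z \<Longrightarrow> conn e0 e1 z"
  by (force simp: conn_def)

lemma least_action_less_iff:
  assumes "fst e0 < fst e1"
  shows "least_action A a b V e0 e1 < ereal y \<longleftrightarrow> conn e0 e1 y"
proof -
  obtain t0 q0 t1 q1 where e: "e0 = (t0, q0)" "e1 = (t1, q1)" by fastforce
  have "least_action A a b V e0 e1 =
      (INF \<gamma>\<in>{\<gamma>. C1_curve A \<gamma> {t0..t1} \<and> \<gamma> t0 = q0 \<and> \<gamma> t1 = q1}. ereal (action \<gamma> t0 t1))"
    using assms by (simp add: e least_action_def action_def lag_def[abs_def])
  then show ?thesis
    using assms by (auto simp: conn_def e INF_less_iff)
qed

section \<open>Deforming curves and estimating their action\<close>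

lemma C1_curve_initial_subset:
  assumes "s0 < s1" "C1_curve A \<gamma> {s0..s1}" "open U" "\<gamma> s0 \<in> U"
  obtains m where "s0 < m" "m < s1" "\<And>s. s0 \<le> s \<Longrightarrow> s \<le> m \<Longrightarrow> \<gamma> s \<in> U"
proof -
  have "continuous (at s0 within {s0..s1}) \<gamma>"
    using C1_curveD(1)[OF assms(1) open_dom assms(2)] assms(1)
    by (simp add: continuous_on_eq_continuous_within)
  then have "\<forall>\<^sub>F s in at s0 within {s0..s1}. \<gamma> s \<in> U"
    using assms(3,4) unfolding continuous_within tendsto_def by blast
  then obtain d where d: "d > 0" "\<And>s. s \<in> {s0..s1} \<Longrightarrow> s \<noteq> s0 \<Longrightarrow> dist s s0 < d \<Longrightarrow> \<gamma> s \<in> U"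
    unfolding eventually_at by blast
  show ?thesis
  proof (rule that[of "s0 + min (d/2) ((s1 - s0)/2)"])
    show "\<gamma> s \<in> U" if st: "s0 \<le> s" "s \<le> s0 + min (d/2) ((s1 - s0)/2)" for s
    proof (cases "s = s0")
      case False
      have "s \<le> s0 + d/2" "s \<le> s0 + (s1 - s0)/2" using st(2) by auto
      then have "s - s0 < d" "s \<le> s1" using d(1) assms(1) by (auto simp: field_simps)
      then show ?thesis using False st(1) by (intro d(2)) (auto simp: dist_real_def)
    qed (use assms(4) in simp)
  qed (use d(1) assms(1) in \<open>auto simp: min_def field_simps\<close>)
qed

text \<open>The integral depends continuously on its lower end. Hence a short initial piece can be
  replaced by one of small action without losing a strict upper bound.\<close>

lemma action_tail_tendsto:
  assumes "s0 < s1" "{s0..s1} \<subseteq> T" "C1_curve A \<gamma> {s0..s1}"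
  shows "((\<lambda>m. action \<gamma> m s1) \<longlongrightarrow> action \<gamma> s0 s1) (at_right s0)"
proof -
  have "continuous_on {s0..s1} (\<lambda>m. integral {m..s1} (lag \<gamma> s0 s1))"
    by (intro indefinite_integral_continuous_1' lag_integrable assms)
  then have "((\<lambda>m. integral {m..s1} (lag \<gamma> s0 s1)) \<longlongrightarrow> action \<gamma> s0 s1) (at s0 within {s0..s1})"
    using assms(1) by (simp add: continuous_on_def action_def)
  then have "((\<lambda>m. integral {m..s1} (lag \<gamma> s0 s1)) \<longlongrightarrow> action \<gamma> s0 s1) (at_right s0)"
    using at_within_Icc_at_right[OF assms(1)] by simp
  moreover have "\<forall>\<^sub>F m in at_right s0. integral {m..s1} (lag \<gamma> s0 s1) = action \<gamma> m s1"
    using eventually_at_right_less[of s0] eventually_at_right_real[OF assms(1)]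
    by eventually_elim (use assms in \<open>simp add: action_eq_integral[of s0 _ _ s1]\<close>)
  ultimately show ?thesis
    by (rule Lim_transform_eventually)
qed

text \<open>The perturbation \<open>\<phi> w\<close> with \<open>\<phi> t = (t - s0) (1 - (t - s0) / \<delta>)\<^sup>2\<close> vanishes at both ends of
  \<open>[s0, s0 + \<delta>]\<close>, has derivative \<open>w\<close> at \<open>s0\<close> and \<open>0\<close> at \<open>s0 + \<delta>\<close>, and changes the action by \<open>O(\<delta>)\<close>.\<close>

lemma action_change_initial_velocity:
  assumes s: "s0 < s1" "{s0..s1} \<subseteq> T" and \<gamma>: "C1_curve A \<gamma> {s0..s1}" "action \<gamma> s0 s1 < y"
    and \<xi>: "\<xi> \<in> tangent_space A (\<gamma> s0)"
  obtains \<gamma>' where "C1_curve A \<gamma>' {s0..s1}" "\<gamma>' s0 = \<gamma> s0" "\<gamma>' s1 = \<gamma> s1"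
    "velocity A \<gamma>' {s0..s1} s0 = \<xi>" "action \<gamma>' s0 s1 < y"
proof -
  note D = C1_curveD[OF s(1) open_dom \<gamma>(1)]
  obtain c where c: "c \<in> A" "\<gamma> s0 \<in> fst c" using chart_cover by blast
  define x where "x = snd c \<circ> \<gamma>"
  define x' where "x' t = velocity A \<gamma> {s0..s1} t c" for t
  define w where "w = \<xi> c - x' s0"
  \<comment> \<open>The radius is shared equally: the curve itself stays within
    \<open>\<rho> / 2\<close> of its start, and the perturbation will be smaller than
    \<open>\<rho> / 2\<close>.\<close>
  obtain \<rho> where \<rho>: "\<rho> > 0" "cball (x s0) \<rho> \<subseteq> snd c ` fst c"
    using open_img[OF c(1)] c(2) unfolding open_contains_cball x_def by auto
  have "open (chart_inv c ` ball (x s0) (\<rho> / 2))"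
    using \<rho> by (intro open_chart_inv_image c) (auto simp: subset_iff mem_ball mem_cball)
  moreover have "\<gamma> s0 \<in> chart_inv c ` ball (x s0) (\<rho> / 2)"
    using \<rho>(1) c by (intro image_eqI[of _ _ "x s0"]) (auto simp: x_def chart_inv_left)
  ultimately obtain m where m: "s0 < m" "m < s1"
    "\<And>t. s0 \<le> t \<Longrightarrow> t \<le> m \<Longrightarrow> \<gamma> t \<in> chart_inv c ` ball (x s0) (\<rho> / 2)"
    using C1_curve_initial_subset[OF s(1) \<gamma>(1)] by metis
  have xt: "\<gamma> t \<in> fst c" "dist (x s0) (x t) < \<rho> / 2" if "s0 \<le> t" "t \<le> m" for t
  proof -
    have "\<gamma> t \<in> chart_inv c ` ball (x s0) (\<rho> / 2)" using that by (rule m(3))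
    then obtain z where z: "z \<in> ball (x s0) (\<rho> / 2)" "\<gamma> t = chart_inv c z" by blast
    then have zi: "z \<in> snd c ` fst c" using \<rho> by (auto simp: subset_iff mem_ball mem_cball)
    show "\<gamma> t \<in> fst c"
      using z(2) chart_inv_in[OF zi] by simp
    show "dist (x s0) (x t) < \<rho> / 2"
      using z chart_inv_right[OF c(1) zi] by (simp add: x_def)
  qed
  have x'_cont: "continuous_on {s0..m} x'"
    unfolding x'_def using xt(1) m(2) by (intro continuous_on_subset[OF D(3)[OF c(1)]]) auto
  have x_deriv: "(x has_vector_derivative x' t) (at t within {s0..s1})" if "t \<in> {s0..m}" for t
    unfolding x_def x'_def using that m(2) xt(1) by (intro D(2) c(1)) auto
  obtain R where R: "\<And>t. t \<in> {s0..m} \<Longrightarrow> norm (x' t) \<le> R"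
    using compact_imp_bounded[OF compact_continuous_image[OF x'_cont compact_Icc]]
    unfolding bounded_iff by blast
  have K: "compact ({s0..m} \<times> cball (x s0) \<rho>)" "{s0..m} \<times> cball (x s0) \<rho> \<subseteq> T \<times> snd c ` fst c"
    using s(2) m(2) \<rho>(2) by (auto intro!: compact_Times compact_cball_model simp: subset_iff)
  \<comment> \<open>Since the derivative of \<open>\<phi>\<close> is bounded by 2,
    \<open>R + 2 * norm w\<close> bounds the velocity of the perturbed curve. Thus \<open>C\<close>
    does not depend on the length of the perturbed piece, which is chosen afterwards.\<close>
  obtain C where C: "C \<ge> 0" "\<And>t z v. (t, z) \<in> {s0..m} \<times> cball (x s0) \<rho> \<Longrightarrow> norm v \<le> R + 2 * norm w \<Longrightarrow>
      \<bar>chart_lagrangian c t z v\<bar> \<le> C"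
    using chart_lagrangian_bounded[OF c(1) K] by blast
  \<comment> \<open>\<open>C * (n - s0)\<close> is the most that the new piece up to
    \<open>n\<close> can cost; for \<open>n\<close> near \<open>s0\<close> its sum with the action
    of the old tail is below \<open>y\<close>.\<close>
  have "((\<lambda>n. C * (n - s0) + action \<gamma> n s1) \<longlongrightarrow> C * (s0 - s0) + action \<gamma> s0 s1) (at_right s0)"
    by (intro tendsto_intros action_tail_tendsto s \<gamma>)
  then have "\<forall>\<^sub>F n in at_right s0. C * (n - s0) + action \<gamma> n s1 < y"
    using \<gamma>(2) by (intro order_tendstoD(2)) auto
  moreover have "((\<lambda>n. (n - s0) * norm w) \<longlongrightarrow> (s0 - s0) * norm w) (at_right s0)"
    by (intro tendsto_intros)
  then have "\<forall>\<^sub>F n in at_right s0. (n - s0) * norm w < \<rho> / 2"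
    using \<rho>(1) by (intro order_tendstoD(2)) auto
  moreover note eventually_at_right_real[OF m(1)]
  ultimately have "\<forall>\<^sub>F n in at_right s0. C * (n - s0) + action \<gamma> n s1 < y \<and> (n - s0) * norm w < \<rho> / 2 \<and> n \<in> {s0<..<m}"
    by eventually_elim simp
  then obtain n where n: "C * (n - s0) + action \<gamma> n s1 < y" "(n - s0) * norm w < \<rho> / 2" "s0 < n" "n < m"
    using eventually_happens'[OF trivial_limit_at_right_real] by (metis (no_types, lifting) greaterThanLessThan_iff)
  define \<delta> where "\<delta> = n - s0"
  have \<delta>: "\<delta> > 0" using n by (simp add: \<delta>_def)
  define \<phi> where "\<phi> t = (t - s0) * (1 - (t - s0) / \<delta>)\<^sup>2" for t
  define \<phi>' where "\<phi>' t = (1 - (t - s0) / \<delta>) * (1 - 3 * ((t - s0) / \<delta>))" for t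
  have \<phi>_deriv: "(\<phi> has_vector_derivative \<phi>' t) (at t within I)" for t I
    unfolding \<phi>_def \<phi>'_def has_real_derivative_iff_has_vector_derivative[symmetric]
    by (rule derivative_eq_intros refl | use \<delta> in \<open>simp add: field_simps power2_eq_square\<close>)+
  have \<phi>_bound: "\<bar>\<phi> t\<bar> \<le> \<delta>" "\<bar>\<phi>' t\<bar> \<le> 2" if t: "t \<in> {s0..n}" for t
  proof -
    \<comment> \<open>In terms of the elapsed fraction \<open>u\<close> of \<open>[s0, n]\<close>,
      the function is \<open>\<delta> * u * (1 - u)^2\<close> and its derivative is
      \<open>(1 - u) * (1 - 3 * u)\<close>.\<close>
    define u where "u = (t - s0) / \<delta>"
    have u: "0 \<le> u" "u \<le> 1" using t \<delta> by (auto simp: u_def \<delta>_def)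
    have "\<bar>(t - s0) * (1 - u)\<^sup>2\<bar> \<le> \<delta> * 1"
      unfolding abs_mult using t u by (intro mult_mono) (auto simp: \<delta>_def power_le_one abs_square_le_1)
    then show "\<bar>\<phi> t\<bar> \<le> \<delta>" by (simp add: \<phi>_def u_def)
    have "\<bar>(1 - u) * (1 - 3 * u)\<bar> \<le> 1 * 2"
      unfolding abs_mult using u by (intro mult_mono) auto
    then show "\<bar>\<phi>' t\<bar> \<le> 2" by (simp add: \<phi>'_def u_def)
  qed
  define z where "z t = x t + \<phi> t *\<^sub>R w" for t
  define z' where "z' t = x' t + \<phi>' t *\<^sub>R w" for t
  have z_in: "z t \<in> cball (x s0) \<rho>" if t: "t \<in> {s0..n}" for t
  proof -
    have "dist (x s0) (z t) \<le> dist (x s0) (x t) + dist (x t) (z t)"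
      by (rule dist_triangle)
    moreover have "dist (x t) (z t) \<le> \<delta> * norm w"
      using mult_right_mono[OF \<phi>_bound(1)[OF t], of "norm w"] by (simp add: z_def dist_norm)
    ultimately show ?thesis
      using xt(2)[of t] t n by (simp add: \<delta>_def)
  qed
  have z_img: "z ` {s0..n} \<subseteq> snd c ` fst c"
    using z_in \<rho>(2) by blast
  have z_deriv: "\<forall>t\<in>{s0..n}. (z has_vector_derivative z' t) (at t within {s0..n})"
    unfolding z_def z'_def
  proof (intro ballI has_vector_derivative_add)
    fix t assume t: "t \<in> {s0..n}"
    show "(x has_vector_derivative x' t) (at t within {s0..n})"
      using t n m by (intro has_vector_derivative_within_subset[OF x_deriv]) auto
    show "((\<lambda>t. \<phi> t *\<^sub>R w) has_vector_derivative \<phi>' t *\<^sub>R w) (at t within {s0..n})"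
      using has_vector_derivative_scaleR[of \<phi> "\<phi>' t" t "{s0..n}" "\<lambda>_. w" 0] \<phi>_deriv
      by (simp add: has_real_derivative_iff_has_vector_derivative)
  qed
  have "continuous_on {s0..n} \<phi>'"
    unfolding \<phi>'_def using \<delta> by (intro continuous_intros) auto
  then have z'_cont: "continuous_on {s0..n} z'"
    unfolding z'_def using n by (intro continuous_on_add continuous_on_scaleR continuous_on_const
        continuous_on_subset[OF x'_cont]) auto
  note Z = chart_curve[OF n(3) c(1) z_img z_deriv z'_cont]
  have lag_le: "\<bar>chart_lagrangian c t (z t) (z' t)\<bar> \<le> C" if t: "t \<in> {s0..n}" for t
  proof (rule C(2))
    show "(t, z t) \<in> {s0..m} \<times> cball (x s0) \<rho>"
      using z_in[OF t] t n by auto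
    have "norm (z' t) \<le> norm (x' t) + norm (\<phi>' t *\<^sub>R w)"
      unfolding z'_def by (rule norm_triangle_ineq)
    also have "\<dots> \<le> R + 2 * norm w"
      using R[of t] t n mult_right_mono[OF \<phi>_bound(2)[OF t], of "norm w"] by simp
    finally show "norm (z' t) \<le> R + 2 * norm w" .
  qed
  have nT: "{s0..n} \<subseteq> T" "n < s1" using n m s by auto
  have "action (chart_inv c \<circ> z) s0 n \<le> C * (n - s0)"
  proof -
    have "(\<lambda>s. chart_lagrangian c s (z s) (z' s)) integrable_on {s0..n}"
    proof (rule integrable_eq[OF lag_integrable[OF n(3) nT(1) Z(1)]])
      show "lag (chart_inv c \<circ> z) s0 n t = chart_lagrangian c t (z t) (z' t)" if "t \<in> {s0..n}" for t
        using Z(2)[OF that] by (simp add: lag_def chart_lagrangian_def)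
    qed
    then have "integral {s0..n} (\<lambda>s. chart_lagrangian c s (z s) (z' s)) \<le> integral {s0..n} (\<lambda>_. C)"
      using lag_le by (intro integral_le) (auto simp: abs_le_iff)
    then show ?thesis
      using n(3) action_chart_curve[OF n(3) c(1) z_img z_deriv z'_cont] by (simp add: mult.commute)
  qed
  then have act: "action (chart_inv c \<circ> z) s0 n + action \<gamma> n s1 < y"
    using n(1) by simp
  have n_in: "n \<in> {s0..n}" "s0 \<in> {s0..n}" using n by auto
  have \<phi>0: "\<phi> n = 0" "\<phi>' n = 0" "\<phi> s0 = 0" "\<phi>' s0 = 1"
    using \<delta> by (auto simp: \<phi>_def \<phi>'_def \<delta>_def)
  have zn: "(chart_inv c \<circ> z) n = \<gamma> n" "(chart_inv c \<circ> z) s0 = \<gamma> s0"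
    using n xt(1) c by (auto simp: z_def \<phi>0 x_def chart_inv_left)
  have \<gamma>n: "C1_curve A \<gamma> {n..s1}" and \<gamma>n': "velocity A \<gamma> {n..s1} n = velocity A \<gamma> {s0..s1} n"
    using C1_curve_subinterval[OF _ nT(2) order_refl open_dom \<gamma>(1)] n nT(2) by auto
  have vn: "velocity A (chart_inv c \<circ> z) {s0..n} n = velocity A \<gamma> {n..s1} n"
    using Z(2)[OF n_in(1)] velocity_eq_coord_vec[OF s(1) \<gamma>(1) _ c(1) xt(1), of n] zn n nT
    by (simp add: \<gamma>n' z'_def \<phi>0 x'_def)
  note G = action_glue[OF n(3) nT(2) s(2) Z(1) \<gamma>n zn(1) vn]
  let ?\<gamma> = "\<lambda>s. if s \<le> n then (chart_inv c \<circ> z) s else \<gamma> s"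
  have "velocity A ?\<gamma> {s0..s1} s0 = velocity A (chart_inv c \<circ> z) {s0..n} s0"
    by (rule C1_curve_glue(2)[OF n(3) nT(2) open_dom Z(1) \<gamma>n zn(1) vn n_in(2)])
  also have "\<dots> = coord_vec A c (\<gamma> s0) (\<xi> c)"
    using Z(2)[OF n_in(2)] zn by (simp add: z'_def \<phi>0 w_def)
  also have "\<dots> = \<xi>"
    using tangent_eq_coord_vec[OF c \<xi>] by simp
  finally have v0: "velocity A ?\<gamma> {s0..s1} s0 = \<xi>" .
  show ?thesis
    by (rule that[OF G(1) _ _ v0]) (use zn n nT act G(2) in auto)
qed

text \<open>The triangle inequality for the least action. The second curve is altered so as to leave
  \<open>e1\<close> with the velocity with which the first one arrives; the strict bound on its
  action survives, and the two curves join smoothly.\<close>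

lemma conn_trans:
  assumes "conn e0 e1 y" "conn e1 e2 z" "fst e0 \<in> T" "fst e2 \<in> T"
  shows "conn e0 e2 (y + z)"
proof -
  obtain t0 q0 t1 q1 t2 q2 where e: "e0 = (t0, q0)" "e1 = (t1, q1)" "e2 = (t2, q2)"
    by (metis surj_pair)
  obtain \<gamma>1 where 1: "t0 < t1" "C1_curve A \<gamma>1 {t0..t1}" "\<gamma>1 t0 = q0" "\<gamma>1 t1 = q1" "action \<gamma>1 t0 t1 < y"
    using assms(1) unfolding e by (rule connE)
  obtain \<gamma>2 where 2: "t1 < t2" "C1_curve A \<gamma>2 {t1..t2}" "\<gamma>2 t1 = q1" "\<gamma>2 t2 = q2" "action \<gamma>2 t1 t2 < z"
    using assms(2) unfolding e by (rule connE)
  have T02: "{t0..t2} \<subseteq> T" using assms by (intro Icc_subset_T) (auto simp: e)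
  then have T12: "{t1..t2} \<subseteq> T" using 1(1) by auto
  have "velocity A \<gamma>1 {t0..t1} t1 \<in> tangent_space A (\<gamma>2 t1)"
    using velocity_tangent[OF 1(1,2), of t1] 1 2 by simp
  then obtain \<gamma>3 where 3: "C1_curve A \<gamma>3 {t1..t2}" "\<gamma>3 t1 = \<gamma>2 t1" "\<gamma>3 t2 = \<gamma>2 t2"
    "velocity A \<gamma>3 {t1..t2} t1 = velocity A \<gamma>1 {t0..t1} t1" "action \<gamma>3 t1 t2 < z"
    using action_change_initial_velocity[OF 2(1) T12 2(2,5)] by metis
  have "\<gamma>1 t1 = \<gamma>3 t1" using 1 2 3 by simp
  note G = action_glue[OF 1(1) 2(1) T02 1(2) 3(1) this 3(4)[symmetric]]
  show ?thesis
    using connI[OF _ G(1), of "y + z"] G(2) 1 2 3 by (simp add: e)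
qed

text \<open>Straight coordinate segments of speed at most \<open>R\<close> stay in the convex ball,
  where the Lagrangian is bounded by some \<open>C\<close>; their action is at most \<open>C\<close>
  times the duration. The constants depend on \<open>R\<close> but not on the end points of the
  segment.\<close>

lemma conn_segment:
  assumes "t1 \<in> T" "c \<in> A" "q \<in> fst c"
  obtains \<rho> C where "\<rho> > 0" "C \<ge> 0" "cball (snd c q) \<rho> \<subseteq> snd c ` fst c" "{t1 - \<rho>..t1 + \<rho>} \<subseteq> T"
    "\<And>s t x x' y. t1 - \<rho> \<le> s \<Longrightarrow> s < t \<Longrightarrow> t \<le> t1 + \<rho> \<Longrightarrow> x \<in> cball (snd c q) \<rho> \<Longrightarrow>
       x' \<in> cball (snd c q) \<rho> \<Longrightarrow> norm (x' - x) \<le> R * (t - s) \<Longrightarrow> C * (t - s) < y \<Longrightarrow>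
       conn (s, chart_inv c x) (t, chart_inv c x') y"
proof -
  obtain \<rho>1 where \<rho>1: "\<rho>1 > 0" "cball (snd c q) \<rho>1 \<subseteq> snd c ` fst c"
    using open_img[OF assms(2)] assms(3) unfolding open_contains_cball by auto
  obtain \<rho>2 where \<rho>2: "\<rho>2 > 0" "cball t1 \<rho>2 \<subseteq> T"
    using open_T assms(1) unfolding open_contains_cball by auto
  define \<rho> where "\<rho> = min \<rho>1 \<rho>2"
  have \<rho>: "\<rho> > 0" "\<rho> \<le> \<rho>1" "\<rho> \<le> \<rho>2"
    using \<rho>1 \<rho>2 by (auto simp: \<rho>_def)
  have sub: "cball (snd c q) \<rho> \<subseteq> snd c ` fst c" "{t1 - \<rho>..t1 + \<rho>} \<subseteq> T"
    using \<rho>1(2) \<rho>2(2) \<rho> subset_cball[OF \<rho>(2), of "snd c q"] subset_cball[OF \<rho>(3), of t1]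
    by (auto simp: cball_eq_atLeastAtMost)
  have K: "compact ({t1 - \<rho>..t1 + \<rho>} \<times> cball (snd c q) \<rho>)"
    "{t1 - \<rho>..t1 + \<rho>} \<times> cball (snd c q) \<rho> \<subseteq> T \<times> snd c ` fst c"
    using sub by (auto intro!: compact_Times compact_cball_model)
  obtain C where C: "C \<ge> 0" "\<And>t x v. (t, x) \<in> {t1 - \<rho>..t1 + \<rho>} \<times> cball (snd c q) \<rho> \<Longrightarrow> norm v \<le> R \<Longrightarrow>
      \<bar>chart_lagrangian c t x v\<bar> \<le> C"
    using chart_lagrangian_bounded[OF assms(2) K] by blast
  show ?thesis
  proof (rule that[OF \<rho>(1) C(1) sub])
    fix s t x x' y
    assume st: "t1 - \<rho> \<le> s" "s < t" "t \<le> t1 + \<rho>" and x: "x \<in> cball (snd c q) \<rho>" "x' \<in> cball (snd c q) \<rho>"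
      and R: "norm (x' - x) \<le> R * (t - s)" and y: "C * (t - s) < y"
    define v where "v = (1 / (t - s)) *\<^sub>R (x' - x)"
    define z where "z r = x + (r - s) *\<^sub>R v" for r
    have z_ends: "z s = x" "z t = x'"
      using st(2) by (simp_all add: z_def v_def)
    have "norm v \<le> R"
    proof -
      have "norm v = norm (x' - x) / (t - s)" using st(2) by (simp add: v_def)
      then show ?thesis using R st(2) by (simp add: pos_divide_le_eq)
    qed
    have z_in: "z r \<in> cball (snd c q) \<rho>" if r: "r \<in> {s..t}" for r
    proof -
      define u where "u = (r - s) / (t - s)"
      have "0 \<le> u" "u \<le> 1" using r st(2) by (auto simp: u_def field_simps)
      then have "(1 - u) *\<^sub>R x + u *\<^sub>R x' \<in> cball (snd c q) \<rho>"
        by (rule convexD_alt[OF convex_cball x])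
      also have "(1 - u) *\<^sub>R x + u *\<^sub>R x' = z r"
        by (simp add: z_def v_def u_def algebra_simps)
      finally show ?thesis .
    qed
    have z_img: "z ` {s..t} \<subseteq> snd c ` fst c"
      using z_in sub(1) by blast
    have z_deriv: "\<forall>r\<in>{s..t}. (z has_vector_derivative v) (at r within {s..t})"
      unfolding z_def by (auto intro!: derivative_eq_intros)
    have v_cont: "continuous_on {s..t} (\<lambda>_. v)" by (rule continuous_on_const)
    note Z = chart_curve[OF st(2) assms(2) z_img z_deriv v_cont]
    have stT: "{s..t} \<subseteq> T" using sub(2) st by auto
    have lag_le: "lag (chart_inv c \<circ> z) s t r \<le> C" if r: "r \<in> {s..t}" for r
    proof -
      have "lag (chart_inv c \<circ> z) s t r = chart_lagrangian c r (z r) v"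
        using Z(2)[OF r] by (simp add: lag_def chart_lagrangian_def)
      moreover have "\<bar>chart_lagrangian c r (z r) v\<bar> \<le> C"
        using z_in[OF r] r st \<open>norm v \<le> R\<close> by (intro C(2)) auto
      ultimately show ?thesis by linarith
    qed
    have "action (chart_inv c \<circ> z) s t \<le> integral {s..t} (\<lambda>_. C)"
      unfolding action_def
      by (rule integral_le[OF lag_integrable[OF st(2) stT Z(1)] integrable_const_ivl lag_le])
    then have "action (chart_inv c \<circ> z) s t < y"
      using y st(2) by (simp add: mult.commute)
    from connI[OF st(2) Z(1) this] show "conn (s, chart_inv c x) (t, chart_inv c x') y"
      by (simp add: z_ends)
  qed
qed

text \<open>Resting at \<open>q0\<close> is a segment of speed \<open>0\<close>, so its action is at
  most proportional to the elapsed time.\<close>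

lemma conn_const:
  assumes "t0 \<in> T" "\<epsilon> > 0"
  obtains \<rho> where "\<rho> > 0" "\<And>t. t0 < t \<Longrightarrow> t < t0 + \<rho> \<Longrightarrow> t \<in> T \<and> conn (t0, q0) (t, q0) \<epsilon>"
proof -
  obtain c where c: "c \<in> A" "q0 \<in> fst c" using chart_cover by blast
  obtain \<rho> C where \<rho>: "\<rho> > 0" "C \<ge> 0" "{t0 - \<rho>..t0 + \<rho>} \<subseteq> T"
    "\<And>s t x x' y. t0 - \<rho> \<le> s \<Longrightarrow> s < t \<Longrightarrow> t \<le> t0 + \<rho> \<Longrightarrow> x \<in> cball (snd c q0) \<rho> \<Longrightarrow>
       x' \<in> cball (snd c q0) \<rho> \<Longrightarrow> norm (x' - x) \<le> 0 * (t - s) \<Longrightarrow> C * (t - s) < y \<Longrightarrow>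
       conn (s, chart_inv c x) (t, chart_inv c x') y"
    using conn_segment[OF assms(1) c, of 0] by metis
  show ?thesis
  \<comment> \<open>\<open>C\<close> may vanish, so the division is by \<open>C + 1\<close>.\<close>
  proof (rule that[of "min \<rho> (\<epsilon> / (C + 1))"])
    show "min \<rho> (\<epsilon> / (C + 1)) > 0" using \<rho> assms by simp
    fix t assume t: "t0 < t" "t < t0 + min \<rho> (\<epsilon> / (C + 1))"
    have "C * (t - t0) \<le> (C + 1) * (t - t0)"
      using t by (simp add: algebra_simps)
    also have "\<dots> < \<epsilon>"
    proof -
      have "t - t0 < min \<rho> (\<epsilon> / (C + 1))" using t(2) by linarith
      then have "t - t0 < \<epsilon> / (C + 1)" by simp
      then show ?thesis using \<rho>(2) by (simp add: pos_less_divide_eq mult.commute)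
    qed
    finally have "conn (t0, chart_inv c (snd c q0)) (t, chart_inv c (snd c q0)) \<epsilon>"
      using t \<rho>(1) by (intro \<rho>(4)) auto
    then show "t \<in> T \<and> conn (t0, q0) (t, q0) \<epsilon>"
      using t \<rho>(1,3) by (auto simp: chart_inv_left[OF c])
  qed
qed

text \<open>A point near \<open>(t1, q1)\<close> is joined by a coordinate segment to a slightly
  later point \<open>\<gamma> m\<close> of the given curve. The speeds of these segments are bounded
  uniformly in \<open>m\<close>, so for \<open>m\<close> near \<open>t1\<close> their cost fits into
  the slack of the strict inequality.\<close>

lemma conn_open_left:
  assumes "conn (t1, q1) e y" "t1 \<in> T" "fst e \<in> T"
  obtains U where "open U" "(t1, q1) \<in> U" "\<And>e'. e' \<in> U \<Longrightarrow> conn e' e y"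
proof -
  obtain t2 q2 where e: "e = (t2, q2)" by fastforce
  obtain \<gamma> where \<gamma>: "t1 < t2" "C1_curve A \<gamma> {t1..t2}" "\<gamma> t1 = q1" "\<gamma> t2 = q2" "action \<gamma> t1 t2 < y"
    using assms(1) unfolding e by (rule connE)
  have T12: "{t1..t2} \<subseteq> T" using assms by (intro Icc_subset_T) (auto simp: e)
  note D = C1_curveD[OF \<gamma>(1) open_dom \<gamma>(2)]
  obtain c where c: "c \<in> A" "q1 \<in> fst c" using chart_cover by blast
  define x where "x = snd c \<circ> \<gamma>"
  have x1: "x t1 = snd c q1" by (simp add: x_def \<gamma>(3))
  have t1_in: "t1 \<in> {t1..t2}" using \<gamma>(1) by simp
  have atr: "at t1 within {t1..t2} = at_right t1"
    by (rule at_within_Icc_at_right[OF \<gamma>(1)])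
  define v where "v = velocity A \<gamma> {t1..t2} t1 c"
  have xd: "(x has_vector_derivative v) (at_right t1)"
    using D(2)[OF c(1) t1_in] c(2) \<gamma>(3) by (simp add: x_def v_def atr)
  \<comment> \<open>Differentiability at \<open>t1\<close> gives the Lipschitz bound
    \<open>k\<close> for the coordinate curve just after \<open>t1\<close>, the added 1 absorbing
    the error term.\<close>
  define k where "k = norm v + 1"
  have "\<forall>\<^sub>F t in at_right t1. norm (x t - x t1 - (t - t1) *\<^sub>R v) \<le> 1 * norm (t - t1)"
    using xd unfolding has_vector_derivative_def has_derivative_within_alt2 by (metis zero_less_one)
  moreover have pos: "\<forall>\<^sub>F t in at_right t1. t1 < t"
    by (rule eventually_at_right_less)
  ultimately have lip: "\<forall>\<^sub>F t in at_right t1. norm (x t - x t1) \<le> k * (t - t1)"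
  proof eventually_elim
    case (elim t)
    have "norm (x t - x t1) \<le> norm (x t - x t1 - (t - t1) *\<^sub>R v) + norm ((t - t1) *\<^sub>R v)"
      using norm_triangle_ineq[of "x t - x t1 - (t - t1) *\<^sub>R v" "(t - t1) *\<^sub>R v"] by simp
    moreover have "norm ((t - t1) *\<^sub>R v) = (t - t1) * norm v" "norm (t - t1) = t - t1"
      using elim by simp_all
    moreover have "k * (t - t1) = (t - t1) * norm v + (t - t1)"
      by (simp add: k_def algebra_simps)
    ultimately show ?case
      using elim by linarith
  qed
  obtain \<rho> C where \<rho>: "\<rho> > 0" "C \<ge> 0" "cball (snd c q1) \<rho> \<subseteq> snd c ` fst c" "{t1 - \<rho>..t1 + \<rho>} \<subseteq> T"
    "\<And>s t x x' y. t1 - \<rho> \<le> s \<Longrightarrow> s < t \<Longrightarrow> t \<le> t1 + \<rho> \<Longrightarrow> x \<in> cball (snd c q1) \<rho> \<Longrightarrow>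
       x' \<in> cball (snd c q1) \<rho> \<Longrightarrow> norm (x' - x) \<le> 2 * (k + 1) * (t - s) \<Longrightarrow> C * (t - s) < y \<Longrightarrow>
       conn (s, chart_inv c x) (t, chart_inv c x') y"
    using conn_segment[OF assms(2) c, of "2 * (k + 1)"] by metis
  have "((\<lambda>m. C * (2 * (m - t1)) + action \<gamma> m t2) \<longlongrightarrow> C * (2 * (t1 - t1)) + action \<gamma> t1 t2) (at_right t1)"
    by (intro tendsto_intros action_tail_tendsto \<gamma> T12)
  then have ev1: "\<forall>\<^sub>F m in at_right t1. C * (2 * (m - t1)) + action \<gamma> m t2 < y"
    using \<gamma>(5) by (intro order_tendstoD(2)) auto
  have "((\<lambda>m. k * (m - t1)) \<longlongrightarrow> k * (t1 - t1)) (at_right t1)"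
    by (intro tendsto_intros)
  then have ev2: "\<forall>\<^sub>F m in at_right t1. k * (m - t1) < \<rho>"
    using \<rho>(1) by (intro order_tendstoD(2)) auto
  have in_c: "\<forall>\<^sub>F m in at_right t1. \<gamma> m \<in> fst c"
  proof -
    have "(\<gamma> \<longlongrightarrow> \<gamma> t1) (at t1 within {t1..t2})"
      using D(1) t1_in by (auto simp: continuous_on_def)
    then show ?thesis
      unfolding atr using c open_dom \<gamma>(3) by (intro topological_tendstoD) auto
  qed
  have "\<forall>\<^sub>F m in at_right t1. m \<in> {t1<..<min t2 (t1 + \<rho>)}"
    using \<gamma>(1) \<rho>(1) by (intro eventually_at_right_real) auto
  with lip ev1 ev2 in_c have "\<forall>\<^sub>F m in at_right t1. norm (x m - x t1) \<le> k * (m - t1) \<and>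
     C * (2 * (m - t1)) + action \<gamma> m t2 < y \<and> k * (m - t1) < \<rho> \<and> \<gamma> m \<in> fst c \<and> m \<in> {t1<..<min t2 (t1 + \<rho>)}"
    by eventually_elim simp
  from eventually_happens'[OF trivial_limit_at_right_real this]
  obtain m where "norm (x m - x t1) \<le> k * (m - t1) \<and>
     C * (2 * (m - t1)) + action \<gamma> m t2 < y \<and> k * (m - t1) < \<rho> \<and> \<gamma> m \<in> fst c \<and> m \<in> {t1<..<min t2 (t1 + \<rho>)}"
    by (rule exE)
  then have m: "norm (x m - x t1) \<le> k * (m - t1)"
     "C * (2 * (m - t1)) + action \<gamma> m t2 < y" "k * (m - t1) < \<rho>" "\<gamma> m \<in> fst c" "t1 < m" "m < t2" "m < t1 + \<rho>"
    by simp_all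
  define \<delta> where "\<delta> = m - t1"
  \<comment> \<open>A starting point in \<open>U\<close> is at coordinate distance at most
    \<open>(k + 1) * \<delta>\<close> from \<open>x m\<close>, and the time left is at least
    \<open>\<delta> / 2\<close>: this is the speed bound \<open>2 * (k + 1)\<close>. The time left
    is also at most \<open>2 * \<delta>\<close>, which bounds the cost.\<close>
  define U where "U = {t1 - \<delta> / 2<..<t1 + \<delta> / 2} \<times> chart_inv c ` ball (x t1) \<delta>"
  have \<delta>: "\<delta> > 0" "\<delta> < \<rho>" using m by (auto simp: \<delta>_def)
  have ball_sub: "ball (x t1) \<delta> \<subseteq> cball (snd c q1) \<rho>"
    using \<delta>(2) by (auto simp: x1)
  have m_in: "x m \<in> cball (snd c q1) \<rho>"
    using m(1,3) by (simp add: dist_norm norm_minus_commute x1)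
  have xm: "chart_inv c (x m) = \<gamma> m"
    using chart_inv_left[OF c(1) m(4)] by (simp add: x_def)
  show ?thesis
  proof (rule that[of U])
    show "open U"
      unfolding U_def using ball_sub \<rho>(3) by (intro open_Times open_chart_inv_image c) auto
    show "(t1, q1) \<in> U"
      using \<delta> c by (auto simp: U_def x1 chart_inv_left intro!: image_eqI[of _ _ "snd c q1"])
    fix e' assume "e' \<in> U"
    then obtain t' x' where e': "e' = (t', chart_inv c x')" "t1 - \<delta> / 2 < t'" "t' < t1 + \<delta> / 2" "x' \<in> ball (x t1) \<delta>"
      by (auto simp: U_def)
    define z where "z = y - action \<gamma> m t2"
    have t'm: "t' < m" "m - t' \<ge> \<delta> / 2" "m - t' \<le> 2 * \<delta>"
      using e'(2,3) \<delta> by (auto simp: \<delta>_def field_simps)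
    have k: "k \<ge> 0" by (simp add: k_def)
    have "norm (x m - x') \<le> norm (x m - x t1) + norm (x t1 - x')"
      using norm_triangle_ineq[of "x m - x t1" "x t1 - x'"] by simp
    also have "\<dots> \<le> k * \<delta> + \<delta>"
      using m(1) e'(4) by (simp add: \<delta>_def dist_norm)
    also have "\<dots> = 2 * (k + 1) * (\<delta> / 2)"
      by (simp add: algebra_simps)
    also have "\<dots> \<le> 2 * (k + 1) * (m - t')"
      using t'm(2) k by (intro mult_left_mono) auto
    finally have dist: "norm (x m - x') \<le> 2 * (k + 1) * (m - t')" .
    have "C * (m - t') \<le> C * (2 * \<delta>)"
      using t'm \<rho>(2) by (intro mult_left_mono) auto
    then have cost: "C * (m - t') < y - action \<gamma> m t2"
      using m(2) by (simp add: \<delta>_def)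
    \<comment> \<open>An intermediate value gives strict bounds both to the segment, by
      \<open>z\<close>, and to the remaining curve, by \<open>y - z\<close>.\<close>
    then obtain z where z: "C * (m - t') < z" "z < y - action \<gamma> m t2"
      using dense by blast
    have "conn (t', chart_inv c x') (m, chart_inv c (x m)) z"
      using e' ball_sub m_in dist z t'm \<delta> m by (intro \<rho>(5)) auto
    moreover have "conn (m, \<gamma> m) (t2, \<gamma> t2) (y - z)"
      using z m C1_curve_subinterval(1)[OF _ m(6) order_refl open_dom \<gamma>(2)] by (intro connI) auto
    moreover have "t' \<in> T"
      using \<rho>(4) e' \<delta> by auto
    ultimately show "conn e' e y"
      using conn_trans[of e' "(m, \<gamma> m)" z e "y - z"] assms(3) by (simp add: e' e xm \<gamma>(4))
  qed
qed

text \<open>A curve that ends at \<open>q1\<close> after starting elsewhere crosses a coordinate sphere around \<open>q1\<close>.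
  In a short time the last part of it costs more than any given \<open>k\<close>.\<close>

lemma conn_crossing:
  assumes "t1 \<in> T" "q2 \<noteq> q1" "open N" "(t1, q1) \<in> N"
  obtains \<tau> where "\<tau> > 0"
    "\<And>t' t y. t1 \<le> t' \<Longrightarrow> t < t1 + \<tau> \<Longrightarrow> conn (t', q2) (t, q1) y \<Longrightarrow>
       \<exists>s p. t' < s \<and> s < t \<and> (s, p) \<in> N \<and> conn (t', q2) (s, p) (y - k)"
proof -
  obtain N1 N2 where N: "open N1" "open N2" "t1 \<in> N1" "q1 \<in> N2" "N1 \<times> N2 \<subseteq> N"
    using assms(3,4) by (metis open_prod_elim mem_Times_iff fst_conv snd_conv)
  obtain c where c: "c \<in> A" "q1 \<in> fst c" using chart_cover by blast
  define x1 where "x1 = snd c q1"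
  \<comment> \<open>Removing \<open>q2\<close> ensures that the curve starts outside the coordinate
    ball; intersecting with \<open>N2\<close> ensures that the crossing point lies in
    \<open>N\<close>.\<close>
  define U where "U = fst c \<inter> N2 - {q2}"
  have U: "open U" "U \<subseteq> fst c" "q1 \<in> U"
    using open_dom c N assms(2) by (auto simp: U_def intro: open_delete)
  obtain \<rho> where \<rho>: "\<rho> > 0" "cball x1 \<rho> \<subseteq> snd c ` U"
    using open_chart_image[OF c(1) U(1,2)] U(3) unfolding open_contains_cball x1_def by blast
  have \<rho>_img: "cball x1 \<rho> \<subseteq> snd c ` fst c" using \<rho>(2) U(2) by blast
  have inv_U: "chart_inv c z \<in> U" if "z \<in> cball x1 \<rho>" for z
  proof -
    have "z \<in> snd c ` U" using that \<rho>(2) by blast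
    then obtain q where "q \<in> U" "z = snd c q" by blast
    then show ?thesis using chart_inv_left[OF c(1)] U(2) by auto
  qed
  obtain \<tau>0 where \<tau>0: "\<tau>0 > 0" "cball t1 \<tau>0 \<subseteq> T \<inter> N1"
    using open_Int[OF open_T N(1)] assms(1) N(3) unfolding open_contains_cball by blast
  have \<tau>0': "{t1..t1 + \<tau>0} \<subseteq> T \<inter> N1"
    using \<tau>0(2) by (auto simp: cball_eq_atLeastAtMost)
  have K: "compact ({t1..t1 + \<tau>0} \<times> cball x1 \<rho>)" "{t1..t1 + \<tau>0} \<times> cball x1 \<rho> \<subseteq> T \<times> snd c ` fst c"
    using \<tau>0' \<rho>_img by (auto intro!: compact_Times compact_cball_model)
  \<comment> \<open>Crossing a coordinate distance \<open>\<rho>\<close> contributes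
    \<open>M * \<rho> = \<bar>k\<bar> + 1\<close>. The extra 1 pays for the constant
    \<open>C\<close>, since \<open>\<tau>\<close> is chosen so that \<open>C\<close> times the
    elapsed time is at most 1.\<close>
  define M where "M = (\<bar>k\<bar> + 1) / \<rho>"
  obtain C where C: "\<And>t x v. (t, x) \<in> {t1..t1 + \<tau>0} \<times> cball x1 \<rho> \<Longrightarrow> M * norm v - C \<le> chart_lagrangian c t x v"
    using chart_lagrangian_superlinear[OF c(1) K] by metis
  define \<tau> where "\<tau> = min \<tau>0 (1 / (\<bar>C\<bar> + 1))"
  define W where "W = chart_inv c ` ball x1 \<rho>"
  have W: "open W" "q1 \<in> W" "q2 \<notin> W"
  proof -
    show "open W"
      unfolding W_def using \<rho>_img by (intro open_chart_inv_image c) (auto simp: subset_iff mem_ball mem_cball)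
    show "q1 \<in> W"
      unfolding W_def using \<rho>(1) c by (intro image_eqI[of _ _ x1]) (auto simp: x1_def chart_inv_left)
    show "q2 \<notin> W"
    proof
      assume "q2 \<in> W"
      then obtain z where z: "z \<in> ball x1 \<rho>" "q2 = chart_inv c z" by (auto simp: W_def)
      then have "q2 \<in> U" using inv_U[of z] by simp
      then show False by (simp add: U_def)
    qed
  qed
  show ?thesis
  proof (rule that[of \<tau>])
    show "\<tau> > 0" using \<tau>0(1) by (simp add: \<tau>_def)
    fix t' t y
    assume t: "t1 \<le> t'" "t < t1 + \<tau>" and conn: "conn (t', q2) (t, q1) y"
    obtain \<gamma> where \<gamma>: "t' < t" "C1_curve A \<gamma> {t'..t}" "\<gamma> t' = q2" "\<gamma> t = q1" "action \<gamma> t' t < y"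
      using conn by (rule connE)
    note D = C1_curveD[OF \<gamma>(1) open_dom \<gamma>(2)]
    have tT: "{t'..t} \<subseteq> {t1..t1 + \<tau>0}" using t by (auto simp: \<tau>_def)
    \<comment> \<open>The maximum of this compact set of times is the last time outside the open
      ball.\<close>
    define F where "F = {s \<in> {t'..t}. \<gamma> s \<in> - W}"
    have "closed F"
      unfolding F_def using W(1) by (intro continuous_closed_preimage[OF D(1), unfolded vimage_def Int_def mem_Collect_eq]) auto
    moreover have "F \<subseteq> {t'..t}" by (auto simp: F_def)
    ultimately have "compact F"
      using compact_Int_closed[OF compact_Icc, of F t' t] by (simp add: Int_absorb1)
    moreover have "t' \<in> F" using \<gamma> W(3) by (simp add: F_def)
    then have "F \<noteq> {}" by blast
    ultimately obtain s where s: "s \<in> F" "\<forall>r\<in>F. r \<le> s"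
      using compact_attains_sup by blast
    have st: "t' \<le> s" "s < t" "\<gamma> s \<notin> W"
      using s \<gamma>(4) W(2) by (auto simp: F_def order.order_iff_strict)
    have after: "\<gamma> r \<in> W" if "s < r" "r \<le> t" for r
    proof (rule ccontr)
      assume "\<gamma> r \<notin> W"
      then have "r \<in> F" using that st(1) by (simp add: F_def)
      then show False using s(2) that(1) by auto
    qed
    \<comment> \<open>The image of the closed ball is compact, hence closed in the Hausdorff space.
      So \<open>\<gamma> s\<close>, a limit of points of \<open>W\<close>, lies in it; as
      \<open>\<gamma> s\<close> is not in \<open>W\<close>, it lies on the sphere.\<close>
    have "closed (chart_inv c ` cball x1 \<rho>)"
      by (intro compact_imp_closed compact_continuous_image compact_cball_model
          continuous_on_subset[OF continuous_on_chart_inv[OF c(1)] \<rho>_img])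
    moreover have "(\<gamma> \<longlongrightarrow> \<gamma> s) (at_right s)"
    proof -
      have "(\<gamma> \<longlongrightarrow> \<gamma> s) (at s within {t'..t})"
        using D(1) st by (auto simp: continuous_on_def)
      then have "(\<gamma> \<longlongrightarrow> \<gamma> s) (at s within {s..t})"
        by (rule tendsto_within_subset) (use st in auto)
      then show ?thesis using at_within_Icc_at_right[OF st(2)] by simp
    qed
    moreover have "\<forall>\<^sub>F r in at_right s. \<gamma> r \<in> chart_inv c ` cball x1 \<rho>"
      using eventually_at_right_real[OF st(2)]
    proof eventually_elim
      case (elim r)
      then have "\<gamma> r \<in> W" by (intro after) auto
      then show ?case
        using image_mono[OF ball_subset_cball[of x1 \<rho>], of "chart_inv c"] by (auto simp: W_def)
    qed
    ultimately have s_in: "\<gamma> s \<in> chart_inv c ` cball x1 \<rho>"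
      using Lim_in_closed_set[of "chart_inv c ` cball x1 \<rho>" \<gamma> "at_right s" "\<gamma> s"] by simp
    then have "\<gamma> s \<in> U"
      by (rule imageE) (simp only: inv_U)
    then have "\<gamma> s \<noteq> q2" "\<gamma> s \<in> N2"
      by (simp_all add: U_def)
    then have t's: "t' < s" using st \<gamma>(3) by (auto simp: order.order_iff_strict)
    define x where "x = snd c \<circ> \<gamma>"
    define x' where "x' r = velocity A \<gamma> {t'..t} r c" for r
    have x_in: "\<gamma> r \<in> fst c" "x r \<in> cball x1 \<rho>" if r: "r \<in> {s..t}" for r
    proof -
      have "\<gamma> r \<in> chart_inv c ` cball x1 \<rho>"
      proof (cases "r = s")
        case False
        then have "\<gamma> r \<in> W" using r by (intro after) auto
        then show ?thesis
          using image_mono[OF ball_subset_cball[of x1 \<rho>], of "chart_inv c"] by (auto simp: W_def)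
      qed (use s_in in simp)
      then obtain z where z: "z \<in> cball x1 \<rho>" "\<gamma> r = chart_inv c z" by blast
      then have zi: "z \<in> snd c ` fst c" using \<rho>_img by blast
      show "\<gamma> r \<in> fst c" using z(2) chart_inv_in[OF zi] by simp
      show "x r \<in> cball x1 \<rho>" using z chart_inv_right[OF c(1) zi] by (simp add: x_def)
    qed
    have s_in_st: "s \<in> {s..t}" using st by simp
    have norm_xs: "norm (x t - x s) = \<rho>"
    proof (rule ccontr)
      assume "norm (x t - x s) \<noteq> \<rho>"
      then have "x s \<in> ball x1 \<rho>"
        using x_in(2)[OF s_in_st] by (simp add: x_def x1_def \<gamma>(4) dist_norm)
      moreover have "\<gamma> s = chart_inv c (x s)"
        using chart_inv_left[OF c(1) x_in(1)[OF s_in_st]] by (simp add: x_def)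
      ultimately show False using st(3) by (auto simp: W_def)
    qed
    \<comment> \<open>Projecting on the direction of the total displacement turns the displacement
      into the integral of a real function, and \<open>x' r \<bullet> w\<close> is a lower bound for
      the speed.\<close>
    define w where "w = (1 / \<rho>) *\<^sub>R (x t - x s)"
    have w: "norm w = 1" "(x t - x s) \<bullet> w = \<rho>"
      using norm_xs \<rho>(1) by (simp_all add: w_def dot_square_norm power2_eq_square)
    have int1: "((\<lambda>r. x' r \<bullet> w) has_integral (x t \<bullet> w - x s \<bullet> w)) {s..t}"
    proof (rule fundamental_theorem_of_calculus)
      show "s \<le> t" using st by simp
      fix r assume r: "r \<in> {s..t}"
      have "(x has_vector_derivative x' r) (at r within {t'..t})"
        unfolding x_def x'_def using r st x_in(1)[OF r] by (intro D(2) c) auto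
      then have "(x has_vector_derivative x' r) (at r within {s..t})"
        by (rule has_vector_derivative_within_subset) (use st in auto)
      then show "((\<lambda>r. x r \<bullet> w) has_vector_derivative x' r \<bullet> w) (at r within {s..t})"
        by (rule bounded_linear.has_vector_derivative[OF bounded_linear_inner_left])
    qed
    have "((\<lambda>_. C) has_integral (t - s) *\<^sub>R C) {s..t}"
      using has_integral_const_real[of C s t] st by simp
    from has_integral_diff[OF has_integral_mult_right[OF int1, of M] this]
    have int2: "((\<lambda>r. M * (x' r \<bullet> w) - C) has_integral M * \<rho> - (t - s) * C) {s..t}"
      using w(2) by (simp add: inner_diff_left)
    have tT': "{t'..t} \<subseteq> T" using tT \<tau>0' by blast
    then have "lag \<gamma> t' t integrable_on {t'..t}"
      by (intro lag_integrable \<gamma>)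
    then have "lag \<gamma> t' t integrable_on {s..t}"
      by (rule integrable_subinterval_real) (use st in auto)
    moreover have "M * (x' r \<bullet> w) - C \<le> lag \<gamma> t' t r" if r: "r \<in> {s..t}" for r
    proof -
      have r': "r \<in> {t'..t}" using r st by auto
      have "lag \<gamma> t' t r = chart_lagrangian c r (x r) (x' r)"
        unfolding lag_def chart_lagrangian_def x'_def
        by (subst velocity_eq_coord_vec[OF \<gamma>(1,2) r' c(1) x_in(1)[OF r]])
          (simp add: x_def chart_inv_left[OF c(1) x_in(1)[OF r]])
      moreover have "M * norm (x' r) - C \<le> chart_lagrangian c r (x r) (x' r)"
        using r' tT x_in(2)[OF r] by (intro C) blast
      moreover have "M * (x' r \<bullet> w) \<le> M * norm (x' r)"
        using norm_cauchy_schwarz[of "x' r" w] w(1) \<rho>(1) by (intro mult_left_mono) (auto simp: M_def)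
      ultimately show ?thesis by linarith
    qed
    ultimately have "M * \<rho> - (t - s) * C \<le> integral {s..t} (lag \<gamma> t' t)"
      by (intro has_integral_le[OF int2 integrable_integral]) auto
    also have "\<dots> = action \<gamma> s t"
      using action_eq_integral[OF st(1,2) order_refl \<gamma>(2)] by simp
    finally have low: "M * \<rho> - (t - s) * C \<le> action \<gamma> s t" .
    have "(t - s) * C \<le> (t - s) * (\<bar>C\<bar> + 1)"
      using st by (intro mult_left_mono) auto
    also have "\<dots> \<le> (1 / (\<bar>C\<bar> + 1)) * (\<bar>C\<bar> + 1)"
      using st t t's by (intro mult_right_mono) (auto simp: \<tau>_def)
    also have "\<dots> = 1" by simp
    finally have "k \<le> action \<gamma> s t"
      using low \<rho>(1) by (simp add: M_def)
    then have "action \<gamma> t' s < y - k"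
      using action_split[OF t's st(2) tT' \<gamma>(2)] \<gamma>(5) by simp
    then have "conn (t', \<gamma> t') (s, \<gamma> s) (y - k)"
      using C1_curve_subinterval(1)[OF order_refl t's _ open_dom \<gamma>(2)] st by (intro connI t's) auto
    moreover have "(s, \<gamma> s) \<in> N"
    proof -
      have "s \<in> {t'..t}" using st by simp
      then have "s \<in> N1" using tT \<tau>0' by blast
      then show ?thesis using N(5) \<open>\<gamma> s \<in> N2\<close> by blast
    qed
    ultimately show "\<exists>s p. t' < s \<and> s < t \<and> (s, p) \<in> N \<and> conn (t', q2) (s, p) (y - k)"
      using t's st \<gamma>(3) by blast
  qed
qed

section \<open>The chronological future\<close>

lemma tangent_scale:
  assumes "\<xi> \<in> tangent_space A q"
  shows "(\<lambda>c. k *\<^sub>R \<xi> c) \<in> tangent_space A q"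
proof -
  obtain c where c: "c \<in> A" "q \<in> fst c" using chart_cover by blast
  have "coord_vec A c q (k *\<^sub>R \<xi> c) = (\<lambda>c'. k *\<^sub>R coord_vec A c q (\<xi> c) c')"
    using coord_vec_lincomb[OF c, of k "\<xi> c" 0 0] by simp
  then have "coord_vec A c q (k *\<^sub>R \<xi> c) = (\<lambda>c'. k *\<^sub>R \<xi> c')"
    using tangent_eq_coord_vec[OF c assms] by simp
  then show ?thesis using coord_vec_tangent[OF c] by metis
qed

text \<open>With \<open>\<nu>\<close> as defined in the proof the two products are
  \<open>\<alpha> - 2 * \<tau> * \<nu>\<close> and \<open>- \<nu> - \<tau> / 2\<close>, where
  \<open>\<alpha> \<ge> 0\<close>. If the first is negative, \<open>\<tau>\<close> and
  \<open>\<nu>\<close> have the same strict sign, and the second decides which. Dividing by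
  \<open>2 * \<tau>\<close> then yields the inequality for the Lagrangian.\<close>

lemma future_timelike_iff:
  assumes "t \<in> T" and \<xi>: "\<xi> \<in> tangent_space A q"
  shows "gw_metric a b V ((t, q), y) ((\<tau>, \<xi>), \<eta>) ((\<tau>, \<xi>), \<eta>) < 0 \<and>
      gw_metric a b V ((t, q), y) (orientation_field V ((t, q), y)) ((\<tau>, \<xi>), \<eta>) < 0 \<longleftrightarrow>
    \<tau> > 0 \<and> \<tau> * lagrangian a b V t q (\<lambda>c. (1 / \<tau>) *\<^sub>R \<xi> c) < \<eta>"
proof -
  define \<alpha> where "\<alpha> = a t q \<xi> \<xi>"
  define \<nu> where "\<nu> = \<eta> - b t q \<xi> + V t q * \<tau>"
  have a0: "a t q (\<lambda>_. 0) \<xi> = 0" and b0: "b t q (\<lambda>_. 0) = 0"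
    using a_lin[OF assms(1) \<xi> \<xi> \<xi>, of 0 0] b_lin[OF assms(1) \<xi> \<xi>, of 0 0] by simp_all
  have \<alpha>: "\<alpha> \<ge> 0"
    using a_pos[OF assms] a0 by (cases "\<xi> = (\<lambda>_. 0)") (auto simp: \<alpha>_def)
  have "gw_metric a b V ((t, q), y) ((\<tau>, \<xi>), \<eta>) ((\<tau>, \<xi>), \<eta>) = \<alpha> - 2 * \<tau> * \<nu>"
    by (simp add: gw_metric_def \<alpha>_def \<nu>_def algebra_simps)
  moreover have "gw_metric a b V ((t, q), y) (orientation_field V ((t, q), y)) ((\<tau>, \<xi>), \<eta>) = - \<nu> - \<tau> / 2"
    by (simp add: gw_metric_def orientation_field_def \<nu>_def a0 b0 algebra_simps)
  moreover have "\<alpha> - 2 * \<tau> * \<nu> < 0 \<and> - \<nu> - \<tau> / 2 < 0 \<longleftrightarrow> \<tau> > 0 \<and> \<alpha> < 2 * \<tau> * \<nu>"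
  proof
    assume h: "\<alpha> - 2 * \<tau> * \<nu> < 0 \<and> - \<nu> - \<tau> / 2 < 0"
    then have "\<tau> * \<nu> > 0" using \<alpha> by linarith
    then have "\<tau> > 0" using h by (auto simp: zero_less_mult_iff)
    then show "\<tau> > 0 \<and> \<alpha> < 2 * \<tau> * \<nu>" using h by simp
  next
    assume h: "\<tau> > 0 \<and> \<alpha> < 2 * \<tau> * \<nu>"
    then have "\<tau> * \<nu> > 0" using \<alpha> by linarith
    then have "\<nu> > 0" using h by (auto simp: zero_less_mult_iff)
    then show "\<alpha> - 2 * \<tau> * \<nu> < 0 \<and> - \<nu> - \<tau> / 2 < 0" using h by simp
  qed
  moreover have "\<alpha> < 2 * \<tau> * \<nu> \<longleftrightarrow> \<tau> * lagrangian a b V t q (\<lambda>c. (1 / \<tau>) *\<^sub>R \<xi> c) < \<eta>" if "\<tau> > 0"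
  proof -
    let ?\<xi> = "\<lambda>c. (1 / \<tau>) *\<^sub>R \<xi> c"
    have 1: "a t q ?\<xi> \<zeta> = 1 / \<tau> * a t q \<xi> \<zeta>" if "\<zeta> \<in> tangent_space A q" for \<zeta>
      using a_lin[OF assms(1) \<xi> \<xi> that, of "1 / \<tau>" 0] by simp
    have h1: "a t q ?\<xi> ?\<xi> = 1 / \<tau> * (1 / \<tau> * \<alpha>)"
      using 1[OF tangent_scale[OF \<xi>]] 1[OF \<xi>] a_sym[OF assms(1) \<xi> tangent_scale[OF \<xi>]] by (simp add: \<alpha>_def)
    have h2: "b t q ?\<xi> = 1 / \<tau> * b t q \<xi>"
      using b_lin[OF assms(1) \<xi> \<xi>, of "1 / \<tau>" 0] by simp
    have "\<tau> * lagrangian a b V t q ?\<xi> = \<alpha> / (2 * \<tau>) + b t q \<xi> - V t q * \<tau>"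
      unfolding lagrangian_def h1 h2 using that by (simp add: field_simps)
    then have "\<tau> * lagrangian a b V t q ?\<xi> < \<eta> \<longleftrightarrow> \<alpha> / (2 * \<tau>) < \<nu>"
      by (auto simp: \<nu>_def)
    also have "\<dots> \<longleftrightarrow> \<alpha> < 2 * \<tau> * \<nu>"
      using that by (simp add: pos_divide_less_eq mult.commute)
    finally show ?thesis by simp
  qed
  ultimately show ?thesis by auto
qed

lemma conn_imp_chron_future:
  assumes "conn (t0, q0) (t1, q1) (y1 - y0)" "t0 \<in> T" "t1 \<in> T"
  shows "((t1, q1), y1) \<in> chron_future T A a b V ((t0, q0), y0)"
proof -
  obtain \<gamma> where \<gamma>: "t0 < t1" "C1_curve A \<gamma> {t0..t1}" "\<gamma> t0 = q0" "\<gamma> t1 = q1" "action \<gamma> t0 t1 < y1 - y0"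
    using assms(1) by (rule connE)
  have T: "{t0..t1} \<subseteq> T" using assms by (intro Icc_subset_T)
  let ?I = "{t0..t1}"
  note lc = continuous_on_lag[OF \<gamma>(1) T \<gamma>(2)]
  define k where "k = (y1 - y0 - action \<gamma> t0 t1) / (t1 - t0)"
  have k: "k > 0" using \<gamma>(1,5) by (simp add: k_def)
  define Y where "Y t = y0 + integral {t0..t} (lag \<gamma> t0 t1) + k * (t - t0)" for t
  define \<Gamma> where "\<Gamma> t = ((t, \<gamma> t), Y t)" for t
  have Yd: "(Y has_vector_derivative lag \<gamma> t0 t1 t + k) (at t within ?I)" if t: "t \<in> ?I" for t
  proof -
    have "((\<lambda>t. k * (t - t0)) has_vector_derivative k) (at t within ?I)"
      unfolding has_real_derivative_iff_has_vector_derivative[symmetric]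
      by (auto intro!: derivative_eq_intros)
    from has_vector_derivative_add[OF integral_has_vector_derivative[OF lc t] this]
    have "((\<lambda>t. integral {t0..t} (lag \<gamma> t0 t1) + k * (t - t0)) has_vector_derivative lag \<gamma> t0 t1 t + k) (at t within ?I)" .
    from has_vector_derivative_add[OF has_vector_derivative_const[of y0] this]
    show ?thesis by (simp add: Y_def[abs_def] add.assoc)
  qed
  have id: "((\<lambda>t. t) has_vector_derivative 1) (at t within ?I)" for t :: real
    by (auto intro!: derivative_eq_intros)
  have sc: "spacetime_C1_curve T A \<Gamma> ?I"
    unfolding spacetime_C1_curve_def
  proof (intro conjI)
    show "\<Gamma> ` ?I \<subseteq> spacetime T" using T by (auto simp: \<Gamma>_def spacetime_def)
    show "C1_on (\<lambda>s. fst (fst (\<Gamma> s))) ?I"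
      unfolding C1_on_def \<Gamma>_def using id by (auto intro!: exI[of _ "\<lambda>_. 1"] continuous_on_const)
    show "C1_curve A (\<lambda>s. snd (fst (\<Gamma> s))) ?I" using \<gamma>(2) by (simp add: \<Gamma>_def)
    show "C1_on (\<lambda>s. snd (\<Gamma> s)) ?I"
      unfolding C1_on_def \<Gamma>_def using Yd lc
      by (auto intro!: exI[of _ "\<lambda>t. lag \<gamma> t0 t1 t + k"] continuous_on_add continuous_on_const)
  qed
  have "future_timelike_curve T A a b V \<Gamma> ?I"
    unfolding future_timelike_curve_def Let_def
  proof (intro conjI[OF sc] ballI)
    fix t assume t: "t \<in> ?I"
    have nb: "at t within ?I \<noteq> bot" by (rule at_within_Icc_neq_bot[OF \<gamma>(1) t])
    have v: "spacetime_velocity A \<Gamma> ?I t = ((1, velocity A \<gamma> ?I t), lag \<gamma> t0 t1 t + k)"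
      using vector_derivative_within[OF nb id] vector_derivative_within[OF nb Yd[OF t]]
      by (simp add: spacetime_velocity_def \<Gamma>_def)
    show "gw_metric a b V (\<Gamma> t) (spacetime_velocity A \<Gamma> ?I t) (spacetime_velocity A \<Gamma> ?I t) < 0 \<and>
      gw_metric a b V (\<Gamma> t) (orientation_field V (\<Gamma> t)) (spacetime_velocity A \<Gamma> ?I t) < 0"
      unfolding v \<Gamma>_def
      by (subst future_timelike_iff[OF _ velocity_tangent[OF \<gamma>(1,2) t]]) (use t T k in \<open>auto simp: lag_def\<close>)
  qed
  moreover have "\<Gamma> t0 = ((t0, q0), y0)" by (simp add: \<Gamma>_def Y_def \<gamma>(3))
  moreover have "\<Gamma> t1 = ((t1, q1), y1)"
    using \<gamma>(1) by (simp add: \<Gamma>_def Y_def \<gamma>(4) k_def action_def)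
  ultimately show ?thesis
    unfolding chron_future_def using \<gamma>(1) by blast
qed

text \<open>Along a future directed timelike curve the time increases with positive derivative, so
  the curve can be parametrised by time and projected to the manifold.\<close>

lemma chron_future_imp_conn:
  assumes "((t1, q1), y1) \<in> chron_future T A a b V ((t0, q0), y0)"
  shows "t1 \<in> T" "conn (t0, q0) (t1, q1) (y1 - y0)"
proof -
  obtain \<Gamma> s0 s1 where s: "s0 < s1" and fut: "future_timelike_curve T A a b V \<Gamma> {s0..s1}"
    and ends: "\<Gamma> s0 = ((t0, q0), y0)" "\<Gamma> s1 = ((t1, q1), y1)"
    using assms unfolding chron_future_def by blast
  let ?I = "{s0..s1}"
  define t where "t r = fst (fst (\<Gamma> r))" for r
  define q where "q r = snd (fst (\<Gamma> r))" for r
  define y where "y r = snd (\<Gamma> r)" for r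
  have sc: "spacetime_C1_curve T A \<Gamma> ?I" using fut by (simp add: future_timelike_curve_def)
  have tT: "t r \<in> T" if "r \<in> ?I" for r
  proof -
    have "\<Gamma> r \<in> spacetime T" using sc that by (auto simp: spacetime_C1_curve_def)
    then show ?thesis by (auto simp: spacetime_def t_def)
  qed
  have "C1_on t ?I" "C1_on y ?I" and q: "C1_curve A q ?I"
    using sc by (simp_all add: spacetime_C1_curve_def t_def[abs_def] q_def[abs_def] y_def[abs_def])
  then obtain D E where D: "\<forall>r\<in>?I. (t has_vector_derivative D r) (at r within ?I)" "continuous_on ?I D"
    and E: "\<forall>r\<in>?I. (y has_vector_derivative E r) (at r within ?I)"
    unfolding C1_on_def by blast
  have key: "D r > 0 \<and> D r * lagrangian a b V (t r) (q r) (\<lambda>c. (1 / D r) *\<^sub>R velocity A q ?I r c) < E r"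
    if r: "r \<in> ?I" for r
  proof -
    have nb: "at r within ?I \<noteq> bot" by (rule at_within_Icc_neq_bot[OF s r])
    have v: "spacetime_velocity A \<Gamma> ?I r = ((D r, velocity A q ?I r), E r)"
      using vector_derivative_within[OF nb bspec[OF D(1) r]] vector_derivative_within[OF nb bspec[OF E r]]
      by (simp add: spacetime_velocity_def t_def[abs_def] y_def[abs_def] q_def[abs_def])
    have \<Gamma>: "\<Gamma> r = ((t r, q r), y r)" by (simp add: t_def q_def y_def)
    have "gw_metric a b V (\<Gamma> r) (spacetime_velocity A \<Gamma> ?I r) (spacetime_velocity A \<Gamma> ?I r) < 0 \<and>
      gw_metric a b V (\<Gamma> r) (orientation_field V (\<Gamma> r)) (spacetime_velocity A \<Gamma> ?I r) < 0"
      using fut r by (simp add: future_timelike_curve_def Let_def)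
    then show ?thesis
      unfolding v \<Gamma> using future_timelike_iff[OF tT[OF r] velocity_tangent[OF s q r]] by blast
  qed
  have Dpos: "\<forall>r\<in>?I. D r > 0" using key by blast
  obtain \<sigma> where \<sigma>: "t s0 < t s1" "\<sigma> (t s0) = s0" "\<sigma> (t s1) = s1" "\<sigma> ` {t s0..t s1} \<subseteq> ?I"
    "\<And>u. u \<in> {t s0..t s1} \<Longrightarrow> t (\<sigma> u) = u"
    "\<And>u. u \<in> {t s0..t s1} \<Longrightarrow> (\<sigma> has_vector_derivative 1 / D (\<sigma> u)) (at u within {t s0..t s1})"
    "continuous_on {t s0..t s1} (\<lambda>u. 1 / D (\<sigma> u))"
    using increasing_C1_inverse[OF s D Dpos] by metis
  have t01: "t s0 = t0" "t s1 = t1" using ends by (simp_all add: t_def)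
  note \<sigma> = \<sigma>[unfolded t01]
  let ?J = "{t0..t1}"
  define \<gamma> where "\<gamma> = q \<circ> \<sigma>"
  have \<sigma>_in: "\<sigma> u \<in> ?I" if "u \<in> ?J" for u using \<sigma>(4) that by blast
  have \<gamma>: "C1_curve A \<gamma> ?J"
    unfolding \<gamma>_def by (rule C1_curve_reparam(1)[OF s \<sigma>(1) open_dom q \<sigma>(6,7,4)])
  have \<gamma>v: "velocity A \<gamma> ?J u = (\<lambda>c. (1 / D (\<sigma> u)) *\<^sub>R velocity A q ?I (\<sigma> u) c)" if "u \<in> ?J" for u
    unfolding \<gamma>_def by (rule C1_curve_reparam(2)[OF s \<sigma>(1) open_dom q \<sigma>(6,7,4) that])
  show "t1 \<in> T" using tT[of s1] s t01 by simp
  moreover have "t0 \<in> T" using tT[of s0] s t01 by simp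
  ultimately have T: "?J \<subseteq> T" by (intro Icc_subset_T)
  note lc = continuous_on_lag[OF \<sigma>(1) T \<gamma>]
  \<comment> \<open>The derivative of \<open>F\<close> is the excess of the rate of \<open>y\<close>
    over the Lagrangian, which is positive because the curve is timelike; so the gain in
    \<open>y\<close> exceeds the action.\<close>
  define F where "F u = (y \<circ> \<sigma>) u - integral {t0..u} (lag \<gamma> t0 t1)" for u
  have Fd: "(F has_vector_derivative (1 / D (\<sigma> u)) *\<^sub>R E (\<sigma> u) - lag \<gamma> t0 t1 u) (at u within ?J)"
    if u: "u \<in> ?J" for u
    unfolding F_def
    by (intro has_vector_derivative_diff integral_has_vector_derivative[OF lc u]
        vector_derivative_reparam[OF bspec[OF E \<sigma>_in[OF u]] \<sigma>(6)[OF u] \<sigma>(4)])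
  have "F t0 < F t1"
  proof (rule DERIV_pos_imp_increasing_open[OF \<sigma>(1)])
    show "continuous_on ?J F"
      using Fd by (meson continuous_on_eq_continuous_within has_vector_derivative_continuous)
    fix u assume "t0 < u" "u < t1"
    then have u: "u \<in> ?J" and int: "at u within ?J = at u"
      by (auto intro!: at_within_interior simp: interior_atLeastAtMost_real)
    have "lag \<gamma> t0 t1 u < (1 / D (\<sigma> u)) * E (\<sigma> u)"
      using key[OF \<sigma>_in[OF u]] \<gamma>v[OF u] \<sigma>(5)[OF u]
      by (simp add: lag_def \<gamma>_def pos_less_divide_eq mult.commute)
    then show "\<exists>z. DERIV F u :> z \<and> z > 0"
      using Fd[OF u] unfolding int has_real_derivative_iff_has_vector_derivative[symmetric] by auto
  qed
  then have "action \<gamma> t0 t1 < y1 - y0"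
    using \<sigma>(2,3) ends by (simp add: F_def action_def y_def)
  from connI[OF \<sigma>(1) \<gamma> this] show "conn (t0, q0) (t1, q1) (y1 - y0)"
    using \<sigma>(2,3) ends by (simp add: \<gamma>_def q_def)
qed

lemma chron_future_iff:
  assumes "fst e0 \<in> T"
  shows "(e1, y1) \<in> chron_future T A a b V (e0, y0) \<longleftrightarrow> fst e1 \<in> T \<and> conn e0 e1 (y1 - y0)"
  using conn_imp_chron_future[of "fst e0" "snd e0" "fst e1" "snd e1" y1 y0]
    chron_future_imp_conn[of "fst e1" "snd e1" y1 "fst e0" "snd e0" y0] assms
  by auto

text \<open>For distinct points that are not in temporal order the least action is infinite and
  \<open>conn\<close> fails.\<close>

lemma least_action_less_iff':
  assumes "e0 \<noteq> e1"
  shows "least_action A a b V e0 e1 < ereal y \<longleftrightarrow> conn e0 e1 y"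
proof (cases "fst e0 < fst e1")
  case False
  then have "least_action A a b V e0 e1 = \<infinity>"
    using assms by (simp add: least_action_def case_prod_beta prod_eq_iff)
  then show ?thesis using False by (simp add: conn_def)
qed (rule least_action_less_iff)

section \<open>Lower semicontinuity and equality of futures in terms of connections\<close>

lemma least_action_refl: "least_action A a b V e e = 0"
  by (simp add: least_action_def case_prod_beta)

lemma conn_irrefl: "\<not> conn e e y"
  by (simp add: conn_def)

lemma lsc_least_action_iff:
  "lsc_at_within (T \<times> UNIV) (\<lambda>e. least_action A a b V e1 e) e1 \<longleftrightarrow>
     (\<forall>k<0. \<exists>N. open N \<and> e1 \<in> N \<and> (\<forall>z\<in>N. z \<in> T \<times> UNIV \<longrightarrow> \<not> conn e1 z k))"
  by (rule lsc_at_within_zero_iff) (auto simp: least_action_refl least_action_less_iff' conn_irrefl)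

lemma lsc_least_action_iff':
  "lsc_at_within (T \<times> UNIV) (\<lambda>e. least_action A a b V e e1) e1 \<longleftrightarrow>
     (\<forall>k<0. \<exists>N. open N \<and> e1 \<in> N \<and> (\<forall>z\<in>N. z \<in> T \<times> UNIV \<longrightarrow> \<not> conn z e1 k))"
  by (rule lsc_at_within_zero_iff) (auto simp: least_action_refl least_action_less_iff' conn_irrefl)

lemma chron_future_eq_iff:
  assumes "fst e1 \<in> T" "fst e2 \<in> T"
  shows "chron_future T A a b V (e1, y1) = chron_future T A a b V (e2, y2) \<longleftrightarrow>
     (\<forall>e y. fst e \<in> T \<longrightarrow> (conn e1 e (y - y1) \<longleftrightarrow> conn e2 e (y - y2)))"
    (is "?F1 = ?F2 \<longleftrightarrow> ?R")
proof
  assume eq: "?F1 = ?F2"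
  show ?R
  proof (intro allI impI)
    fix e :: "real \<times> 'q" and y :: real assume "fst e \<in> T"
    moreover have "(e, y) \<in> ?F1 \<longleftrightarrow> (e, y) \<in> ?F2" by (simp only: eq)
    ultimately show "conn e1 e (y - y1) \<longleftrightarrow> conn e2 e (y - y2)"
      by (simp only: chron_future_iff[OF assms(1)] chron_future_iff[OF assms(2)] simp_thms)
  qed
next
  assume R: ?R
  show "?F1 = ?F2"
  proof (rule set_eqI)
    fix x :: "(real \<times> 'q) \<times> real"
    obtain e y where x: "x = (e, y)" by fastforce
    have "fst e \<in> T \<Longrightarrow> conn e1 e (y - y1) \<longleftrightarrow> conn e2 e (y - y2)" using R by blast
    then show "x \<in> ?F1 \<longleftrightarrow> x \<in> ?F2"
      unfolding x chron_future_iff[OF assms(1)] chron_future_iff[OF assms(2)] by (rule conj_cong[OF refl])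
  qed
qed

text \<open>By contraposition. A connection from \<open>e1\<close> persists from all nearby starting
  points by \<open>conn_open_left\<close>; one of these is reached from \<open>e1\<close> at a cost
  below \<open>k < 0\<close>. Hence every upper bound on the action from \<open>e1\<close> can be
  lowered by \<open>- k\<close>, and \<open>y1\<close> and \<open>y1 + k\<close> have the same
  future.\<close>

lemma lsc_if_future_distinguishing:
  assumes "fst e1 \<in> T" "future_distinguishing_at T A a b V (e1, y1)"
  shows "lsc_at_within (T \<times> UNIV) (\<lambda>e. least_action A a b V e1 e) e1"
proof (rule ccontr)
  assume "\<not> ?thesis"
  then obtain k where k: "k < 0"
    and no: "\<not> (\<exists>N. open N \<and> e1 \<in> N \<and> (\<forall>z\<in>N. z \<in> T \<times> UNIV \<longrightarrow> \<not> conn e1 z k))"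
    unfolding lsc_least_action_iff by (auto simp only: not_all not_imp)
  have freq: "\<exists>z\<in>N. conn e1 z k" if "open N" "e1 \<in> N" for N
  proof (rule ccontr)
    assume "\<not> (\<exists>z\<in>N. conn e1 z k)"
    then have "open N \<and> e1 \<in> N \<and> (\<forall>z\<in>N. z \<in> T \<times> UNIV \<longrightarrow> \<not> conn e1 z k)"
      using that by simp
    with no show False by (simp only: not_ex)
  qed
  have "conn e1 e (y - y1) \<longleftrightarrow> conn e1 e (y - (y1 + k))" if e: "fst e \<in> T" for e y
  proof
    assume "conn e1 e (y - y1)"
    then show "conn e1 e (y - (y1 + k))"
      by (rule conn_mono) (use k in simp)
  next
    assume "conn e1 e (y - (y1 + k))"
    then have "conn (fst e1, snd e1) e (y - (y1 + k))" by simp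
    from this assms(1) e obtain U where U: "open U" "(fst e1, snd e1) \<in> U" "\<And>e'. e' \<in> U \<Longrightarrow> conn e' e (y - (y1 + k))"
      by (rule conn_open_left) blast
    obtain z where z: "z \<in> U" "conn e1 z k"
      using freq[OF U(1)] U(2) by auto
    show "conn e1 e (y - y1)"
      using conn_trans[OF z(2) U(3)[OF z(1)] assms(1) e] by simp
  qed
  then have "chron_future T A a b V (e1, y1) = chron_future T A a b V (e1, y1 + k)"
    by (subst chron_future_eq_iff[OF assms(1) assms(1)]) blast
  moreover have "(e1, y1 + k) \<in> spacetime T"
    using assms(1) by (simp add: spacetime_def mem_Times_iff)
  ultimately have "(e1, y1 + k) = (e1, y1)"
    using assms(2) unfolding future_distinguishing_at_def by blast
  then show False using k by simp
qed

lemma future_distinguishing_if_lsc: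
  assumes T1: "fst e1 \<in> T" and lsc: "lsc_at_within (T \<times> UNIV) (\<lambda>e. least_action A a b V e1 e) e1"
  shows "future_distinguishing_at T A a b V (e1, y1)"
  unfolding future_distinguishing_at_def
proof (intro ballI impI)
  fix z assume z: "z \<in> spacetime T" and eq: "chron_future T A a b V (e1, y1) = chron_future T A a b V z"
  obtain t1 q1 where e1: "e1 = (t1, q1)" by fastforce
  obtain t2 q2 y2 where z': "z = ((t2, q2), y2)" by (metis surj_pair)
  have T: "t1 \<in> T" "t2 \<in> T" using T1 z by (auto simp: e1 z' spacetime_def)
  have T': "fst (t1, q1) \<in> T" "fst (t2, q2) \<in> T" using T by simp_all
  have eq: "conn (t1, q1) e (y - y1) \<longleftrightarrow> conn (t2, q2) e (y - y2)" if "fst e \<in> T" for e y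
    using iffD1[OF chron_future_eq_iff[OF T'] eq[unfolded e1 z']] that by blast
  have eq': "conn (t1, q1) e y \<longleftrightarrow> conn (t2, q2) e (y + (y1 - y2))" if "fst e \<in> T" for e y
    using eq[OF that, of "y + y1"] by (simp add: algebra_simps)
  obtain \<rho>1 where \<rho>1: "\<rho>1 > 0" "\<And>t. t1 < t \<Longrightarrow> t < t1 + \<rho>1 \<Longrightarrow> t \<in> T \<and> conn (t1, q1) (t, q1) 1"
    using conn_const[OF T(1), of 1 q1] by auto
  obtain \<rho>2 where \<rho>2: "\<rho>2 > 0" "\<And>t. t2 < t \<Longrightarrow> t < t2 + \<rho>2 \<Longrightarrow> t \<in> T \<and> conn (t2, q2) (t, q2) 1"
    using conn_const[OF T(2), of 1 q2] by auto
  have fst_less: "fst e < fst e'" if "conn e e' y" for e e' y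
    using that by (simp add: conn_def)
  \<comment> \<open>Points \<open>(t, q1)\<close> with \<open>t\<close> just after \<open>t1\<close>
    lie in the common future, and connections go strictly forward in time, so \<open>t2\<close> is
    below all these \<open>t\<close>. The other inequality is symmetric.\<close>
  have "t2 \<le> t1"
  proof (rule dense_ge_bounded)
    show "t1 < t1 + \<rho>1" using \<rho>1 by simp
    show "t2 \<le> t" if "t1 < t" "t < t1 + \<rho>1" for t
      using \<rho>1(2)[OF that] eq'[of "(t, q1)" 1] fst_less by fastforce
  qed
  moreover have "t1 \<le> t2"
  proof (rule dense_ge_bounded)
    show "t2 < t2 + \<rho>2" using \<rho>2 by simp
    show "t1 \<le> t" if "t2 < t" "t < t2 + \<rho>2" for t
      using \<rho>2(2)[OF that] eq'[of "(t, q2)" "1 - (y1 - y2)"] fst_less by fastforce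
  qed
  ultimately have t12: "t2 = t1" by simp
  have lsc': "\<exists>N. open N \<and> (t1, q1) \<in> N \<and> (\<forall>z\<in>N. z \<in> T \<times> UNIV \<longrightarrow> \<not> conn (t1, q1) z k)"
    if "k < 0" for k
    using lsc that unfolding lsc_least_action_iff by (simp add: e1)
  have lsc_const: "\<exists>t. t1 < t \<and> t < t1 + \<rho>1 \<and> \<not> conn (t1, q1) (t, q1) k" if k: "k < 0" for k
  proof -
    obtain N where N: "open N" "(t1, q1) \<in> N" "\<forall>z\<in>N. z \<in> T \<times> UNIV \<longrightarrow> \<not> conn (t1, q1) z k"
      using lsc'[OF k] by blast
    obtain N1 N2 where N': "open N1" "t1 \<in> N1" "q1 \<in> N2" "N1 \<times> N2 \<subseteq> N"
      using N(1,2) by (metis open_prod_elim mem_Times_iff fst_conv snd_conv)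
    obtain d where d: "d > 0" "ball t1 d \<subseteq> N1"
      using N'(1,2) open_contains_ball by blast
    obtain t where t: "t1 < t" "t < t1 + min d \<rho>1"
      using dense[of t1 "t1 + min d \<rho>1"] d(1) \<rho>1(1) by auto
    then have "t \<in> ball t1 d" by (simp add: dist_real_def)
    then have "(t, q1) \<in> N" using d(2) N' by blast
    then show ?thesis using N(3) \<rho>1(2)[of t] t by auto
  qed
  have q12: "q2 = q1"
  proof (rule ccontr)
    assume ne: "q2 \<noteq> q1"
    obtain N where N: "open N" "(t1, q1) \<in> N" "\<forall>z\<in>N. z \<in> T \<times> UNIV \<longrightarrow> \<not> conn (t1, q1) z (- 1)"
      using lsc'[of "- 1"] by auto
    \<comment> \<open>The way out and the way back will cost less than \<open>1 - (y1 - y2)\<close>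
      and \<open>1 + (y1 - y2)\<close>, together less than 2. Cutting off a last part worth 3 leaves
      -1, against the choice of \<open>N\<close>.\<close>
    obtain \<tau> where \<tau>: "\<tau> > 0"
      "\<And>t' t y. t1 \<le> t' \<Longrightarrow> t < t1 + \<tau> \<Longrightarrow> conn (t', q2) (t, q1) y \<Longrightarrow>
       \<exists>s p. t' < s \<and> s < t \<and> (s, p) \<in> N \<and> conn (t', q2) (s, p) (y - 3)"
      using conn_crossing[OF T(1) ne N(1,2), of 3] by metis
    obtain t where t: "t1 < t" "t < t1 + min \<tau> \<rho>1"
      using dense[of t1 "t1 + min \<tau> \<rho>1"] \<tau>(1) \<rho>1(1) by auto
    then have tT: "t \<in> T" and "conn (t1, q1) (t, q1) 1" using \<rho>1(2)[of t] by auto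
    then have "conn (t1, q2) (t, q1) (1 + (y1 - y2))"
      using eq'[of "(t, q1)" 1] by (simp add: t12)
    \<comment> \<open>The way back must start after the way out has ended; openness of
      \<open>conn\<close> in its first argument moves its start from time \<open>t1\<close> to a
      slightly later \<open>t'\<close> at the same bound.\<close>
    from this T(1) obtain U where U: "open U" "(t1, q2) \<in> U" "\<And>e'. e' \<in> U \<Longrightarrow> conn e' (t, q1) (1 + (y1 - y2))"
      by (rule conn_open_left) (use tT in auto)
    obtain U1 U2 where U': "open U1" "t1 \<in> U1" "q2 \<in> U2" "U1 \<times> U2 \<subseteq> U"
      using U(1,2) by (metis open_prod_elim mem_Times_iff fst_conv snd_conv)
    obtain d where d: "d > 0" "ball t1 d \<subseteq> U1"
      using U'(1,2) open_contains_ball by blast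
    obtain t' where t': "t1 < t'" "t' < t1 + min d \<rho>2"
      using dense[of t1 "t1 + min d \<rho>2"] d(1) \<rho>2(1) by auto
    then have "t' \<in> ball t1 d" by (simp add: dist_real_def)
    then have "(t', q2) \<in> U" using d(2) U' by blast
    then have ret: "conn (t', q2) (t, q1) (1 + (y1 - y2))" by (rule U(3))
    have t'T: "t' \<in> T" and "conn (t1, q2) (t', q2) 1"
      using \<rho>2(2)[of t'] t' by (auto simp: t12)
    then have out: "conn (t1, q1) (t', q2) (1 - (y1 - y2))"
      using eq'[of "(t', q2)" "1 - (y1 - y2)"] by (simp add: t12)
    have "t < t1 + \<tau>" using t(2) min.cobounded1[of \<tau> \<rho>1] by linarith
    then obtain s p where sp: "t' < s" "s < t" "(s, p) \<in> N" "conn (t', q2) (s, p) (1 + (y1 - y2) - 3)"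
      using \<tau>(2)[OF less_imp_le[OF t'(1)] _ ret] by blast
    have sT: "s \<in> T" using Icc_subset_T[OF T(1) tT] sp t' by auto
    have "conn (t1, q1) (s, p) (- 1)"
      using conn_trans[OF out sp(4)] T(1) sT by simp
    then show False using N(3) sp(3) sT by auto
  qed
  have y12: "y2 = y1"
  proof (rule ccontr)
    assume "y2 \<noteq> y1"
    define d where "d = \<bar>y1 - y2\<bar>"
    have d: "d > 0" using \<open>y2 \<noteq> y1\<close> by (simp add: d_def)
    \<comment> \<open>Now both futures belong to the same \<open>e1\<close>, so bounds may be
      shifted by \<open>y1 - y2\<close> in either direction; the case distinction picks the one that
      lowers them.\<close>
    have step: "conn (t1, q1) e (y - d)" if "conn (t1, q1) e y" "fst e \<in> T" for e y
    proof (cases "y1 \<le> y2")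
      case True
      then show ?thesis using that eq'[of e y] by (simp add: t12 q12 d_def algebra_simps)
    next
      case False
      then show ?thesis using that eq'[of e "y - (y1 - y2)"] by (simp add: t12 q12 d_def)
    qed
    \<comment> \<open>\<open>n\<close> steps of size \<open>d\<close> bring the bound 1 for resting
      at \<open>q1\<close> below -1.\<close>
    obtain n where n: "real n * d > 2" using reals_Archimedean3[OF d] by blast
    have "conn (t1, q1) (t, q1) (- 1)" if t: "t1 < t" "t < t1 + \<rho>1" for t
    proof -
      have "conn (t1, q1) (t, q1) (1 - real m * d)" for m
      proof (induction m)
        case 0
        then show ?case using \<rho>1(2)[OF t] by simp
      next
        case (Suc m)
        from step[OF Suc] \<rho>1(2)[OF t] show ?case by (simp add: algebra_simps)
      qed
      from conn_mono[OF this[of n]] n show ?thesis by simp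
    qed
    then show False using lsc_const[of "- 1"] by auto
  qed
  show "z = (e1, y1)" by (simp add: z' e1 t12 q12 y12)
qed

lemma future_distinguishing_iff:
  assumes "fst e1 \<in> T"
  shows "future_distinguishing_at T A a b V (e1, y1) \<longleftrightarrow>
    lsc_at_within (T \<times> UNIV) (\<lambda>e. least_action A a b V e1 e) e1"
  using lsc_if_future_distinguishing[OF assms] future_distinguishing_if_lsc[OF assms] by blast

end

section \<open>Time reversal\<close>

text \<open>Time reversal \<open>((t, q), y) \<mapsto> ((-t, q), -y)\<close> is an isometry onto the spacetime of the fields
  \<open>a (-t)\<close>, \<open>- b (-t)\<close>, \<open>V (-t)\<close> that exchanges the time orientations.\<close>

definition treverse :: "real \<times> 'q \<Rightarrow> real \<times> 'q" where
  "treverse e = (- fst e, snd e)"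

definition preverse :: "'q point \<Rightarrow> 'q point" where
  "preverse x = (treverse (fst x), - snd x)"

lemma treverse_treverse [simp]: "treverse (treverse e) = e"
  by (simp add: treverse_def)

lemma preverse_preverse [simp]: "preverse (preverse x) = x"
  by (simp add: preverse_def)

lemma continuous_on_treverse: "continuous_on UNIV treverse"
  unfolding treverse_def[abs_def] by (intro continuous_intros)

lemma C1_on_uminus: "C1_on f J \<Longrightarrow> C1_on (\<lambda>s. - f s) J"
  unfolding C1_on_def
proof (elim exE conjE)
  fix D assume "\<forall>s\<in>J. (f has_vector_derivative D s) (at s within J)" "continuous_on J D"
  then show "\<exists>D. (\<forall>s\<in>J. ((\<lambda>s. - f s) has_vector_derivative D s) (at s within J)) \<and> continuous_on J D"
    by (intro exI[of _ "\<lambda>s. - D s"] conjI ballI has_vector_derivative_minus continuous_on_minus) auto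
qed

lemma continuous_on_time_reflect:
  fixes f :: "real \<times> 'a::topological_space \<Rightarrow> 'b::topological_space"
  assumes "continuous_on (T \<times> S) f"
  shows "continuous_on (uminus ` T \<times> S) (\<lambda>(t, x). f (- t, x))"
proof -
  have "continuous_on (uminus ` T \<times> S) (\<lambda>p. f (- fst p, snd p))"
    by (rule continuous_on_compose2[OF assms]) (auto intro!: continuous_intros)
  then show ?thesis by (simp add: case_prod_beta)
qed

section \<open>Reversal of fields, connections and spacetime curves\<close>

context gw_fields begin

abbreviation "rev_T \<equiv> uminus ` T"
abbreviation "rev_a \<equiv> \<lambda>t. a (- t)"
abbreviation "rev_b \<equiv> \<lambda>t q \<xi>. - b (- t) q \<xi>"
abbreviation "rev_V \<equiv> \<lambda>t. V (- t)"

lemma gw_fields_reverse: "gw_fields A B rev_T rev_a rev_b rev_V"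
proof unfold_locales
  show "open rev_T" using open_T by (rule open_negations)
  show "connected rev_T" using connected_T by (intro connected_continuous_image continuous_intros)
  fix c u w assume c: "c \<in> A"
  show "continuous_on (rev_T \<times> snd c ` fst c)
      (\<lambda>(t, x). a (- t) (chart_inv c x) (coord_vec A c (chart_inv c x) u) (coord_vec A c (chart_inv c x) w))"
    using continuous_on_time_reflect[OF a_cont[OF c, of u w]] by simp
  show "continuous_on (rev_T \<times> snd c ` fst c) (\<lambda>(t, x). - b (- t) (chart_inv c x) (coord_vec A c (chart_inv c x) u))"
    using continuous_on_minus[OF continuous_on_time_reflect[OF b_cont[OF c, of u]]] by (simp add: case_prod_beta)
  show "continuous_on (rev_T \<times> snd c ` fst c) (\<lambda>(t, x). V (- t) (chart_inv c x))"
    using continuous_on_time_reflect[OF V_cont[OF c]] by simp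
next
  fix t q \<xi> \<eta> assume t: "t \<in> rev_T" and \<xi>: "\<xi> \<in> tangent_space A q"
  have t': "- t \<in> T" using t by auto
  show "a (- t) q \<xi> \<xi> > 0" if "\<xi> \<noteq> (\<lambda>_. 0)" using a_pos[OF t' \<xi> that] .
  assume \<eta>: "\<eta> \<in> tangent_space A q"
  show "a (- t) q \<xi> \<eta> = a (- t) q \<eta> \<xi>" using a_sym[OF t' \<xi> \<eta>] .
  fix m n
  show "- b (- t) q (\<lambda>c. m *\<^sub>R \<xi> c + n *\<^sub>R \<eta> c) = m * - b (- t) q \<xi> + n * - b (- t) q \<eta>"
    using b_lin[OF t' \<xi> \<eta>, of m n] by simp
  fix \<zeta> assume \<zeta>: "\<zeta> \<in> tangent_space A q"
  show "a (- t) q (\<lambda>c. m *\<^sub>R \<xi> c + n *\<^sub>R \<eta> c) \<zeta> = m * a (- t) q \<xi> \<zeta> + n * a (- t) q \<eta> \<zeta>"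
    using a_lin[OF t' \<xi> \<eta> \<zeta>, of m n] .
qed

text \<open>Running a curve backwards changes the sign of its velocity. The quadratic term is
  unaffected and the sign of the linear term is compensated by \<open>rev_b\<close>, so the
  Lagrangian at \<open>t\<close> equals the original one at \<open>- t\<close> and the integrals
  agree by reflection.\<close>

lemma conn_imp_conn_reverse:
  assumes "conn e0 e1 y" "fst e0 \<in> T" "fst e1 \<in> T"
  shows "gw_fields.conn A rev_a rev_b rev_V (treverse e1) (treverse e0) y"
proof -
  interpret rev: gw_fields A B rev_T rev_a rev_b rev_V by (rule gw_fields_reverse)
  obtain t0 q0 t1 q1 where e: "e0 = (t0, q0)" "e1 = (t1, q1)" by fastforce
  obtain \<gamma> where \<gamma>: "t0 < t1" "C1_curve A \<gamma> {t0..t1}" "\<gamma> t0 = q0" "\<gamma> t1 = q1" "action \<gamma> t0 t1 < y"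
    using assms(1) unfolding e by (rule connE)
  have T: "{t0..t1} \<subseteq> T" using assms by (intro Icc_subset_T) (auto simp: e)
  define \<gamma>' where "\<gamma>' = \<gamma> \<circ> uminus"
  have lt: "- t1 < - t0" using \<gamma>(1) by simp
  have u1: "(uminus has_vector_derivative - 1) (at t within {- t1..- t0})" for t :: real
    by (auto intro!: derivative_eq_intros simp: has_real_derivative_iff_has_vector_derivative[symmetric])
  have u2: "uminus ` {- t1..- t0} \<subseteq> {t0..t1}" by auto
  note R = C1_curve_reparam[OF \<gamma>(1) lt open_dom \<gamma>(2) u1 continuous_on_const u2, folded \<gamma>'_def]
  have "rev.lag \<gamma>' (- t1) (- t0) t = lag \<gamma> t0 t1 (- t)" if t: "t \<in> {- t1..- t0}" for t
  proof -
    have t': "- t \<in> {t0..t1}" using t by auto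
    have tT: "- t \<in> T" using t' T by blast
    let ?\<xi> = "velocity A \<gamma> {t0..t1} (- t)"
    have \<xi>: "?\<xi> \<in> tangent_space A (\<gamma> (- t))" by (rule velocity_tangent[OF \<gamma>(1,2) t'])
    have \<xi>': "(\<lambda>c. (- 1) *\<^sub>R ?\<xi> c) \<in> tangent_space A (\<gamma> (- t))" by (rule tangent_scale[OF \<xi>])
    have a1: "a (- t) (\<gamma> (- t)) (\<lambda>c. (- 1) *\<^sub>R ?\<xi> c) \<zeta> = - a (- t) (\<gamma> (- t)) ?\<xi> \<zeta>"
      if "\<zeta> \<in> tangent_space A (\<gamma> (- t))" for \<zeta>
      using a_lin[OF tT \<xi> \<xi> that, of "- 1" 0] by simp
    have "a (- t) (\<gamma> (- t)) (\<lambda>c. (- 1) *\<^sub>R ?\<xi> c) (\<lambda>c. (- 1) *\<^sub>R ?\<xi> c) = a (- t) (\<gamma> (- t)) ?\<xi> ?\<xi>"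
      using a1[OF \<xi>'] a_sym[OF tT \<xi> \<xi>'] a1[OF \<xi>] by simp
    moreover have "b (- t) (\<gamma> (- t)) (\<lambda>c. (- 1) *\<^sub>R ?\<xi> c) = - b (- t) (\<gamma> (- t)) ?\<xi>"
      using b_lin[OF tT \<xi> \<xi>, of "- 1" 0] by simp
    ultimately show ?thesis
      unfolding rev.lag_def lag_def R(2)[OF t] by (simp add: \<gamma>'_def lagrangian_def)
  qed
  then have "rev.action \<gamma>' (- t1) (- t0) = integral {- t1..- t0} (\<lambda>t. lag \<gamma> t0 t1 (- t))"
    unfolding rev.action_def by (intro integral_cong)
  also have "\<dots> = action \<gamma> t0 t1"
    by (simp add: action_def integral_reflect_real)
  finally have "rev.action \<gamma>' (- t1) (- t0) < y" using \<gamma>(5) by simp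
  from rev.connI[OF lt R(1) this] show ?thesis
    by (simp add: e treverse_def \<gamma>'_def \<gamma>)
qed

lemma conn_reverse_iff:
  assumes "fst e0 \<in> T" "fst e1 \<in> T"
  shows "gw_fields.conn A rev_a rev_b rev_V (treverse e1) (treverse e0) y \<longleftrightarrow> conn e0 e1 y"
proof
  assume "conn e0 e1 y"
  then show "gw_fields.conn A rev_a rev_b rev_V (treverse e1) (treverse e0) y"
    using assms by (rule conn_imp_conn_reverse)
next
  interpret rev: gw_fields A B rev_T rev_a rev_b rev_V by (rule gw_fields_reverse)
  assume "gw_fields.conn A rev_a rev_b rev_V (treverse e1) (treverse e0) y"
  \<comment> \<open>The first implication is applied to the reversed fields; reversing twice
    restores fields and points.\<close>
  then have "gw_fields.conn A (\<lambda>t. a (- (- t))) (\<lambda>t q \<xi>. - (- b (- (- t)) q \<xi>)) (\<lambda>t. V (- (- t)))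
      (treverse (treverse e0)) (treverse (treverse e1)) y"
    by (rule rev.conn_imp_conn_reverse) (use assms in \<open>auto simp: treverse_def\<close>)
  then show "conn e0 e1 y" by simp
qed

text \<open>In terms of \<open>conn\<close> both sides are statements about neighbourhoods.
  \<open>treverse\<close> is a continuous involution, and \<open>conn_reverse_iff\<close> turns the
  first argument of the least action into the second.\<close>

lemma lsc_reverse:
  assumes "fst e1 \<in> T"
  shows "lsc_at_within (T \<times> UNIV) (\<lambda>e. least_action A a b V e e1) e1 \<longleftrightarrow>
    lsc_at_within (rev_T \<times> UNIV) (\<lambda>e. least_action A rev_a rev_b rev_V (treverse e1) e) (treverse e1)"
proof -
  interpret rev: gw_fields A B rev_T rev_a rev_b rev_V by (rule gw_fields_reverse)
  have open_rev: "open (treverse -` N)" if "open N" for N :: "(real \<times> 'q) set"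
    using open_vimage[OF that continuous_on_treverse] .
  have "(\<exists>N. open N \<and> e1 \<in> N \<and> (\<forall>z\<in>N. z \<in> T \<times> UNIV \<longrightarrow> \<not> conn z e1 k)) \<longleftrightarrow>
     (\<exists>N. open N \<and> treverse e1 \<in> N \<and> (\<forall>z\<in>N. z \<in> rev_T \<times> UNIV \<longrightarrow> \<not> rev.conn (treverse e1) z k))" for k
  proof
    assume "\<exists>N. open N \<and> e1 \<in> N \<and> (\<forall>z\<in>N. z \<in> T \<times> UNIV \<longrightarrow> \<not> conn z e1 k)"
    then obtain N where N: "open N" "e1 \<in> N" "\<And>z. z \<in> N \<Longrightarrow> z \<in> T \<times> UNIV \<Longrightarrow> \<not> conn z e1 k" by blast
    have "\<not> rev.conn (treverse e1) z k" if z: "z \<in> treverse -` N" "z \<in> rev_T \<times> UNIV" for z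
    proof -
      have z': "treverse z \<in> T \<times> UNIV" using z(2) by (auto simp: treverse_def)
      then show ?thesis
        using N(3)[OF _ z'] z(1) conn_reverse_iff[of "treverse z" e1 k] assms by auto
    qed
    then show "\<exists>N. open N \<and> treverse e1 \<in> N \<and> (\<forall>z\<in>N. z \<in> rev_T \<times> UNIV \<longrightarrow> \<not> rev.conn (treverse e1) z k)"
      using open_rev[OF N(1)] N(2) by (intro exI[of _ "treverse -` N"]) simp
  next
    assume "\<exists>N. open N \<and> treverse e1 \<in> N \<and> (\<forall>z\<in>N. z \<in> rev_T \<times> UNIV \<longrightarrow> \<not> rev.conn (treverse e1) z k)"
    then obtain N where N: "open N" "treverse e1 \<in> N"
      "\<And>z. z \<in> N \<Longrightarrow> z \<in> rev_T \<times> UNIV \<Longrightarrow> \<not> rev.conn (treverse e1) z k" by blast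
    have "\<not> conn z e1 k" if z: "z \<in> treverse -` N" "z \<in> T \<times> UNIV" for z
    proof -
      have z': "treverse z \<in> rev_T \<times> UNIV" using z(2) by (auto simp: treverse_def)
      then show ?thesis
        using N(3)[OF _ z'] z conn_reverse_iff[of z e1 k] assms by auto
    qed
    then show "\<exists>N. open N \<and> e1 \<in> N \<and> (\<forall>z\<in>N. z \<in> T \<times> UNIV \<longrightarrow> \<not> conn z e1 k)"
      using open_rev[OF N(1)] N(2) by (intro exI[of _ "treverse -` N"]) simp
  qed
  then show ?thesis
    unfolding lsc_least_action_iff' rev.lsc_least_action_iff by simp
qed

text \<open>The curve parameter is kept and only the \<open>t\<close> and \<open>y\<close>
  components change sign. The component \<open>\<xi>\<close> of the velocity is therefore unchanged,
  and the curve still starts at the image of its starting point.\<close>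

lemma spacetime_C1_curve_reverse:
  assumes s: "s0 < s1" and sc: "spacetime_C1_curve T A \<Gamma> {s0..s1}"
  shows "spacetime_C1_curve rev_T A (preverse \<circ> \<Gamma>) {s0..s1}"
    and "\<And>r. r \<in> {s0..s1} \<Longrightarrow> spacetime_velocity A (preverse \<circ> \<Gamma>) {s0..s1} r =
      (case spacetime_velocity A \<Gamma> {s0..s1} r of ((\<tau>, \<xi>), \<eta>) \<Rightarrow> ((- \<tau>, \<xi>), - \<eta>))"
proof -
  let ?I = "{s0..s1}"
  have c1: "C1_on (\<lambda>s. fst (fst (\<Gamma> s))) ?I" "C1_on (\<lambda>s. snd (\<Gamma> s)) ?I"
    and T: "\<Gamma> ` ?I \<subseteq> spacetime T"
    using sc by (simp_all add: spacetime_C1_curve_def)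
  have proj: "(\<lambda>s. fst (fst ((preverse \<circ> \<Gamma>) s))) = (\<lambda>s. - fst (fst (\<Gamma> s)))"
    "(\<lambda>s. snd (fst ((preverse \<circ> \<Gamma>) s))) = (\<lambda>s. snd (fst (\<Gamma> s)))"
    "(\<lambda>s. snd ((preverse \<circ> \<Gamma>) s)) = (\<lambda>s. - snd (\<Gamma> s))"
    by (simp_all add: preverse_def treverse_def)
  have "(preverse \<circ> \<Gamma>) ` ?I \<subseteq> spacetime rev_T"
  proof
    fix p assume "p \<in> (preverse \<circ> \<Gamma>) ` ?I"
    then obtain s where s: "s \<in> ?I" "p = preverse (\<Gamma> s)" by auto
    then have "\<Gamma> s \<in> spacetime T" using T by blast
    then show "p \<in> spacetime rev_T"
      by (auto simp: s(2) spacetime_def preverse_def treverse_def)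
  qed
  then show "spacetime_C1_curve rev_T A (preverse \<circ> \<Gamma>) ?I"
    using sc C1_on_uminus[OF c1(1)] C1_on_uminus[OF c1(2)]
    unfolding spacetime_C1_curve_def proj by simp
  fix r assume r: "r \<in> ?I"
  have neg: "vector_derivative (\<lambda>s. - f s) (at r within ?I) = - vector_derivative f (at r within ?I)"
    if f: "C1_on f ?I" for f :: "real \<Rightarrow> real"
  proof -
    obtain D where D: "(f has_vector_derivative D r) (at r within ?I)"
      using f r unfolding C1_on_def by blast
    have nb: "at r within ?I \<noteq> bot" by (rule at_within_Icc_neq_bot[OF s r])
    show ?thesis
      using vector_derivative_within[OF nb has_vector_derivative_minus[OF D]] vector_derivative_within[OF nb D] by simp
  qed
  show "spacetime_velocity A (preverse \<circ> \<Gamma>) ?I r =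
      (case spacetime_velocity A \<Gamma> ?I r of ((\<tau>, \<xi>), \<eta>) \<Rightarrow> ((- \<tau>, \<xi>), - \<eta>))"
    unfolding spacetime_velocity_def proj neg[OF c1(1)] neg[OF c1(2)] by simp
qed

text \<open>Under the reversal the square of the velocity is preserved, while its product with the
  orientation field changes sign.\<close>

lemma timelike_curve_reverse:
  assumes s: "s0 < s1" and sc: "spacetime_C1_curve T A \<Gamma> {s0..s1}"
  shows "future_timelike_curve rev_T A rev_a rev_b rev_V (preverse \<circ> \<Gamma>) {s0..s1} \<longleftrightarrow>
    past_timelike_curve T A a b V \<Gamma> {s0..s1}"
proof -
  let ?I = "{s0..s1}"
  have "(let X = spacetime_velocity A (preverse \<circ> \<Gamma>) ?I r in
      gw_metric rev_a rev_b rev_V ((preverse \<circ> \<Gamma>) r) X X < 0 \<and>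
      gw_metric rev_a rev_b rev_V ((preverse \<circ> \<Gamma>) r) (orientation_field rev_V ((preverse \<circ> \<Gamma>) r)) X < 0) \<longleftrightarrow>
    (let X = spacetime_velocity A \<Gamma> ?I r in
      gw_metric a b V (\<Gamma> r) X X < 0 \<and> gw_metric a b V (\<Gamma> r) (orientation_field V (\<Gamma> r)) X > 0)"
    if r: "r \<in> ?I" for r
  proof -
    obtain t q y where \<Gamma>: "\<Gamma> r = ((t, q), y)" by (metis surj_pair)
    obtain \<tau> \<xi> \<eta> where X: "spacetime_velocity A \<Gamma> ?I r = ((\<tau>, \<xi>), \<eta>)" by (metis surj_pair)
    have "\<Gamma> r \<in> spacetime T" using sc r by (auto simp: spacetime_C1_curve_def)
    then have t: "t \<in> T" by (simp add: \<Gamma> spacetime_def)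
    have "C1_curve A (\<lambda>s. snd (fst (\<Gamma> s))) ?I" using sc by (simp add: spacetime_C1_curve_def)
    from velocity_tangent[OF s this r] have \<xi>: "\<xi> \<in> tangent_space A q"
      using X by (simp add: spacetime_velocity_def \<Gamma>)
    have a0: "a t q (\<lambda>_. 0) \<xi> = 0" and b0: "b t q (\<lambda>_. 0) = 0"
      using a_lin[OF t \<xi> \<xi> \<xi>, of 0 0] b_lin[OF t \<xi> \<xi>, of 0 0] by simp_all
    show ?thesis
      unfolding Let_def spacetime_C1_curve_reverse(2)[OF s sc r] X comp_apply \<Gamma>
      by (simp add: preverse_def treverse_def gw_metric_def orientation_field_def a0 b0 algebra_simps)
  qed
  then show ?thesis
    using sc spacetime_C1_curve_reverse(1)[OF s sc]
    by (simp add: future_timelike_curve_def past_timelike_curve_def)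
qed

lemma chron_past_reverse:
  "z \<in> chron_past T A a b V x \<longleftrightarrow> preverse z \<in> chron_future rev_T A rev_a rev_b rev_V (preverse x)"
proof
  assume "z \<in> chron_past T A a b V x"
  then obtain \<Gamma> s0 s1 where \<Gamma>: "s0 < s1" "past_timelike_curve T A a b V \<Gamma> {s0..s1}" "\<Gamma> s0 = x" "\<Gamma> s1 = z"
    unfolding chron_past_def by blast
  then have "future_timelike_curve rev_T A rev_a rev_b rev_V (preverse \<circ> \<Gamma>) {s0..s1}"
    using timelike_curve_reverse[OF \<Gamma>(1)] by (simp add: past_timelike_curve_def)
  then show "preverse z \<in> chron_future rev_T A rev_a rev_b rev_V (preverse x)"
    unfolding chron_future_def using \<Gamma>
    by (intro CollectI exI[of _ "preverse \<circ> \<Gamma>"] exI[of _ s0] exI[of _ s1]) simp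
next
  interpret rev: gw_fields A B rev_T rev_a rev_b rev_V by (rule gw_fields_reverse)
  \<comment> \<open>This identifies the doubly reversed time interval when the result for curves is
    used for the reversed fields.\<close>
  have TT: "uminus ` uminus ` T = T" by (simp add: image_image)
  assume "preverse z \<in> chron_future rev_T A rev_a rev_b rev_V (preverse x)"
  then obtain \<Gamma> s0 s1 where \<Gamma>: "s0 < s1" "future_timelike_curve rev_T A rev_a rev_b rev_V \<Gamma> {s0..s1}"
    "\<Gamma> s0 = preverse x" "\<Gamma> s1 = preverse z"
    unfolding chron_future_def by blast
  have inv: "preverse \<circ> (preverse \<circ> \<Gamma>) = \<Gamma>" by (simp add: fun_eq_iff)
  have "spacetime_C1_curve T A (preverse \<circ> \<Gamma>) {s0..s1}"
    using rev.spacetime_C1_curve_reverse(1)[OF \<Gamma>(1)] \<Gamma>(2) by (simp add: future_timelike_curve_def TT)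
  from timelike_curve_reverse[OF \<Gamma>(1) this]
  have "past_timelike_curve T A a b V (preverse \<circ> \<Gamma>) {s0..s1}"
    using \<Gamma>(2) by (simp add: inv)
  then show "z \<in> chron_past T A a b V x"
    unfolding chron_past_def using \<Gamma>
    by (intro CollectI exI[of _ "preverse \<circ> \<Gamma>"] exI[of _ s0] exI[of _ s1]) simp
qed

lemma past_distinguishing_reverse:
  "past_distinguishing_at T A a b V x \<longleftrightarrow>
     future_distinguishing_at rev_T A rev_a rev_b rev_V (preverse x)"
proof -
  have past: "chron_past T A a b V x = preverse -` chron_future rev_T A rev_a rev_b rev_V (preverse x)" for x
    by (rule set_eqI) (simp only: vimage_eq chron_past_reverse)
  have inv: "preverse -` (preverse -` S) = S" for S :: "'q point set"
    by (simp add: vimage_def)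
  have eq: "chron_past T A a b V x = chron_past T A a b V z \<longleftrightarrow>
      chron_future rev_T A rev_a rev_b rev_V (preverse x) = chron_future rev_T A rev_a rev_b rev_V (preverse z)" for z
    unfolding past by (metis inv)
  have st: "z \<in> spacetime T \<longleftrightarrow> preverse z \<in> spacetime rev_T" for z
    by (cases z) (auto simp: spacetime_def preverse_def treverse_def)
  have inj: "preverse z = preverse x \<longleftrightarrow> z = x" for z
    by (metis preverse_preverse)
  show ?thesis
    unfolding past_distinguishing_at_def future_distinguishing_at_def Ball_def eq
    by (metis st inj preverse_preverse)
qed

lemma past_distinguishing_iff:
  assumes "fst e1 \<in> T"
  shows "past_distinguishing_at T A a b V (e1, y1) \<longleftrightarrow>
    lsc_at_within (T \<times> UNIV) (\<lambda>e. least_action A a b V e e1) e1"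
proof -
  interpret rev: gw_fields A B rev_T rev_a rev_b rev_V by (rule gw_fields_reverse)
  have "fst (treverse e1) \<in> rev_T" using assms by (simp add: treverse_def)
  from rev.future_distinguishing_iff[OF this, of "- y1"] show ?thesis
    unfolding past_distinguishing_reverse lsc_reverse[OF assms] by (simp add: preverse_def)
qed

end

section \<open>From the smoothness hypotheses to the theorem\<close>

lemma gw_fields_if_Ck:
  fixes A :: "('q::t2_space, 'v::real_inner) chart set"
  assumes "manifold (r + 1) d A" "open T" "connected T"
    and a: "Ck_riemannian_metric r T A a" and b: "Ck_one_form r T A b" and V: "Ck_function r T A V"
  obtains B :: "'v set" where "gw_fields A B T a b V"
proof -
  obtain B :: "'v set" where B: "finite B" "\<And>u. u \<in> B \<Longrightarrow> norm u = 1" "\<And>v. (\<Sum>u\<in>B. (v \<bullet> u) *\<^sub>R u) = v"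
    using assms(1) euclidean_model_expansion unfolding manifold_def by metis
  have atlas: "Ck_atlas (Suc r) A" using assms(1) by (simp add: manifold_def)
  have trans: "Ck_on (Suc r) (snd c' \<circ> chart_inv c) (snd c ` (fst c \<inter> fst c'))" if "c \<in> A" "c' \<in> A" for c c'
    using atlas that unfolding Ck_atlas_def by blast
  have "gw_fields A B T a b V"
  proof unfold_locales
    show "finite B" by (rule B(1))
    show "norm u = 1" if "u \<in> B" for u using that by (rule B(2))
    show "(\<Sum>u\<in>B. (v \<bullet> u) *\<^sub>R u) = v" for v by (rule B(3))
    show "open T" "connected T" by (rule assms)+
    show "\<exists>c\<in>A. q \<in> fst c" for q
      using atlas unfolding Ck_atlas_def by blast
    show "\<forall>c\<in>A. open (fst c)"
      using atlas unfolding Ck_atlas_def by blast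
    show "open (snd c ` fst c)" "homeomorphism (fst c) (snd c ` fst c) (snd c) (chart_inv c)" if "c \<in> A" for c
      using atlas that unfolding Ck_atlas_def by blast+
    show "(snd c' \<circ> chart_inv c) differentiable (at x)"
      if "c \<in> A" "c' \<in> A" "x \<in> snd c ` (fst c \<inter> fst c')" for c c' x
      using trans[OF that(1,2)] that(3) unfolding Ck_on.simps by blast
    show "continuous_on (snd c ` (fst c \<inter> fst c')) (\<lambda>x. frechet_derivative (snd c' \<circ> chart_inv c) (at x) v)"
      if "c \<in> A" "c' \<in> A" for c c' v
      using trans[OF that] unfolding Ck_on.simps by (blast intro: Ck_on_imp_continuous_on)
    fix c u w assume c: "c \<in> A"
    show "continuous_on (T \<times> snd c ` fst c)
        (\<lambda>(t, x). a t (chart_inv c x) (coord_vec A c (chart_inv c x) u) (coord_vec A c (chart_inv c x) w))"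
      using a c unfolding Ck_riemannian_metric_def by (blast intro: Ck_on_imp_continuous_on)
    show "continuous_on (T \<times> snd c ` fst c) (\<lambda>(t, x). b t (chart_inv c x) (coord_vec A c (chart_inv c x) u))"
      using b c unfolding Ck_one_form_def by (blast intro: Ck_on_imp_continuous_on)
    show "continuous_on (T \<times> snd c ` fst c) (\<lambda>(t, x). V t (chart_inv c x))"
      using V c unfolding Ck_function_def by (blast intro: Ck_on_imp_continuous_on)
  next
    fix t q \<xi> \<eta> assume t: "t \<in> T" and \<xi>: "\<xi> \<in> tangent_space A q"
    show "a t q \<xi> \<xi> > 0" if "\<xi> \<noteq> (\<lambda>_. 0)"
      using a t \<xi> that unfolding Ck_riemannian_metric_def by blast
    assume \<eta>: "\<eta> \<in> tangent_space A q"
    show "a t q \<xi> \<eta> = a t q \<eta> \<xi>"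
      using a t \<xi> \<eta> unfolding Ck_riemannian_metric_def by blast
    fix m n
    show "b t q (\<lambda>c. m *\<^sub>R \<xi> c + n *\<^sub>R \<eta> c) = m * b t q \<xi> + n * b t q \<eta>"
      using b t \<xi> \<eta> unfolding Ck_one_form_def by blast
    fix \<zeta> assume \<zeta>: "\<zeta> \<in> tangent_space A q"
    show "a t q (\<lambda>c. m *\<^sub>R \<xi> c + n *\<^sub>R \<eta> c) \<zeta> = m * a t q \<xi> \<zeta> + n * a t q \<eta> \<zeta>"
      using a t \<xi> \<eta> \<zeta> unfolding Ck_riemannian_metric_def by blast
  qed
  then show ?thesis by (rule that)
qed

theorem theorem4p9:
  fixes r d :: nat
    and T :: "real set"
    and A :: "('q::t2_space, 'v::real_inner) chart set"
    and a :: "real \<Rightarrow> 'q \<Rightarrow> ('q, 'v) tvec \<Rightarrow> ('q, 'v) tvec \<Rightarrow> real"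
    and b :: "real \<Rightarrow> 'q \<Rightarrow> ('q, 'v) tvec \<Rightarrow> real"
    and V :: "real \<Rightarrow> 'q \<Rightarrow> real"
    and e1 :: "real \<times> 'q"
    and y1 :: real
  assumes "r \<ge> 2"
    and "manifold (r + 1) d A"
    and "connected (UNIV :: 'q set)"
    and "open T" and "connected T"
    and "Ck_riemannian_metric r T A a"
    and "Ck_one_form r T A b"
    and "Ck_function r T A V"
    and "e1 \<in> T \<times> UNIV"
  shows "(future_distinguishing_at T A a b V (e1, y1) \<longleftrightarrow>
            lsc_at_within (T \<times> UNIV) (\<lambda>e. least_action A a b V e1 e) e1) \<and>
         (past_distinguishing_at T A a b V (e1, y1) \<longleftrightarrow>
            lsc_at_within (T \<times> UNIV) (\<lambda>e. least_action A a b V e e1) e1)"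
proof -
  obtain B where "gw_fields A B T a b V"
    using gw_fields_if_Ck[OF assms(2,4-8)] .
  then interpret gw_fields A B T a b V .
  have "fst e1 \<in> T" using assms(9) by auto
  then show ?thesis
    using future_distinguishing_iff past_distinguishing_iff by blast
qed

end
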